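(* Let $\omega:\mathbb{Z}_{+}\to[1,+\infty)$ be such that: (i) $\lim_{n\to\infty}\omega(n)^{1/n}=1$; (ii) for every integer $k\geq0$, the sequence $n\mapsto\log\bigl(\omega(n)(n+1)^{-k}\bigr)$ is concave for large $n$; (iii) $\omega$ is log-convex; and (iv) $\sum_{n\geq0}\frac{\log\omega(n)}{n^{3/2}+1}=\infty$. Let $T=S_\omega$ be the corresponding (quasianalytic) unilateral shift operator on $\ell^2(\mathbb{Z}_+)$. Then $\operatorname{Lat}(T)=\operatorname{Lat}_{ns}(T)$.
   Context: $\mathbb{Z}_+=\{0,1,2,\ldots\}$. $S_\omega:\ell^2(\mathbb{Z}_+)\to\ell^2(\mathbb{Z}_+)$ is the weighted unilateral shift $S_\omega e_n=\frac{\omega(n+1)}{\omega(n)}e_{n+1}$, where $\{e_n\}_{n\geq0}$ is the standard orthonormal basis. A function $\omega$ on $\mathbb{Z}_+$ is called log-convex here if it extends to a function on $\mathbb{R}_+$ such that $t\mapsto\log\omega(\exp t)$ is convex for large $t$. $\operatorname{Lat}(T)$ is the set of all closed subspaces of $\mathcal{H}$ invariant under $T\in\mathcal{B}(\mathcal{H})$; a closed subspace $M$ is identified with the orthogonal projection $P_M$ onto it. $M\in\operatorname{Lat}(T)$ is norm stable if, whenever $\{T_n\}$ is a sequence in $\mathcal{B}(\mathcal{H})$ with $\|T_n-T\|\to0$, there are $P_n\in\operatorname{Lat}(T_n)$ ($n\geq1$) with $\|P_n-P_M\|\to0$. $\operatorname{Lat}_{ns}(T)$ is the set of norm-stable invariant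 subspaces of $T$. *)

theory Defs
  imports "HOL-Analysis.Analysis"
begin

section \<open>The complex Hilbert space of square-summable sequences\<close>

lemma summable_norm_sq_add:
  fixes x y :: "nat \<Rightarrow> complex"
  assumes "summable (\<lambda>n. (norm (x n))\<^sup>2)" "summable (\<lambda>n. (norm (y n))\<^sup>2)"
  shows "summable (\<lambda>n. (norm (x n + y n))\<^sup>2)"
proof (rule summable_comparison_test')
  show "summable (\<lambda>n. 2 * (norm (x n))\<^sup>2 + 2 * (norm (y n))\<^sup>2)"
    by (intro summable_add summable_mult assms)
  fix n :: nat
  have "(norm (x n + y n))\<^sup>2 \<le> (norm (x n) + norm (y n))\<^sup>2"
    by (intro power_mono norm_triangle_ineq) auto
  also have "\<dots> \<le> 2 * (norm (x n))\<^sup>2 + 2 * (norm (y n))\<^sup>2"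
    using zero_le_power2[of "norm (x n) - norm (y n)"]
    by (simp add: power2_sum power2_diff)
  finally show "norm ((norm (x n + y n))\<^sup>2) \<le> 2 * (norm (x n))\<^sup>2 + 2 * (norm (y n))\<^sup>2"
    by simp
qed

lemma summable_norm_sq_mult:
  fixes x :: "nat \<Rightarrow> complex"
  assumes "summable (\<lambda>n. (norm (x n))\<^sup>2)"
  shows "summable (\<lambda>n. (norm (c * x n))\<^sup>2)"
  using summable_mult[OF assms, of "(norm c)\<^sup>2"] by (simp add: norm_mult power_mult_distrib)

lemma summable_mult_cnj:
  fixes x y :: "nat \<Rightarrow> complex"
  assumes "summable (\<lambda>n. (norm (x n))\<^sup>2)" "summable (\<lambda>n. (norm (y n))\<^sup>2)"
  shows "summable (\<lambda>n. x n * cnj (y n))"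
proof (rule summable_comparison_test')
  show "summable (\<lambda>n. (norm (x n))\<^sup>2 + (norm (y n))\<^sup>2)"
    by (intro summable_add assms)
  fix n :: nat
  have "norm (x n * cnj (y n)) = norm (x n) * norm (y n)"
    by (simp add: norm_mult)
  also have "\<dots> \<le> (norm (x n))\<^sup>2 + (norm (y n))\<^sup>2"
    using zero_le_power2[of "norm (x n) - norm (y n)"]
      zero_le_power2[of "norm (x n)"] zero_le_power2[of "norm (y n)"]
    unfolding power2_diff by linarith
  finally show "norm (x n * cnj (y n)) \<le> (norm (x n))\<^sup>2 + (norm (y n))\<^sup>2" .
qed

typedef ell2 = "{x :: nat \<Rightarrow> complex. summable (\<lambda>n. (norm (x n))\<^sup>2)}"
  morphisms coord Abs_ell2
  by (rule exI[of _ "\<lambda>_. 0"]) simp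

setup_lifting type_definition_ell2

lemma summable_coord: "summable (\<lambda>n. (norm (coord x n))\<^sup>2)"
  using coord[of x] by simp

lemma ell2_eqI: "(\<And>n. coord x n = coord y n) \<Longrightarrow> x = y"
  by (simp add: coord_inject[symmetric] fun_eq_iff)

lift_definition scaleC :: "complex \<Rightarrow> ell2 \<Rightarrow> ell2" (infixr \<open>*\<^sub>C\<close> 75)
  is "\<lambda>c x n. c * x n"
  by (rule summable_norm_sq_mult)

lift_definition basis_vec :: "nat \<Rightarrow> ell2"
  is "\<lambda>k n. if n = k then 1 else 0"
  by (rule summable_finite[of "{k}" for k]) auto

text \<open>Linear in the first argument, conjugate-linear in the second.\<close>

definition cinner :: "ell2 \<Rightarrow> ell2 \<Rightarrow> complex" where
  "cinner x y = (\<Sum>n. coord x n * cnj (coord y n))"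

text \<open>The real inner product space structure is the one underlying the complex one; in
  particular the norm is the usual one, see \<open>norm_ell2\<close> below.\<close>

instantiation ell2 :: real_inner
begin

lift_definition zero_ell2 :: ell2 is "\<lambda>_. 0" by simp

lift_definition plus_ell2 :: "ell2 \<Rightarrow> ell2 \<Rightarrow> ell2" is "\<lambda>x y n. x n + y n"
  by (rule summable_norm_sq_add)

lift_definition uminus_ell2 :: "ell2 \<Rightarrow> ell2" is "\<lambda>x n. - x n" by simp

lift_definition minus_ell2 :: "ell2 \<Rightarrow> ell2 \<Rightarrow> ell2" is "\<lambda>x y n. x n - y n"
  using summable_norm_sq_add[of _ "\<lambda>n. - y n" for y] by fastforce

definition scaleR_ell2 :: "real \<Rightarrow> ell2 \<Rightarrow> ell2" where
  "scaleR_ell2 r x = of_real r *\<^sub>C x"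

definition inner_ell2 :: "ell2 \<Rightarrow> ell2 \<Rightarrow> real" where
  "inner_ell2 x y = Re (cinner x y)"

definition norm_ell2 :: "ell2 \<Rightarrow> real" where
  "norm_ell2 x = sqrt (inner x x)"

definition sgn_ell2 :: "ell2 \<Rightarrow> ell2" where
  "sgn_ell2 x = inverse (norm x) *\<^sub>R x"

definition dist_ell2 :: "ell2 \<Rightarrow> ell2 \<Rightarrow> real" where
  "dist_ell2 x y = norm (x - y)"

definition uniformity_ell2 :: "(ell2 \<times> ell2) filter" where
  "uniformity_ell2 = (INF e\<in>{0<..}. principal {(x, y). dist x y < e})"

definition open_ell2 :: "ell2 set \<Rightarrow> bool" where
  "open_ell2 U \<longleftrightarrow> (\<forall>x\<in>U. eventually (\<lambda>(x', y). x' = x \<longrightarrow> y \<in> U) uniformity)"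

lemma cinner_summable: "summable (\<lambda>n. coord x n * cnj (coord y n))"
  by (intro summable_mult_cnj summable_coord)

lemma cinner_self: "cinner x x = of_real (\<Sum>n. (norm (coord x n))\<^sup>2)"
  unfolding cinner_def complex_norm_square[symmetric]
  by (rule suminf_of_real[OF summable_coord, symmetric])

instance
proof
  fix x y z :: ell2 and r s :: real
  show "x + y + z = x + (y + z)" by transfer (simp add: add.assoc)
  show "x + y = y + x" by transfer (simp add: add.commute)
  show "0 + x = x" by transfer simp
  show "- x + x = 0" by transfer simp
  show "x - y = x + - y" by transfer simp
  show "r *\<^sub>R (x + y) = r *\<^sub>R x + r *\<^sub>R y"
    unfolding scaleR_ell2_def by transfer (simp add: algebra_simps)
  show "(r + s) *\<^sub>R x = r *\<^sub>R x + s *\<^sub>R x"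
    unfolding scaleR_ell2_def by transfer (simp add: algebra_simps)
  show "r *\<^sub>R s *\<^sub>R x = (r * s) *\<^sub>R x"
    unfolding scaleR_ell2_def by transfer (simp add: algebra_simps)
  show "1 *\<^sub>R x = x"
    unfolding scaleR_ell2_def by transfer simp
  show "sgn x = inverse (norm x) *\<^sub>R x" by (rule sgn_ell2_def)
  show "dist x y = norm (x - y)" by (rule dist_ell2_def)
  show "uniformity = (INF e\<in>{0<..}. principal {(x, y :: ell2). dist x y < e})"
    by (rule uniformity_ell2_def)
  show "open U \<longleftrightarrow> (\<forall>x\<in>U. eventually (\<lambda>(x', y). x' = x \<longrightarrow> y \<in> U) uniformity)"
    for U :: "ell2 set"
    by (rule open_ell2_def)
  have re: "inner x y = (\<Sum>n. Re (coord x n * cnj (coord y n)))" for x y :: ell2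
    unfolding inner_ell2_def cinner_def
    by (rule Re_suminf[OF cinner_summable])
  have sre: "summable (\<lambda>n. Re (coord x n * cnj (coord y n)))" for x y :: ell2
    by (rule summable_Re[OF cinner_summable])
  show "inner x y = inner y x"
    unfolding re by (simp add: algebra_simps)
  show "inner (x + y) z = inner x z + inner y z"
    unfolding re suminf_add[OF sre sre] by (simp add: plus_ell2.rep_eq algebra_simps)
  show "inner (r *\<^sub>R x) y = r * inner x y"
    unfolding re suminf_mult[OF sre, symmetric] scaleR_ell2_def
    by (simp add: scaleC.rep_eq algebra_simps)
  have self: "inner x x = (\<Sum>n. (norm (coord x n))\<^sup>2)"
    by (simp add: inner_ell2_def cinner_self)
  show "0 \<le> inner x x"
    unfolding self by (intro suminf_nonneg summable_coord) simp
  show "inner x x = 0 \<longleftrightarrow> x = 0"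
    unfolding self suminf_eq_zero_iff[OF summable_coord zero_le_power2]
    by transfer (auto simp: fun_eq_iff)
  show "norm x = sqrt (inner x x)" by (rule norm_ell2_def)
qed

end

lemma coord_simps [simp]:
  "coord 0 n = 0" "coord (x + y) n = coord x n + coord y n" "coord (- x) n = - coord x n"
  "coord (x - y) n = coord x n - coord y n" "coord (c *\<^sub>C x) n = c * coord x n"
  "coord (r *\<^sub>R x) n = of_real r * coord x n"
  "coord (basis_vec k) n = (if n = k then 1 else 0)"
  by (simp_all add: zero_ell2.rep_eq plus_ell2.rep_eq uminus_ell2.rep_eq minus_ell2.rep_eq
      scaleC.rep_eq scaleR_ell2_def basis_vec.rep_eq)

lemma norm_ell2: "norm x = sqrt (\<Sum>n. (norm (coord x n))\<^sup>2)"
  by (simp add: norm_ell2_def inner_ell2_def cinner_self)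

lemma power2_norm_ell2: "(norm x)\<^sup>2 = (\<Sum>n. (norm (coord x n))\<^sup>2)" for x :: ell2
  by (simp add: norm_ell2 suminf_nonneg summable_coord)

lemma norm_scaleC: "norm (c *\<^sub>C x) = norm c * norm x"
proof -
  have "(\<Sum>n. (norm (coord (c *\<^sub>C x) n))\<^sup>2) = (norm c)\<^sup>2 * (\<Sum>n. (norm (coord x n))\<^sup>2)"
    by (subst suminf_mult[OF summable_coord, symmetric]) (simp add: norm_mult power_mult_distrib)
  then show ?thesis by (simp add: norm_ell2 real_sqrt_mult)
qed

lemma cinner_add_left: "cinner (x + y) z = cinner x z + cinner y z"
  unfolding cinner_def suminf_add[OF cinner_summable cinner_summable]
  by (simp add: algebra_simps)

lemma cinner_scaleC_left: "cinner (c *\<^sub>C x) y = c * cinner x y"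
  unfolding cinner_def suminf_mult[OF cinner_summable, symmetric]
  by (simp add: algebra_simps)

lemma cinner_scaleC_right: "cinner x (c *\<^sub>C y) = cnj c * cinner x y"
  unfolding cinner_def suminf_mult[OF cinner_summable, symmetric]
  by (simp add: algebra_simps)

lemma cinner_diff_left: "cinner (x - y) z = cinner x z - cinner y z"
  using cinner_add_left[of "x - y" y z] by simp

lemma norm_coord_le: "norm (coord x n) \<le> norm x"
proof -
  have "(\<Sum>k\<in>{n}. (norm (coord x k))\<^sup>2) \<le> (\<Sum>k. (norm (coord x k))\<^sup>2)"
    by (intro sum_le_suminf summable_coord) auto
  then show ?thesis
    unfolding norm_ell2 by (simp add: real_le_rsqrt)
qed

instance ell2 :: complete_space
proof
  fix X :: "nat \<Rightarrow> ell2"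
  assume X: "Cauchy X"
  have "Cauchy (\<lambda>n. coord (X n) k)" for k
  proof (rule CauchyI)
    fix e :: real assume "0 < e"
    then obtain M where M: "\<forall>m\<ge>M. \<forall>n\<ge>M. norm (X m - X n) < e"
      using CauchyD[OF X] by blast
    have "norm (coord (X m) k - coord (X n) k) \<le> norm (X m - X n)" for m n
      using norm_coord_le[of "X m - X n" k] by simp
    with M show "\<exists>M. \<forall>m\<ge>M. \<forall>n\<ge>M. norm (coord (X m) k - coord (X n) k) < e"
      by (meson le_less_trans)
  qed
  then have "\<exists>l. (\<lambda>n. coord (X n) k) \<longlonglongrightarrow> l" for k
    by (simp add: Cauchy_convergent_iff convergent_def)
  then obtain l where l: "\<And>k. (\<lambda>n. coord (X n) k) \<longlonglongrightarrow> l k"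
    by metis
  have bound: "\<exists>M. \<forall>m\<ge>M. \<forall>K. (\<Sum>k<K. (norm (coord (X m) k - l k))\<^sup>2) \<le> e\<^sup>2"
    if "0 < e" for e :: real
  proof -
    obtain M where M: "\<forall>m\<ge>M. \<forall>n\<ge>M. norm (X m - X n) < e"
      using CauchyD[OF X \<open>0 < e\<close>] by blast
    have "(\<Sum>k<K. (norm (coord (X m) k - l k))\<^sup>2) \<le> e\<^sup>2" if "m \<ge> M" for m K
    proof (rule tendsto_upperbound)
      show "(\<lambda>n. \<Sum>k<K. (norm (coord (X m) k - coord (X n) k))\<^sup>2)
              \<longlonglongrightarrow> (\<Sum>k<K. (norm (coord (X m) k - l k))\<^sup>2)"
        by (intro tendsto_intros l)
      have "(\<Sum>k<K. (norm (coord (X m) k - coord (X n) k))\<^sup>2) \<le> e\<^sup>2" if "n \<ge> M" for n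
      proof -
        have "(\<Sum>k<K. (norm (coord (X m - X n) k))\<^sup>2) \<le> (norm (X m - X n))\<^sup>2"
          unfolding power2_norm_ell2 by (intro sum_le_suminf summable_coord) auto
        also have "\<dots> \<le> e\<^sup>2"
          using M \<open>m \<ge> M\<close> \<open>n \<ge> M\<close> by (intro power_mono) (auto intro: less_imp_le)
        finally show ?thesis by simp
      qed
      then show "\<forall>\<^sub>F n in sequentially. (\<Sum>k<K. (norm (coord (X m) k - coord (X n) k))\<^sup>2) \<le> e\<^sup>2"
        by (auto simp: eventually_at_top_linorder)
    qed simp
    then show ?thesis by blast
  qed
  have summ: "summable (\<lambda>k. (norm (coord (X m) k - l k))\<^sup>2)"
    if "\<forall>K. (\<Sum>k<K. (norm (coord (X m) k - l k))\<^sup>2) \<le> e\<^sup>2" for m and e :: real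
    using that by (intro summableI_nonneg_bounded[where x = "e\<^sup>2"]) auto
  obtain m0 where "\<forall>K. (\<Sum>k<K. (norm (coord (X m0) k - l k))\<^sup>2) \<le> 1\<^sup>2"
    using bound[of 1] by auto
  from summable_norm_sq_add[OF summ[OF this] summable_norm_sq_mult[OF summable_coord, of "-1" "X m0"]]
  have "summable (\<lambda>k. (norm (l k))\<^sup>2)" by simp
  then have L: "coord (Abs_ell2 l) = l" by (simp add: Abs_ell2_inverse)
  have "X \<longlonglongrightarrow> Abs_ell2 l"
  proof (rule LIMSEQ_I)
    fix e :: real assume "0 < e"
    then obtain M where M: "\<forall>m\<ge>M. \<forall>K. (\<Sum>k<K. (norm (coord (X m) k - l k))\<^sup>2) \<le> (e/2)\<^sup>2"
      using bound[of "e/2"] by auto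
    have "norm (X m - Abs_ell2 l) < e" if "m \<ge> M" for m
    proof -
      from M that have *: "\<forall>K. (\<Sum>k<K. (norm (coord (X m) k - l k))\<^sup>2) \<le> (e/2)\<^sup>2" by blast
      have "(norm (X m - Abs_ell2 l))\<^sup>2 \<le> (e/2)\<^sup>2"
        unfolding power2_norm_ell2 using suminf_le_const[OF summ[OF *]] * by (simp add: L)
      then have "norm (X m - Abs_ell2 l) \<le> e/2"
        using \<open>0 < e\<close> power2_le_imp_le[of "norm (X m - Abs_ell2 l)" "e/2"] by simp
      with \<open>0 < e\<close> show ?thesis by linarith
    qed
    then show "\<exists>M. \<forall>m\<ge>M. norm (X m - Abs_ell2 l) < e" by blast
  qed
  then show "convergent X" by (auto simp: convergent_def)
qed

section \<open>Operators, invariant subspaces and orthogonal projections\<close>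

text \<open>The type \<open>ell2 \<Rightarrow>\<^sub>L ell2\<close> consists of the bounded real-linear maps with the operator norm,
  so that membership in the algebra of bounded operators only has to add complex homogeneity.\<close>

definition bounded_ops :: "(ell2 \<Rightarrow>\<^sub>L ell2) set" where
  "bounded_ops = {T. \<forall>c x. blinfun_apply T (c *\<^sub>C x) = c *\<^sub>C blinfun_apply T x}"

definition closed_csubspace :: "ell2 set \<Rightarrow> bool" where
  "closed_csubspace M \<longleftrightarrow>
     closed M \<and> 0 \<in> M \<and> (\<forall>x\<in>M. \<forall>y\<in>M. x + y \<in> M) \<and> (\<forall>c. \<forall>x\<in>M. c *\<^sub>C x \<in> M)"

definition Lat :: "(ell2 \<Rightarrow>\<^sub>L ell2) \<Rightarrow> ell2 set set" where
  "Lat T = {M. closed_csubspace M \<and> (\<forall>x\<in>M. blinfun_apply T x \<in> M)}"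

text \<open>The orthogonal projection onto \<open>M\<close>; existence and uniqueness for closed subspaces are
  \<open>is_orth_proj_ex1\<close> below.\<close>

definition is_orth_proj :: "ell2 set \<Rightarrow> (ell2 \<Rightarrow>\<^sub>L ell2) \<Rightarrow> bool" where
  "is_orth_proj M P \<longleftrightarrow>
     (\<forall>x. blinfun_apply P x \<in> M \<and> (\<forall>y\<in>M. cinner (x - blinfun_apply P x) y = 0))"

definition orth_proj :: "ell2 set \<Rightarrow> ell2 \<Rightarrow>\<^sub>L ell2" where
  "orth_proj M = (THE P. is_orth_proj M P)"

definition norm_stable :: "(ell2 \<Rightarrow>\<^sub>L ell2) \<Rightarrow> ell2 set \<Rightarrow> bool" where
  "norm_stable T M \<longleftrightarrow>
     (\<forall>Tn :: nat \<Rightarrow> ell2 \<Rightarrow>\<^sub>L ell2.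
        (\<forall>n. Tn n \<in> bounded_ops) \<longrightarrow> (\<lambda>n. norm (Tn n - T)) \<longlonglongrightarrow> 0 \<longrightarrow>
        (\<exists>Mn. (\<forall>n. Mn n \<in> Lat (Tn n)) \<and>
              (\<lambda>n. norm (orth_proj (Mn n) - orth_proj M)) \<longlonglongrightarrow> 0))"

definition Lat_ns :: "(ell2 \<Rightarrow>\<^sub>L ell2) \<Rightarrow> ell2 set set" where
  "Lat_ns T = {M \<in> Lat T. norm_stable T M}"

lemma closed_csubspace_diff:
  assumes "closed_csubspace M" "x \<in> M" "y \<in> M" shows "x - y \<in> M"
proof -
  have "(-1) *\<^sub>C y = - y" by (rule ell2_eqI) simp
  with assms have "x + - y \<in> M" unfolding closed_csubspace_def by metis
  then show ?thesis by simp
qed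

lemma closed_csubspace_scaleR:
  assumes "closed_csubspace M" "x \<in> M" shows "r *\<^sub>R x \<in> M"
  using assms unfolding closed_csubspace_def scaleR_ell2_def by blast

lemma orth_point_unique:
  assumes M: "closed_csubspace M"
    and "p \<in> M" "\<forall>y\<in>M. cinner (x - p) y = 0" "q \<in> M" "\<forall>y\<in>M. cinner (x - q) y = 0"
  shows "p = q"
proof -
  have "p - q \<in> M" using assms closed_csubspace_diff by blast
  then have "cinner (x - q) (p - q) - cinner (x - p) (p - q) = 0" using assms by simp
  then have "cinner (p - q) (p - q) = 0" by (simp flip: cinner_diff_left)
  then have "inner (p - q) (p - q) = 0" unfolding inner_ell2_def by simp
  then show ?thesis by simp
qed

lemma orth_point_exists:
  assumes M: "closed_csubspace M"
  shows "\<exists>p\<in>M. \<forall>y\<in>M. cinner (x - p) y = 0"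
proof -
  have ne: "M \<noteq> {}" and cl: "closed M" using M by (auto simp: closed_csubspace_def)
  define d where "d = infdist x M"
  have d0: "0 \<le> d" unfolding d_def by (rule infdist_nonneg)
  have dle: "d \<le> norm (x - y)" if "y \<in> M" for y
    using infdist_le[OF that, of x] by (simp add: d_def dist_norm)
  have "\<exists>y\<in>M. (norm (x - y))\<^sup>2 < d\<^sup>2 + 1 / real (Suc n)" for n
  proof -
    have "d < sqrt (d\<^sup>2 + 1 / real (Suc n))"
      by (rule real_less_rsqrt) simp
    then have "(INF a\<in>M. dist x a) < sqrt (d\<^sup>2 + 1 / real (Suc n))"
      using ne by (simp add: d_def infdist_notempty)
    then obtain y where y: "y \<in> M" "dist x y < sqrt (d\<^sup>2 + 1 / real (Suc n))"
      using ne by (subst (asm) cINF_less_iff) (auto intro: bdd_belowI2[of _ 0])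
    have "(norm (x - y))\<^sup>2 < (sqrt (d\<^sup>2 + 1 / real (Suc n)))\<^sup>2"
      using y by (intro power_strict_mono) (auto simp: dist_norm)
    also have "\<dots> = d\<^sup>2 + 1 / real (Suc n)"
      by (rule real_sqrt_pow2) (auto intro: add_nonneg_nonneg)
    finally show ?thesis using y by blast
  qed
  then obtain Y where Y: "\<And>n. Y n \<in> M" "\<And>n. (norm (x - Y n))\<^sup>2 < d\<^sup>2 + 1 / real (Suc n)"
    by metis
  have para: "(norm (Y m - Y n))\<^sup>2 \<le> 2 * (1 / real (Suc m)) + 2 * (1 / real (Suc n))" for m n
  proof -
    have "Y m + Y n \<in> M" using M Y by (auto simp: closed_csubspace_def)
    then have "(1/2) *\<^sub>R (Y m + Y n) \<in> M" using closed_csubspace_scaleR[OF M] by blast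
    then have "d\<^sup>2 \<le> (norm (x - (1/2) *\<^sub>R (Y m + Y n)))\<^sup>2"
      using d0 dle by (intro power_mono) auto
    moreover have "(norm (Y m - Y n))\<^sup>2 + 4 * (norm (x - (1/2) *\<^sub>R (Y m + Y n)))\<^sup>2
        = 2 * (norm (x - Y m))\<^sup>2 + 2 * (norm (x - Y n))\<^sup>2"
      unfolding power2_norm_eq_inner
      by (simp add: inner_diff_left inner_diff_right inner_add_left inner_add_right inner_commute
          algebra_simps)
    ultimately show ?thesis using Y(2)[of m] Y(2)[of n] by linarith
  qed
  have "Cauchy Y"
  proof (rule CauchyI)
    fix e :: real assume "0 < e"
    then obtain K where K: "inverse (real (Suc K)) < e\<^sup>2 / 4"
      using reals_Archimedean[of "e\<^sup>2 / 4"] by auto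
    have "norm (Y m - Y n) < e" if "m \<ge> K" "n \<ge> K" for m n
    proof -
      have "1 / real (Suc m) \<le> 1 / real (Suc K)" "1 / real (Suc n) \<le> 1 / real (Suc K)"
        using that by (auto simp: frac_le)
      with K para[of m n] have "(norm (Y m - Y n))\<^sup>2 < e\<^sup>2"
        unfolding inverse_eq_divide by linarith
      then show ?thesis using \<open>0 < e\<close> power2_less_imp_less[of "norm (Y m - Y n)" e] by simp
    qed
    then show "\<exists>M. \<forall>m\<ge>M. \<forall>n\<ge>M. norm (Y m - Y n) < e" by blast
  qed
  then obtain p where p: "Y \<longlonglongrightarrow> p"
    using Cauchy_convergent_iff convergent_def by blast
  have pM: "p \<in> M" using closed_sequentially[OF cl] Y(1) p by blast
  have "(\<lambda>n. (norm (x - Y n))\<^sup>2) \<longlonglongrightarrow> (norm (x - p))\<^sup>2" by (intro tendsto_intros p)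
  moreover have "(\<lambda>n. d\<^sup>2 + 1 / real (Suc n)) \<longlonglongrightarrow> d\<^sup>2 + 0"
    by (intro tendsto_intros LIMSEQ_Suc[OF lim_1_over_n])
  moreover have "\<exists>N. \<forall>n\<ge>N. (norm (x - Y n))\<^sup>2 \<le> d\<^sup>2 + 1 / real (Suc n)"
    using Y(2) less_imp_le by blast
  ultimately have "(norm (x - p))\<^sup>2 \<le> d\<^sup>2 + 0"
    by (rule LIMSEQ_le)
  then have pd: "(norm (x - p))\<^sup>2 \<le> d\<^sup>2" by simp
  have re: "inner (x - p) y = 0" if "y \<in> M" for y
  proof (cases "y = 0")
    case False
    define t where "t = inner (x - p) y / inner y y"
    have yy: "inner y y \<noteq> 0" using False by simp
    have "p + t *\<^sub>R y \<in> M"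
      using pM closed_csubspace_scaleR[OF M that] M by (auto simp: closed_csubspace_def)
    then have "d\<^sup>2 \<le> (norm (x - (p + t *\<^sub>R y)))\<^sup>2"
      using d0 dle by (intro power_mono) auto
    with pd have "(norm (x - p))\<^sup>2 \<le> (norm ((x - p) - t *\<^sub>R y))\<^sup>2"
      unfolding diff_diff_add by (rule order_trans)
    also have "\<dots> = (norm (x - p))\<^sup>2 - 2 * t * inner (x - p) y + t * t * inner y y"
      unfolding power2_norm_eq_inner
      by (simp only: inner_diff_left inner_diff_right inner_scaleR_left inner_scaleR_right
          inner_commute[of y x] inner_commute[of y p]) (simp add: algebra_simps)
    also have "t * t * inner y y = t * inner (x - p) y" using yy by (simp add: t_def)
    finally have "t * inner (x - p) y \<le> 0" by simp
    then have "(inner (x - p) y)\<^sup>2 / inner y y \<le> 0" by (simp add: t_def power2_eq_square)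
    moreover have "0 < inner y y" using False by simp
    ultimately show ?thesis by (simp add: divide_le_0_iff)
  qed simp
  have "cinner (x - p) y = 0" if "y \<in> M" for y
  proof -
    have "\<i> *\<^sub>C y \<in> M" using M that by (auto simp: closed_csubspace_def)
    from re[OF that] re[OF this] show ?thesis
      unfolding inner_ell2_def by (simp add: cinner_scaleC_right complex_eq_iff)
  qed
  with pM show ?thesis by blast
qed

lemma is_orth_proj_ex1:
  assumes M: "closed_csubspace M"
  shows "\<exists>!P. is_orth_proj M P"
proof -
  obtain f where f: "\<And>x. f x \<in> M" "\<And>x y. y \<in> M \<Longrightarrow> cinner (x - f x) y = 0"
    using orth_point_exists[OF M] by metis
  have fI: "f x = q" if "q \<in> M" "\<And>y. y \<in> M \<Longrightarrow> cinner (x - q) y = 0" for x q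
    using orth_point_unique[OF M f(1) _ that(1)] f(2) that(2) by blast
  have "bounded_linear f"
  proof (rule bounded_linear_intro[where K = 1])
    fix x y :: ell2 and r :: real
    show "f (x + y) = f x + f y"
    proof (rule fI)
      show "f x + f y \<in> M" using M f(1) by (auto simp: closed_csubspace_def)
      fix z assume "z \<in> M"
      have "x + y - (f x + f y) = (x - f x) + (y - f y)" by simp
      with \<open>z \<in> M\<close> show "cinner (x + y - (f x + f y)) z = 0"
        by (simp only: cinner_add_left f(2) add_0)
    qed
    show "f (r *\<^sub>R x) = r *\<^sub>R f x"
    proof (rule fI)
      show "r *\<^sub>R f x \<in> M" using closed_csubspace_scaleR[OF M f(1)] .
      fix z assume "z \<in> M"
      have "r *\<^sub>R x - r *\<^sub>R f x = of_real r *\<^sub>C (x - f x)"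
        by (simp add: scaleR_ell2_def[symmetric] algebra_simps)
      with \<open>z \<in> M\<close> show "cinner (r *\<^sub>R x - r *\<^sub>R f x) z = 0"
        by (simp add: cinner_scaleC_left f(2))
    qed
    have "inner (x - f x) (f x) = 0" using f by (simp add: inner_ell2_def)
    then have "inner x (f x) = inner (f x) (f x)" by (simp add: inner_diff_left)
    then have "(norm (f x))\<^sup>2 \<le> norm x * norm (f x)"
      using norm_cauchy_schwarz[of x "f x"] by (simp add: power2_norm_eq_inner)
    then show "norm (f x) \<le> norm x * 1"
      by (cases "norm (f x) = 0") (auto simp: power2_eq_square)
  qed
  then have "is_orth_proj M (Blinfun f)"
    unfolding is_orth_proj_def by (simp add: bounded_linear_Blinfun_apply f)
  moreover have "P = Q" if "is_orth_proj M P" "is_orth_proj M Q" for P Q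
  proof (rule blinfun_eqI)
    fix x
    from that show "blinfun_apply P x = blinfun_apply Q x"
      unfolding is_orth_proj_def using orth_point_unique[OF M] by blast
  qed
  ultimately show ?thesis by blast
qed

lemma is_orth_proj_orth_proj: "closed_csubspace M \<Longrightarrow> is_orth_proj M (orth_proj M)"
  unfolding orth_proj_def by (rule theI'[OF is_orth_proj_ex1])

section \<open>Weighted shifts\<close>

text \<open>The operator exists and is unique when the weights \<open>w (n + 1) / w n\<close> are bounded, see
  \<open>weighted_shift_ex1\<close>; \<open>shift_weights_bounded\<close> gives a criterion.\<close>

definition is_weighted_shift :: "(nat \<Rightarrow> real) \<Rightarrow> (ell2 \<Rightarrow>\<^sub>L ell2) \<Rightarrow> bool" where
  "is_weighted_shift w S \<longleftrightarrow> S \<in> bounded_ops \<and>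
     (\<forall>n. blinfun_apply S (basis_vec n) = of_real (w (n + 1) / w n) *\<^sub>C basis_vec (n + 1))"

definition weighted_shift :: "(nat \<Rightarrow> real) \<Rightarrow> ell2 \<Rightarrow>\<^sub>L ell2" where
  "weighted_shift w = (THE S. is_weighted_shift w S)"

definition eventually_concave :: "(nat \<Rightarrow> real) \<Rightarrow> bool" where
  "eventually_concave a \<longleftrightarrow> (\<forall>\<^sub>F n in sequentially. a n + a (n + 2) \<le> 2 * a (n + 1))"

definition log_convex :: "(nat \<Rightarrow> real) \<Rightarrow> bool" where
  "log_convex w \<longleftrightarrow> (\<exists>f :: real \<Rightarrow> real.
     (\<forall>n. f (real n) = w n) \<and> (\<forall>x\<ge>0. f x > 0) \<and>
     (\<exists>t0. convex_on {t0..} (\<lambda>t. ln (f (exp t)))))"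

lemma coord_sum: "coord (sum f A) n = (\<Sum>k\<in>A. coord (f k) n)"
  by (induction A rule: infinite_finite_induct) auto

lemma basis_expansion: "(\<lambda>K. \<Sum>k<K. coord x k *\<^sub>C basis_vec k) \<longlonglongrightarrow> x"
proof -
  have c: "coord (x - (\<Sum>k<K. coord x k *\<^sub>C basis_vec k)) n = (if n < K then 0 else coord x n)"
    for K n
    by (simp add: coord_sum if_distrib[of "\<lambda>t. _ * t"] cong: if_cong)
  have "(norm (x - (\<Sum>k<K. coord x k *\<^sub>C basis_vec k)))\<^sup>2 = (\<Sum>n. (norm (coord x (n + K)))\<^sup>2)" for K
  proof -
    have "(norm (x - (\<Sum>k<K. coord x k *\<^sub>C basis_vec k)))\<^sup>2 =
        (\<Sum>n. (norm (coord (x - (\<Sum>k<K. coord x k *\<^sub>C basis_vec k)) (n + K)))\<^sup>2)"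
      unfolding power2_norm_ell2
      by (subst suminf_split_initial_segment[OF summable_coord, of _ K])
        (simp add: c del: coord_simps(4))
    then show ?thesis by (simp add: c del: coord_simps(4))
  qed
  moreover have "(\<lambda>K. \<Sum>n. (norm (coord x (n + K)))\<^sup>2) \<longlonglongrightarrow> 0"
    by (rule suminf_exist_split2[OF summable_coord])
  ultimately have "(\<lambda>K. (norm (x - (\<Sum>k<K. coord x k *\<^sub>C basis_vec k)))\<^sup>2) \<longlonglongrightarrow> 0"
    by simp
  then have "(\<lambda>K. sqrt ((norm (x - (\<Sum>k<K. coord x k *\<^sub>C basis_vec k)))\<^sup>2)) \<longlonglongrightarrow> sqrt 0"
    by (rule tendsto_real_sqrt)
  then have "(\<lambda>K. norm ((\<Sum>k<K. coord x k *\<^sub>C basis_vec k) - x)) \<longlonglongrightarrow> 0"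
    by (simp add: norm_minus_commute)
  then show ?thesis
    using Lim_null tendsto_norm_zero_iff by blast
qed

lemma bounded_ops_eqI:
  assumes S: "S \<in> bounded_ops" and T: "T \<in> bounded_ops"
    and eq: "\<And>n. blinfun_apply S (basis_vec n) = blinfun_apply T (basis_vec n)"
  shows "S = T"
proof (rule blinfun_eqI)
  fix x
  let ?p = "\<lambda>K. \<Sum>k<K. coord x k *\<^sub>C basis_vec k"
  have "blinfun_apply S (?p K) = blinfun_apply T (?p K)" for K
    using S T eq by (simp add: blinfun.sum_right bounded_ops_def)
  moreover have "(\<lambda>K. blinfun_apply S (?p K)) \<longlonglongrightarrow> blinfun_apply S x"
    "(\<lambda>K. blinfun_apply T (?p K)) \<longlonglongrightarrow> blinfun_apply T x"
    by (intro tendsto_intros basis_expansion)+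
  ultimately show "blinfun_apply S x = blinfun_apply T x"
    using LIMSEQ_unique by auto
qed

lemma weighted_shift_ex1:
  assumes bdd: "bdd_above (range (\<lambda>n. \<bar>w (n + 1) / w n\<bar>))"
  shows "\<exists>!S. is_weighted_shift w S"
proof -
  obtain B where B: "\<And>n. \<bar>w (n + 1) / w n\<bar> \<le> B"
    using bdd by (auto simp: bdd_above_def)
  have B0: "0 \<le> B" using B[of 0] by linarith
  define g where "g x n = (case n of 0 \<Rightarrow> 0 | Suc m \<Rightarrow> of_real (w (m + 1) / w m) * coord x m)"
    for x :: ell2 and n
  have g0: "g x 0 = 0" and gS: "g x (Suc m) = of_real (w (m + 1) / w m) * coord x m" for x m
    by (simp_all add: g_def)
  have le: "(norm (g x (Suc m)))\<^sup>2 \<le> B\<^sup>2 * (norm (coord x m))\<^sup>2" for x m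
  proof -
    have "norm (g x (Suc m)) \<le> B * norm (coord x m)"
      unfolding gS norm_mult norm_of_real by (intro mult_right_mono B) simp
    then have "(norm (g x (Suc m)))\<^sup>2 \<le> (B * norm (coord x m))\<^sup>2"
      by (rule power_mono) simp
    then show ?thesis by (simp add: power_mult_distrib)
  qed
  have sS: "summable (\<lambda>m. (norm (g x (Suc m)))\<^sup>2)" for x
    by (rule summable_comparison_test'[OF summable_mult[OF summable_coord[of x], of "B\<^sup>2"]])
      (use le in simp)
  then have s: "summable (\<lambda>m. (norm (g x m))\<^sup>2)" for x
    using summable_Suc_iff[of "\<lambda>m. (norm (g x m))\<^sup>2"] by simp
  define f where "f x = Abs_ell2 (g x)" for x
  have cf: "coord (f x) n = g x n" for x n
    using s by (simp add: f_def Abs_ell2_inverse)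
  have "bounded_linear f"
  proof (rule bounded_linear_intro[where K = B])
    fix x y :: ell2 and r :: real
    show "f (x + y) = f x + f y"
      by (rule ell2_eqI) (simp add: cf g_def distrib_left add_divide_distrib split: nat.split)
    show "f (r *\<^sub>R x) = r *\<^sub>R f x"
      by (rule ell2_eqI) (simp add: cf g_def algebra_simps split: nat.split)
    have "(norm (f x))\<^sup>2 = (\<Sum>m. (norm (g x (Suc m)))\<^sup>2)"
      using suminf_split_head[OF s[of x]] by (simp add: power2_norm_ell2 cf g0)
    also have "\<dots> \<le> (\<Sum>m. B\<^sup>2 * (norm (coord x m))\<^sup>2)"
      by (intro suminf_le le sS summable_mult summable_coord)
    also have "\<dots> = (norm x * B)\<^sup>2"
      by (simp add: suminf_mult[OF summable_coord] power2_norm_ell2 power_mult_distrib)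
    finally show "norm (f x) \<le> norm x * B"
      by (rule power2_le_imp_le) (simp add: B0)
  qed
  then have ap: "blinfun_apply (Blinfun f) = f" by (rule bounded_linear_Blinfun_apply)
  have "is_weighted_shift w (Blinfun f)"
    unfolding is_weighted_shift_def bounded_ops_def mem_Collect_eq ap
    by (intro conjI allI ell2_eqI) (auto simp: cf g_def split: nat.split)
  moreover have "S = T" if "is_weighted_shift w S" "is_weighted_shift w T" for S T
    using that unfolding is_weighted_shift_def by (intro bounded_ops_eqI) auto
  ultimately show ?thesis by blast
qed

lemma is_weighted_shift_weighted_shift:
  "bdd_above (range (\<lambda>n. \<bar>w (n + 1) / w n\<bar>)) \<Longrightarrow> is_weighted_shift w (weighted_shift w)"
  unfolding weighted_shift_def by (rule theI'[OF weighted_shift_ex1])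

lemma shift_weights_bounded:
  assumes w: "\<And>n. w n \<ge> 1" and conc: "eventually_concave (\<lambda>n. ln (w n))"
  shows "bdd_above (range (\<lambda>n. \<bar>w (n + 1) / w n\<bar>))"
proof -
  obtain N where N: "\<And>n. n \<ge> N \<Longrightarrow> ln (w n) + ln (w (n + 2)) \<le> 2 * ln (w (n + 1))"
    using conc unfolding eventually_concave_def eventually_at_top_linorder by blast
  have pos: "0 < w n" for n using w[of n] by linarith
  then have nz: "w n \<noteq> 0" for n by (simp add: less_imp_neq[THEN not_sym])
  have dec: "ln (w (n + 1)) - ln (w n) \<le> ln (w (N + 1)) - ln (w N)" if "n \<ge> N" for n
    using that
  proof (induction n rule: dec_induct)
    case (step n)
    then show ?case using N[of n] by simp
  qed simp
  have tail: "\<bar>w (n + 1) / w n\<bar> \<le> w (N + 1) / w N" if "n \<ge> N" for n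
  proof -
    have "ln (w (n + 1) / w n) \<le> ln (w (N + 1) / w N)"
      using dec[OF that] nz by (simp add: ln_div)
    then show ?thesis
      using pos[of n] pos[of "n + 1"] pos[of N] pos[of "N + 1"] by simp
  qed
  have "bdd_above ((\<lambda>n. \<bar>w (n + 1) / w n\<bar>) ` ({..<N} \<union> {N..}))"
    unfolding image_Un bdd_above_Un
    using bdd_aboveI2[of "{N..}", OF tail] by (simp del: abs_divide)
  moreover have "{..<N} \<union> {N..} = UNIV" by auto
  ultimately show ?thesis by simp
qed

end

theory Submission
  imports Defs "HOL-Complex_Analysis.Complex_Analysis" "HOL-Real_Asymp.Real_Asymp"
    "HOL-Computational_Algebra.Computational_Algebra"
begin

text \<open>Identify \<open>x \<in> \<ell>\<^sup>2\<close> with the power series \<open>f(z) = \<Sum> a\<^sub>n z\<^sup>n\<close>, \<open>a\<^sub>n = x\<^sub>n / \<omega>(n)\<close>. Then \<open>S\<^sub>\<omega>\<close> is multiplication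
  by \<open>z\<close> on a Banach algebra \<open>E 0\<close> of functions that are smooth on the closed disc, and its invariant
  subspaces are the closed ideals.

  If \<open>f\<close> vanishes to infinite order at a point \<open>\<lambda>\<close> of the closed disc, all moments of
  \<open>a\<^sub>n \<lambda>\<^sup>n\<close> vanish. The Cauchy transform \<open>F(z) = \<Sum> a\<^sub>n \<lambda>\<^sup>n / (n - z)\<close> then decays faster than any power,
  and by log-convexity \<open>F(w\<^sup>2)\<close> is essentially bounded by \<open>1 / \<omega>(\<bar>w\<bar>\<^sup>2)\<close> on the half-plane \<open>Im w \<ge> 1\<close>.
  The divergence hypothesis is the divergence of the corresponding logarithmic integral, hence \<open>F = 0\<close>
  and \<open>f = 0\<close>. So a nonzero \<open>f\<close> is \<open>p g\<close> with a polynomial \<open>p\<close> and \<open>g\<close> free of zeros; by Wiener's lemma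
  \<open>1 / g\<close> is as smooth as \<open>g\<close>, and \<open>p\<^sup>k / g \<in> E 0\<close> for large \<open>k\<close>. Hence every nonzero invariant
  subspace contains a nonzero polynomial with all zeros in the closed disc.

  Such a subspace is a limit of its dilates, which are the ranges of \<open>\<Prod>(S\<^sub>\<omega> - \<mu>\<^sub>i)\<close> with \<open>\<bar>\<mu>\<^sub>i\<bar> < 1\<close>.
  These operators are bounded below, so their ranges are norm stable.\<close>

section \<open>Weighted sequence algebras\<close>

text \<open>Dividing by a zero costs smoothness, so one algebra is not enough. Condition (ii), for
  all k at once, makes every \<open>\<omega> n / (n + 1) ^ k\<close> an admissible weight: in the
  resulting scale of algebras \<open>E k\<close> a polynomial loss only raises the index, and powers
  of p lead back to \<open>E 0\<close>.

  The map w -> (w + i)^2 takes the half-plane to a region at distance at least 1 from all integers n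
  >= 0, with modulus x^2 + 1 on the boundary. The integral of log \<omega>(x^2) / x^2 thus becomes
  the sum of log \<omega>(n) / n^(3/2), the origin of the exponent in (iv).

  If p has a zero on the unit circle, p(T) is not bounded below; hence the dilations f(z) -> f(r z).
  They tend to the identity only strongly, while stability asks for norm convergence of projections.
  But a subspace M containing a nonzero polynomial has finite codimension, and dilations are
  self-adjoint: the comparison moves to the orthogonal complement of M, where strong convergence is
  uniform.\<close>

lemma eventually_concave_increments:
  assumes "eventually_concave h"
  obtains N where "\<And>m n. N \<le> m \<Longrightarrow> m \<le> n \<Longrightarrow> h (Suc n) - h n \<le> h (Suc m) - h m"
proof -
  obtain N where N: "\<And>n. n \<ge> N \<Longrightarrow> h n + h (n + 2) \<le> 2 * h (n + 1)"
    using assms unfolding eventually_concave_def eventually_at_top_linorder by blast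
  have "h (Suc n) - h n \<le> h (Suc m) - h m" if "N \<le> m" "m \<le> n" for m n
    using that(2)
  proof (induction n rule: dec_induct)
    case (step n)
    then show ?case using N[of n] that(1) by simp
  qed simp
  then show ?thesis using that by blast
qed

text \<open>Beyond N the increments decrease, so the growth of h over m steps starting at n is at
  most that over m steps starting at N. If one argument is below N, the uniform bound D on
  increments suffices.\<close>

lemma eventually_concave_subadditive:
  assumes "eventually_concave h"
  obtains C where "\<And>m n. h (m + n) \<le> h m + h n + C"
proof -
  obtain N where N: "\<And>m n. N \<le> m \<Longrightarrow> m \<le> n \<Longrightarrow> h (Suc n) - h n \<le> h (Suc m) - h m"
    using eventually_concave_increments[OF assms] by blast
  define D where "D = Max ((\<lambda>n. \<bar>h (Suc n) - h n\<bar>) ` {..N})"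
  define B where "B = Max ((\<lambda>n. \<bar>h n\<bar>) ` {..N})"
  have D1: "\<bar>h (Suc n) - h n\<bar> \<le> D" if "n \<le> N" for n
    unfolding D_def using that by (intro Max_ge) auto
  have D0: "0 \<le> D" using D1[of 0] by linarith
  have D: "h (Suc n) - h n \<le> D" for n
    using D1[of n] D1[of N] N[of N n] by (cases "n \<le> N") auto
  have B: "\<bar>h n\<bar> \<le> B" if "n \<le> N" for n
    unfolding B_def using that by (intro Max_ge) auto
  have step: "h (m + i) \<le> h m + real i * D" for m i
  proof (induction i)
    case (Suc i)
    then show ?case using D[of "m + i"] by (simp add: algebra_simps)
  qed simp
  have small: "h (m + n) \<le> h m + h n + (real N * D + B)" if "n \<le> N" for m n
  proof -
    have "real n * D \<le> real N * D" using that D0 by (intro mult_right_mono) auto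
    then show ?thesis using step[of m n] B[OF that] by linarith
  qed
  have "h (m + n) \<le> h m + h n + (real N * D + B)" for m n
  proof (cases "n \<le> N \<or> m \<le> N")
    case True
    then show ?thesis using small[of n m] small[of m n] by (auto simp: add.commute)
  next
    case False
    have "h (n + i) - h n \<le> h (N + i) - h N" for i
    proof (induction i)
      case (Suc i)
      then show ?case using N[of "N + i" "n + i"] False by simp
    qed simp
    from this[of m] show ?thesis using step[of m N] B[of N] by (simp add: add.commute)
  qed
  then show ?thesis using that by blast
qed

text \<open>By concavity a negative increment beyond N would persist and force linear decay, against
  the logarithmic lower bound.\<close>

lemma eventually_concave_mono:
  assumes "eventually_concave h" and low: "\<And>n. h n \<ge> - (c * ln (real n + 1))"
  obtains N where "\<And>m n. N \<le> m \<Longrightarrow> m \<le> n \<Longrightarrow> h m \<le> h n"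
proof -
  obtain N where N: "\<And>m n. N \<le> m \<Longrightarrow> m \<le> n \<Longrightarrow> h (Suc n) - h n \<le> h (Suc m) - h m"
    using eventually_concave_increments[OF assms(1)] by blast
  have inc: "0 \<le> h (Suc m) - h m" if m: "N \<le> m" for m
  proof (rule ccontr)
    define d where "d = h (Suc m) - h m"
    assume "\<not> 0 \<le> h (Suc m) - h m"
    then have d: "d < 0" by (simp add: d_def)
    have up: "h (m + i) \<le> h m + real i * d" for i
    proof (induction i)
      case (Suc i)
      then show ?case using N[of m "m + i"] m by (simp add: d_def algebra_simps)
    qed simp
    have "filterlim (\<lambda>i::nat. h m + real i * d + c * ln (real m + real i + 1)) at_bot at_top"
      using d by real_asymp
    then have "\<forall>\<^sub>F i in sequentially. h m + real i * d + c * ln (real m + real i + 1) \<le> -1"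
      by (simp add: filterlim_at_bot)
    then obtain i where "h m + real i * d + c * ln (real m + real i + 1) \<le> -1"
      by (auto simp: eventually_at_top_linorder)
    then show False using up[of i] low[of "m + i"] by (simp add: add.assoc)
  qed
  have "h m \<le> h n" if "N \<le> m" "m \<le> n" for m n
    using that(2)
  proof (induction n rule: dec_induct)
    case (step n)
    then show ?case using inc[of n] that(1) by simp
  qed simp
  then show ?thesis using that by blast
qed

lemma inverse_square_summable: "summable (\<lambda>m. 1 / (real m + 1)\<^sup>2)"
proof -
  have "summable (\<lambda>m. inverse ((real (Suc m))\<^sup>2))"
    using inverse_power_summable[of 2, where ?'a=real] by (subst summable_Suc_iff) simp
  then show ?thesis by (simp add: inverse_eq_divide add.commute)
qed

section \<open>The weights \<open>wt k\<close>: monotonicity, submultiplicativity, convolution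
  kernel\<close>

locale smooth_weight =
  fixes \<omega> :: "nat \<Rightarrow> real"
  assumes weight_ge_1: "\<omega> n \<ge> 1"
    and weight_root: "(\<lambda>n. \<omega> n powr (1 / real n)) \<longlonglongrightarrow> 1"
    and weight_concave: "eventually_concave (\<lambda>n. ln (\<omega> n * (real n + 1) powi (- int k)))"
begin

definition wt :: "nat \<Rightarrow> nat \<Rightarrow> real" where
  "wt k n = \<omega> n / (real n + 1) ^ k"

lemma wt_0: "wt 0 n = \<omega> n"
  by (simp add: wt_def)

lemma wt_pos [simp]: "0 < wt k n"
  using weight_ge_1[of n] by (simp add: wt_def)

lemma wt_nonneg [simp]: "0 \<le> wt k n"
  using wt_pos less_imp_le by blast

lemma wt_nz [simp]: "wt k n \<noteq> 0"
  using wt_pos less_irrefl by metis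

lemma wt_Suc: "wt k n = wt (Suc k) n * (real n + 1)"
  by (simp add: wt_def)

lemma wt_add: "wt k n = wt (k + j) n * (real n + 1) ^ j"
  by (simp add: wt_def power_add)

lemma wt_antimono: "j \<le> k \<Longrightarrow> wt k n \<le> wt j n"
  unfolding wt_def using weight_ge_1[of n]
  by (intro divide_left_mono power_increasing mult_pos_pos) auto

lemma wt_concave: "eventually_concave (\<lambda>n. ln (wt k n))"
  using weight_concave[of k] by (simp add: wt_def power_int_minus divide_inverse)

lemma wt_submultiplicative: obtains C where "C > 0" "\<And>m n. wt k (m + n) \<le> C * wt k m * wt k n"
proof -
  obtain C where C: "\<And>m n. ln (wt k (m + n)) \<le> ln (wt k m) + ln (wt k n) + C"
    using eventually_concave_subadditive[OF wt_concave] by blast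
  have "wt k (m + n) \<le> exp C * wt k m * wt k n" for m n
  proof -
    have "exp (ln (wt k (m + n))) \<le> exp (ln (wt k m) + ln (wt k n) + C)"
      unfolding exp_le_cancel_iff by (rule C)
    then show ?thesis by (simp add: exp_add mult_ac)
  qed
  then show ?thesis using that[of "exp C"] by simp
qed

lemma wt_eventually_mono: obtains N where "\<And>m n. N \<le> m \<Longrightarrow> m \<le> n \<Longrightarrow> wt k m \<le> wt k n"
proof -
  have "ln (wt k n) \<ge> - (real k * ln (real n + 1))" for n
    using weight_ge_1[of n] unfolding wt_def by (simp add: ln_div ln_realpow)
  then obtain N where "\<And>m n. N \<le> m \<Longrightarrow> m \<le> n \<Longrightarrow> ln (wt k m) \<le> ln (wt k n)"
    using eventually_concave_mono[OF wt_concave, of "real k" k] by blast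
  then show ?thesis using that[of N] by simp
qed

lemma wt_lower: obtains b where "b > 0" "\<And>n. b \<le> wt k n"
proof -
  obtain N where N: "\<And>m n. N \<le> m \<Longrightarrow> m \<le> n \<Longrightarrow> wt k m \<le> wt k n"
    using wt_eventually_mono by blast
  define b where "b = Min (wt k ` {..N})"
  have b: "b \<le> wt k n" if "n \<le> N" for n
    unfolding b_def using that by (intro Min_le) auto
  have "b > 0" unfolding b_def by (subst Min_gr_iff) auto
  moreover have "b \<le> wt k n" for n
    using b[of n] b[of N] N[of N n] by (cases "n \<le> N") auto
  ultimately show ?thesis using that by blast
qed

lemma wt_almost_mono: obtains C where "C > 0" "\<And>m n. m \<le> n \<Longrightarrow> wt k m \<le> C * wt k n"
proof -
  obtain N where N: "\<And>m n. N \<le> m \<Longrightarrow> m \<le> n \<Longrightarrow> wt k m \<le> wt k n"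
    using wt_eventually_mono by blast
  obtain b where b: "b > 0" "\<And>n. b \<le> wt k n" using wt_lower by blast
  define B where "B = Max (wt k ` {..N})"
  have B: "wt k n \<le> B" if "n \<le> N" for n
    unfolding B_def using that by (intro Max_ge) auto
  have B0: "0 < B" using B[of 0] wt_pos[of k 0] by linarith
  define C where "C = 1 + B / b"
  have "wt k m \<le> C * wt k n" if "m \<le> n" for m n
  proof (cases "N \<le> m")
    case True
    have "0 \<le> B / b * wt k n" using B0 b by simp
    then show ?thesis using N[OF True that] by (simp add: C_def algebra_simps)
  next
    case False
    have "B \<le> B / b * wt k n"
      using B0 b(1) b(2)[of n] by (simp add: field_simps)
    then have "wt k m \<le> B / b * wt k n" using B[of m] False by simp
    then show ?thesis using wt_nonneg[of k n] by (simp add: C_def algebra_simps del: wt_nonneg)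
  qed
  moreover have "C > 0" using B0 b by (simp add: C_def add_pos_pos)
  ultimately show ?thesis using that by blast
qed

text \<open>By Cauchy-Schwarz, this bound makes a weighted square-summable space closed under
  convolution. Submultiplicativity of the next weight \<open>wt (Suc k)\<close> leaves the factor (n
  + 1) / ((m + 1) (n - m + 1)), which is at most 1 / (m + 1) + 1 / (n - m + 1) and so square
  summable.\<close>

lemma wt_kernel:
  obtains C where "C > 0" "\<And>n. (\<Sum>m\<le>n. (wt k n / (wt k m * wt k (n - m)))\<^sup>2) \<le> C"
proof -
  obtain C where C: "C > 0" "\<And>m n. wt (Suc k) (m + n) \<le> C * wt (Suc k) m * wt (Suc k) n"
    using wt_submultiplicative by blast
  define Z where "Z = (\<Sum>m. 1 / (real m + 1)\<^sup>2)"
  have Z0: "Z \<ge> 0" unfolding Z_def by (intro suminf_nonneg inverse_square_summable) auto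
  have Z: "(\<Sum>m\<le>n. 1 / (real m + 1)\<^sup>2) \<le> Z" for n
    unfolding Z_def by (intro sum_le_suminf inverse_square_summable) auto
  have K: "(wt k n / (wt k m * wt k (n - m)))\<^sup>2
        \<le> 2 * C\<^sup>2 * (1 / (real m + 1)\<^sup>2 + 1 / (real (n - m) + 1)\<^sup>2)" if "m \<le> n" for m n
  proof -
    define x where "x = real m + 1"
    define y where "y = real (n - m) + 1"
    have xy: "x > 0" "y > 0" "real n + 1 \<le> x + y" using that by (auto simp: x_def y_def)
    have "wt k n / (wt k m * wt k (n - m)) =
       wt (Suc k) n * (real n + 1) / (wt (Suc k) m * wt (Suc k) (n - m) * (x * y))"
      unfolding wt_Suc[of k] x_def y_def by (simp add: mult_ac)
    also have "\<dots> = wt (Suc k) n / (wt (Suc k) m * wt (Suc k) (n - m)) * ((real n + 1) / (x * y))"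
      by simp
    also have "\<dots> \<le> C * ((x + y) / (x * y))"
    proof (intro mult_mono)
      show "wt (Suc k) n / (wt (Suc k) m * wt (Suc k) (n - m)) \<le> C"
        using C(2)[of m "n - m"] that by (simp add: divide_simps mult.assoc)
      show "(real n + 1) / (x * y) \<le> (x + y) / (x * y)"
        using xy by (intro divide_right_mono) auto
    qed (use C xy in auto)
    also have "(x + y) / (x * y) = 1 / x + 1 / y" using xy by (simp add: field_simps)
    finally have "(wt k n / (wt k m * wt k (n - m)))\<^sup>2 \<le> (C * (1 / x + 1 / y))\<^sup>2"
      by (intro power_mono) auto
    also have "\<dots> = C\<^sup>2 * (1 / x + 1 / y)\<^sup>2" by (simp add: power_mult_distrib)
    also have "\<dots> \<le> C\<^sup>2 * (2 * ((1 / x)\<^sup>2 + (1 / y)\<^sup>2))"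
      using zero_le_power2[of "1 / x - 1 / y"]
      by (intro mult_left_mono) (auto simp: power2_sum power2_diff simp del: zero_le_power2)
    also have "\<dots> = 2 * C\<^sup>2 * ((1 / x)\<^sup>2 + (1 / y)\<^sup>2)" by (simp only: mult_ac)
    finally show ?thesis by (simp only: x_def y_def power_divide power_one)
  qed
  have "(\<Sum>m\<le>n. (wt k n / (wt k m * wt k (n - m)))\<^sup>2) \<le> 2 * C\<^sup>2 * (Z + Z) + 1" for n
  proof -
    have rev: "(\<Sum>m\<le>n. 1 / (real (n - m) + 1)\<^sup>2) = (\<Sum>m\<le>n. 1 / (real m + 1)\<^sup>2)"
      by (rule sum.reindex_bij_witness[of _ "\<lambda>m. n - m" "\<lambda>m. n - m"]) auto
    have "(\<Sum>m\<le>n. (wt k n / (wt k m * wt k (n - m)))\<^sup>2)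
       \<le> (\<Sum>m\<le>n. 2 * C\<^sup>2 * (1 / (real m + 1)\<^sup>2 + 1 / (real (n - m) + 1)\<^sup>2))"
      by (intro sum_mono K) auto
    also have "\<dots> = 2 * C\<^sup>2 * ((\<Sum>m\<le>n. 1 / (real m + 1)\<^sup>2) + (\<Sum>m\<le>n. 1 / (real m + 1)\<^sup>2))"
      unfolding sum_distrib_left[symmetric] sum.distrib rev ..
    also have "\<dots> \<le> 2 * C\<^sup>2 * (Z + Z)" by (intro mult_left_mono add_mono Z) auto
    finally show ?thesis by simp
  qed
  moreover have "2 * C\<^sup>2 * (Z + Z) + 1 > 0" using Z0 C by (intro add_nonneg_pos mult_nonneg_nonneg) auto
  ultimately show ?thesis using that by blast
qed

section \<open>Truncated norms and the algebras \<open>E k\<close>\<close>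

definition nrm :: "nat \<Rightarrow> nat \<Rightarrow> complex fps \<Rightarrow> real" where
  "nrm k M a = L2_set (\<lambda>n. wt k n * norm (fps_nth a n)) {..M}"

lemma nrm_nonneg [simp]: "0 \<le> nrm k M a"
  by (simp add: nrm_def L2_set_nonneg)

lemma nrm_add: "nrm k M (a + b) \<le> nrm k M a + nrm k M b"
proof -
  have "nrm k M (a + b) \<le> L2_set (\<lambda>n. wt k n * norm (fps_nth a n) + wt k n * norm (fps_nth b n)) {..M}"
    unfolding nrm_def
    by (intro L2_set_mono) (auto simp flip: distrib_left intro!: mult_left_mono norm_triangle_ineq)
  also have "\<dots> \<le> nrm k M a + nrm k M b"
    unfolding nrm_def by (rule L2_set_triangle_ineq)
  finally show ?thesis .
qed

text \<open>Coefficients up to M of a product depend only on those of the factors, so the estimate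
  holds for arbitrary formal series, also before membership in \<open>E k\<close> is known.\<close>

lemma nrm_mult: obtains C where "C > 0" "\<And>M a b. nrm k M (a * b) \<le> C * nrm k M a * nrm k M b"
proof -
  obtain C where C: "C > 0" "\<And>n. (\<Sum>m\<le>n. (wt k n / (wt k m * wt k (n - m)))\<^sup>2) \<le> C"
    using wt_kernel by blast
  have "nrm k M (a * b) \<le> sqrt C * nrm k M a * nrm k M b" for M a b
  proof -
    define \<alpha> where "\<alpha> n = wt k n * norm (fps_nth a n)" for n
    define \<beta> where "\<beta> n = wt k n * norm (fps_nth b n)" for n
    have tm: "(wt k n * norm (fps_nth (a * b) n))\<^sup>2 \<le> C * (\<Sum>m\<le>n. (\<alpha> m)\<^sup>2 * (\<beta> (n - m))\<^sup>2)" for n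
    proof -
      have "wt k n * norm (fps_nth (a * b) n) \<le> wt k n * (\<Sum>m\<le>n. norm (fps_nth a m) * norm (fps_nth b (n - m)))"
        unfolding fps_mult_nth atLeast0AtMost
        by (intro mult_left_mono order_trans[OF norm_sum]) (auto simp: norm_mult)
      also have "\<dots> = (\<Sum>m\<le>n. (wt k n / (wt k m * wt k (n - m))) * (\<alpha> m * \<beta> (n - m)))"
        unfolding sum_distrib_left \<alpha>_def \<beta>_def by (intro sum.cong refl) (simp add: field_simps)
      finally have "(wt k n * norm (fps_nth (a * b) n))\<^sup>2 \<le>
         (\<Sum>m\<le>n. (wt k n / (wt k m * wt k (n - m))) * (\<alpha> m * \<beta> (n - m)))\<^sup>2"
        by (intro power_mono) auto
      also have "\<dots> \<le> (\<Sum>m\<le>n. (wt k n / (wt k m * wt k (n - m)))\<^sup>2) * (\<Sum>m\<le>n. (\<alpha> m * \<beta> (n - m))\<^sup>2)"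
        by (rule Cauchy_Schwarz_ineq_sum)
      also have "\<dots> \<le> C * (\<Sum>m\<le>n. (\<alpha> m * \<beta> (n - m))\<^sup>2)"
        by (intro mult_right_mono C sum_nonneg) auto
      finally show ?thesis by (simp add: power_mult_distrib)
    qed
    have "(\<Sum>n\<le>M. (wt k n * norm (fps_nth (a * b) n))\<^sup>2) \<le> (\<Sum>n\<le>M. C * (\<Sum>m\<le>n. (\<alpha> m)\<^sup>2 * (\<beta> (n - m))\<^sup>2))"
      by (intro sum_mono tm)
    also have "\<dots> = C * (\<Sum>n\<le>M. \<Sum>m\<le>n. (\<alpha> m)\<^sup>2 * (\<beta> (n - m))\<^sup>2)"
      by (simp add: sum_distrib_left)
    also have "(\<Sum>n\<le>M. \<Sum>m\<le>n. (\<alpha> m)\<^sup>2 * (\<beta> (n - m))\<^sup>2) = (\<Sum>(i, j)\<in>{(i, j). i + j \<le> M}. (\<alpha> i)\<^sup>2 * (\<beta> j)\<^sup>2)"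
      by (rule sum.triangle_reindex_eq[symmetric])
    also have "\<dots> \<le> (\<Sum>(i, j)\<in>{..M} \<times> {..M}. (\<alpha> i)\<^sup>2 * (\<beta> j)\<^sup>2)"
      by (intro sum_mono2) auto
    also have "\<dots> = (\<Sum>i\<le>M. (\<alpha> i)\<^sup>2) * (\<Sum>j\<le>M. (\<beta> j)\<^sup>2)"
      by (simp add: sum_product sum.cartesian_product)
    finally have "sqrt (\<Sum>n\<le>M. (wt k n * norm (fps_nth (a * b) n))\<^sup>2)
       \<le> sqrt (C * ((\<Sum>i\<le>M. (\<alpha> i)\<^sup>2) * (\<Sum>j\<le>M. (\<beta> j)\<^sup>2)))"
      using C(1) by (simp add: real_sqrt_le_mono)
    then show ?thesis
      by (simp add: nrm_def L2_set_def \<alpha>_def \<beta>_def real_sqrt_mult mult.assoc)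
  qed
  then show ?thesis using that[of "sqrt C"] C by simp
qed

text \<open>Formal series rather than functions on the disc, so that products, derivatives and
  inverses exist before any convergence is known. \<open>E 0\<close> corresponds to
  \<open>ell2\<close>, and the spaces grow with k.\<close>

definition E :: "nat \<Rightarrow> complex fps set" where
  "E k = {a. summable (\<lambda>n. (wt k n * norm (fps_nth a n))\<^sup>2)}"

lemma E_iff_bounded: "a \<in> E k \<longleftrightarrow> (\<exists>B. \<forall>M. nrm k M a \<le> B)"
proof
  assume a: "a \<in> E k"
  have "nrm k M a \<le> sqrt (\<Sum>n. (wt k n * norm (fps_nth a n))\<^sup>2)" for M
    unfolding nrm_def L2_set_def using a by (intro real_sqrt_le_mono sum_le_suminf) (auto simp: E_def)
  then show "\<exists>B. \<forall>M. nrm k M a \<le> B" by blast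
next
  assume "\<exists>B. \<forall>M. nrm k M a \<le> B"
  then obtain B where B: "\<And>M. nrm k M a \<le> B" by blast
  have B0: "0 \<le> B" using B[of 0] nrm_nonneg[of k 0 a] by linarith
  have "(\<Sum>n<M. (wt k n * norm (fps_nth a n))\<^sup>2) \<le> B\<^sup>2" for M
  proof -
    have "(\<Sum>n<M. (wt k n * norm (fps_nth a n))\<^sup>2) \<le> (\<Sum>n\<le>M. (wt k n * norm (fps_nth a n))\<^sup>2)"
      by (intro sum_mono2) auto
    also have "\<dots> = (nrm k M a)\<^sup>2" unfolding nrm_def L2_set_def by (simp add: sum_nonneg)
    also have "\<dots> \<le> B\<^sup>2" using B by (intro power_mono) auto
    finally show ?thesis .
  qed
  then show "a \<in> E k" unfolding E_def by (auto intro!: summableI_nonneg_bounded)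
qed

lemma E_add [intro]: "a \<in> E k \<Longrightarrow> b \<in> E k \<Longrightarrow> a + b \<in> E k"
  unfolding E_iff_bounded using nrm_add add_mono order_trans by meson

lemma E_mult [intro]: assumes "a \<in> E k" "b \<in> E k" shows "a * b \<in> E k"
proof -
  obtain C where C: "C > 0" "\<And>M a b. nrm k M (a * b) \<le> C * nrm k M a * nrm k M b"
    using nrm_mult by blast
  obtain A B where AB: "\<And>M. nrm k M a \<le> A" "\<And>M. nrm k M b \<le> B"
    using assms unfolding E_iff_bounded by blast
  have "C * nrm k M a * nrm k M b \<le> C * A * B" for M
    using C(1) order_trans[OF nrm_nonneg AB(1)] by (intro mult_mono AB) auto
  then show ?thesis unfolding E_iff_bounded using C(2) order_trans by blast
qed

lemma E_fin: assumes "finite {n. fps_nth a n \<noteq> 0}" shows "a \<in> E k"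
  unfolding E_def mem_Collect_eq by (rule summable_finite[OF assms]) auto

lemma E_poly [intro]: "fps_of_poly p \<in> E k"
  by (rule E_fin, rule finite_subset[of _ "{..degree p}"]) (auto simp: le_degree)

lemma E_1 [intro]: "1 \<in> E k" and E_X [intro]: "fps_X \<in> E k"
  and E_of_nat [intro]: "of_nat n \<in> E k" and E_0 [intro]: "0 \<in> E k"
  using E_poly[of 1 k] E_poly[of "[:0,1:]" k] E_poly[of "[:of_nat n:]" k] E_poly[of 0 k]
  by (simp_all add: fps_of_poly_pCons fps_of_nat)

lemma E_uminus [intro]: "a \<in> E k \<Longrightarrow> - a \<in> E k"
  by (simp add: E_def)

lemma E_diff [intro]: "a \<in> E k \<Longrightarrow> b \<in> E k \<Longrightarrow> a - b \<in> E k"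
  using E_add[of a k "- b"] E_uminus by simp

lemma E_sum [intro]: "(\<And>i. i \<in> A \<Longrightarrow> f i \<in> E k) \<Longrightarrow> sum f A \<in> E k"
  by (induction A rule: infinite_finite_induct) auto

lemma E_power [intro]: "a \<in> E k \<Longrightarrow> a ^ n \<in> E k"
  by (induction n) auto

lemma E_mono: assumes "j \<le> k" "a \<in> E j" shows "a \<in> E k"
proof -
  have "summable (\<lambda>n. (wt j n * norm (fps_nth a n))\<^sup>2)" using assms(2) by (simp add: E_def)
  then show ?thesis unfolding E_def mem_Collect_eq
    by (rule summable_comparison_test')
      (auto intro!: power_mono mult_right_mono wt_antimono assms)
qed

lemma E_bound: assumes "a \<in> E k" obtains B where "B > 0" "\<And>n. wt k n * norm (fps_nth a n) \<le> B"
proof -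
  obtain B where B: "\<And>M. nrm k M a \<le> B" using assms unfolding E_iff_bounded by blast
  have "wt k n * norm (fps_nth a n) \<le> B + 1" for n
    using order_trans[OF member_le_L2_set[of "{..n}" n "\<lambda>n. wt k n * norm (fps_nth a n)"] B[unfolded nrm_def]] by simp
  moreover have "B + 1 > 0" using B[of 0] nrm_nonneg[of k 0 a] by linarith
  ultimately show ?thesis using that by blast
qed


lemma E_of_bound: assumes "\<And>n. wt k n * norm (fps_nth a n) \<le> B" shows "a \<in> E (Suc k)"
proof -
  have "(wt (Suc k) n * norm (fps_nth a n))\<^sup>2 \<le> B\<^sup>2 * (1 / (real n + 1)\<^sup>2)" for n
  proof -
    have "(wt (Suc k) n * norm (fps_nth a n))\<^sup>2 = (wt k n * norm (fps_nth a n))\<^sup>2 * (1 / (real n + 1)\<^sup>2)"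
      by (simp add: wt_Suc[of k] power_mult_distrib)
    also have "\<dots> \<le> B\<^sup>2 * (1 / (real n + 1)\<^sup>2)"
      using assms[of n] by (intro mult_right_mono power_mono) auto
    finally show ?thesis .
  qed
  then show ?thesis unfolding E_def mem_Collect_eq
    by (intro summable_comparison_test'[OF summable_mult[OF inverse_square_summable]]) auto
qed

lemma E_deriv: assumes "a \<in> E k" shows "fps_deriv a \<in> E (Suc k)"
proof -
  obtain C where C: "C > 0" "\<And>m n. m \<le> n \<Longrightarrow> wt k m \<le> C * wt k n" using wt_almost_mono by blast
  have "summable (\<lambda>n. C\<^sup>2 * (wt k (Suc n) * norm (fps_nth a (Suc n)))\<^sup>2)"
    using assms summable_Suc_iff[of "\<lambda>n. (wt k n * norm (fps_nth a n))\<^sup>2"]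
    by (intro summable_mult) (simp only: E_def mem_Collect_eq)
  moreover have "(wt (Suc k) n * norm (fps_nth (fps_deriv a) n))\<^sup>2
      \<le> C\<^sup>2 * (wt k (Suc n) * norm (fps_nth a (Suc n)))\<^sup>2" for n
  proof -
    have "wt (Suc k) n * norm (fps_nth (fps_deriv a) n) = wt k n * norm (fps_nth a (Suc n))"
      by (simp add: wt_Suc[of k] norm_mult add.commute flip: of_nat_Suc)
    also have "\<dots> \<le> C * wt k (Suc n) * norm (fps_nth a (Suc n))"
      by (intro mult_right_mono C) auto
    finally have "(wt (Suc k) n * norm (fps_nth (fps_deriv a) n))\<^sup>2
      \<le> (C * wt k (Suc n) * norm (fps_nth a (Suc n)))\<^sup>2" by (intro power_mono) auto
    then show ?thesis by (simp add: power_mult_distrib)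
  qed
  ultimately show ?thesis unfolding E_def mem_Collect_eq
    by (elim summable_comparison_test') auto
qed

text \<open>Converse of \<open>E_deriv\<close> without loss: submultiplicativity compares the
  weights at n + 1 and n. Thus control of one derivative recovers one index.\<close>

lemma E_antideriv: assumes "fps_deriv a \<in> E (Suc k)" shows "a \<in> E k"
proof -
  obtain C where C: "C > 0" "\<And>m n. wt (Suc k) (m + n) \<le> C * wt (Suc k) m * wt (Suc k) n"
    using wt_submultiplicative by blast
  define D where "D = 2 * C * wt (Suc k) 1"
  have "summable (\<lambda>n. D\<^sup>2 * (wt (Suc k) n * norm (fps_nth (fps_deriv a) n))\<^sup>2)"
    using assms by (intro summable_mult) (simp only: E_def mem_Collect_eq)
  moreover have "(wt k (Suc n) * norm (fps_nth a (Suc n)))\<^sup>2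
      \<le> D\<^sup>2 * (wt (Suc k) n * norm (fps_nth (fps_deriv a) n))\<^sup>2" for n
  proof -
    have "wt k (Suc n) * norm (fps_nth a (Suc n)) = wt (Suc k) (n + 1) * (real n + 2) * norm (fps_nth a (Suc n))"
      by (simp add: wt_Suc[of k] add.commute)
    also have "\<dots> \<le> (C * wt (Suc k) n * wt (Suc k) 1) * (2 * (real n + 1)) * norm (fps_nth a (Suc n))"
      using C(1) by (intro mult_right_mono mult_mono C(2)) auto
    also have "\<dots> = D * (wt (Suc k) n * norm (fps_nth (fps_deriv a) n))"
      by (simp add: D_def norm_mult add.commute flip: of_nat_Suc)
    finally have "(wt k (Suc n) * norm (fps_nth a (Suc n)))\<^sup>2
      \<le> (D * (wt (Suc k) n * norm (fps_nth (fps_deriv a) n)))\<^sup>2" by (intro power_mono) auto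
    then show ?thesis by (simp only: power_mult_distrib)
  qed
  ultimately have "summable (\<lambda>n. (wt k (Suc n) * norm (fps_nth a (Suc n)))\<^sup>2)"
    by (elim summable_comparison_test') auto
  then show ?thesis unfolding E_def mem_Collect_eq
    using summable_Suc_iff[of "\<lambda>n. (wt k n * norm (fps_nth a n))\<^sup>2"] by simp
qed

section \<open>Power series on the closed unit disc\<close>

lemma nrm_ge_norm_sum:
  obtains D where "D > 0" "\<And>M a. (\<Sum>n\<le>M. norm (fps_nth a n)) \<le> D * nrm k M a"
proof -
  obtain b where b: "b > 0" "\<And>n. b \<le> wt (k + 1) n" using wt_lower by blast
  define Z where "Z = (\<Sum>m. 1 / (real m + 1)\<^sup>2)"
  have Z: "Z \<ge> 0" unfolding Z_def by (intro suminf_nonneg inverse_square_summable) auto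
  have "(\<Sum>n\<le>M. norm (fps_nth a n)) \<le> ((sqrt Z + 1) / b) * nrm k M a" for M a
  proof -
    have "(\<Sum>n\<le>M. norm (fps_nth a n)) \<le> (\<Sum>n\<le>M. \<bar>1 / (b * (real n + 1))\<bar> * \<bar>wt k n * norm (fps_nth a n)\<bar>)"
    proof (rule sum_mono)
      fix n
      \<comment> \<open>The weight \<open>wt k n\<close> is at least b (n + 1), because the next
        weight of the scale is bounded below by b. Cauchy-Schwarz against 1 / (n + 1) then gives
        absolute summability.\<close>
      have "b * (real n + 1) * norm (fps_nth a n) \<le> wt k n * norm (fps_nth a n)"
        unfolding wt_add[of k n 1] using b by (intro mult_right_mono) auto
      then show "norm (fps_nth a n) \<le> \<bar>1 / (b * (real n + 1))\<bar> * \<bar>wt k n * norm (fps_nth a n)\<bar>"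
        using b(1) by (simp add: abs_mult divide_simps) (simp add: mult_ac)
    qed
    also have "\<dots> \<le> L2_set (\<lambda>n. 1 / (b * (real n + 1))) {..M} * nrm k M a"
      unfolding nrm_def by (rule L2_set_mult_ineq)
    also have "\<dots> \<le> ((sqrt Z + 1) / b) * nrm k M a"
    proof (intro mult_right_mono)
      have "L2_set (\<lambda>n. 1 / (b * (real n + 1))) {..M} = sqrt ((\<Sum>n\<le>M. 1 / (real n + 1)\<^sup>2) / b\<^sup>2)"
        unfolding L2_set_def sum_divide_distrib by (simp add: power_divide power_mult_distrib mult_ac)
      also have "\<dots> \<le> sqrt (Z / b\<^sup>2)"
        unfolding Z_def by (intro real_sqrt_le_mono divide_right_mono sum_le_suminf inverse_square_summable) auto
      also have "\<dots> = sqrt Z / b" using b by (simp add: real_sqrt_divide)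
      also have "\<dots> \<le> (sqrt Z + 1) / b" using b by (simp add: divide_right_mono)
      finally show "L2_set (\<lambda>n. 1 / (b * (real n + 1))) {..M} \<le> (sqrt Z + 1) / b" .
    qed auto
    finally show ?thesis .
  qed
  moreover have "(sqrt Z + 1) / b > 0" using Z b by (simp add: add_nonneg_pos)
  ultimately show ?thesis using that by blast
qed

lemma E_norm_summable: assumes "a \<in> E k" shows "summable (\<lambda>n. norm (fps_nth a n))"
proof -
  obtain D B where D: "D > 0" "\<And>M. (\<Sum>n\<le>M. norm (fps_nth a n)) \<le> D * nrm k M a" and B: "\<And>M. nrm k M a \<le> B"
    using nrm_ge_norm_sum assms unfolding E_iff_bounded by metis
  have "(\<Sum>n\<le>M. norm (fps_nth a n)) \<le> D * B" for M
    using D(2)[of M] mult_left_mono[OF B[of M] less_imp_le[OF D(1)]] by linarith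
  then show ?thesis by (intro bounded_imp_summable) auto
qed

lemma E_summable: assumes "a \<in> E k" "norm z \<le> 1"
  shows "summable (\<lambda>n. norm (fps_nth a n * z ^ n))" "summable (\<lambda>n. fps_nth a n * z ^ n)"
proof -
  have "norm (norm (fps_nth a n * z ^ n)) \<le> norm (fps_nth a n)" for n
    using power_le_one[of "norm z" n] assms by (simp add: norm_mult norm_power mult_left_le)
  then show 1: "summable (\<lambda>n. norm (fps_nth a n * z ^ n))"
    by (rule summable_comparison_test'[OF E_norm_summable[OF assms(1)]])
  show "summable (\<lambda>n. fps_nth a n * z ^ n)" by (rule summable_norm_cancel[OF 1])
qed

lemma eval_fps_mult_E:
  assumes "a \<in> E k" "b \<in> E l" "norm z \<le> 1"
  shows "eval_fps (a * b) z = eval_fps a z * eval_fps b z"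
proof -
  have "eval_fps a z * eval_fps b z
      = (\<Sum>n. \<Sum>i\<le>n. (fps_nth a i * z ^ i) * (fps_nth b (n - i) * z ^ (n - i)))"
    unfolding eval_fps_def by (intro Cauchy_product E_summable[OF assms(1,3)] E_summable[OF assms(2,3)])
  also have "\<dots> = eval_fps (a * b) z"
    unfolding eval_fps_def fps_mult_nth atLeast0AtMost sum_distrib_right
    by (intro suminf_cong sum.cong refl) (simp add: power_add[symmetric] mult_ac)
  finally show ?thesis ..
qed

lemma eval_fps_add_E:
  assumes "a \<in> E k" "b \<in> E l" "norm z \<le> 1"
  shows "eval_fps (a + b) z = eval_fps a z + eval_fps b z"
  unfolding eval_fps_def
  using suminf_add[OF E_summable(2)[OF assms(1,3)] E_summable(2)[OF assms(2,3)]]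
  by (simp add: algebra_simps)

lemma continuous_on_eval_fps_E:
  assumes "a \<in> E k" shows "continuous_on (cball 0 1) (eval_fps a)"
proof -
  have "uniform_limit (cball 0 1) (\<lambda>n z. \<Sum>i<n. fps_nth a i * z ^ i) (\<lambda>z. \<Sum>i. fps_nth a i * z ^ i) sequentially"
    by (intro Weierstrass_m_test[OF _ E_norm_summable[OF assms]])
      (auto simp: norm_mult norm_power intro!: mult_left_le power_le_one)
  then show ?thesis
    unfolding eval_fps_def[abs_def]
    by (rule uniform_limit_theorem[rotated]) (auto intro!: continuous_intros always_eventually)
qed

text \<open>The loss of three powers of \<open>n + 1\<close> is crude, but any polynomial loss is harmless.\<close>

lemma E_divide_linear:
  assumes a: "a \<in> E k" and z: "norm z \<le> 1" and zero: "eval_fps a z = 0"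
  obtains b where "b \<in> E (k + 3)" "a = (fps_X - fps_const z) * b"
proof -
  \<comment> \<open>The quotient by X - z written with tail sums, which makes sense for z = 0 too.
    The vanishing at z enters only in coefficient 0.\<close>
  define b where "b = Abs_fps (\<lambda>n. \<Sum>j. fps_nth a (Suc n + j) * z ^ j)"
  have sn: "summable (\<lambda>j. norm (fps_nth a (n + j)))" for n
    using summable_ignore_initial_segment[OF E_norm_summable[OF a], of n] by (simp add: add.commute)
  have nle: "norm (fps_nth a (n + j) * z ^ j) \<le> norm (fps_nth a (n + j))" for n j
    using power_le_one[of "norm z" j] z by (simp add: norm_mult norm_power mult_left_le)
  have sz: "summable (\<lambda>j. fps_nth a (n + j) * z ^ j)" for n
    by (rule summable_norm_cancel, rule summable_comparison_test'[OF sn[of n]]) (simp add: nle)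
  have split: "(\<Sum>j. fps_nth a (n + j) * z ^ j) = fps_nth a n + z * fps_nth b n" for n
    using suminf_split_head[OF sz[of n]] suminf_mult[OF sz[of "Suc n"], of z]
    by (simp add: b_def algebra_simps)
  have "fps_nth a n = fps_nth ((fps_X - fps_const z) * b) n" for n
  proof (cases n)
    case 0
    then show ?thesis using split[of 0] zero
      by (simp add: eval_fps_def left_diff_distrib add_eq_0_iff2)
  next
    case (Suc m)
    then show ?thesis using split[of n] by (simp add: left_diff_distrib) (simp add: b_def)
  qed
  then have eq: "a = (fps_X - fps_const z) * b" by (simp add: fps_eq_iff)
  obtain B where B: "B > 0" "\<And>n. wt k n * norm (fps_nth a n) \<le> B" using E_bound[OF a] by blast
  \<comment> \<open>Two of the three indices pay for the summable factor 1 / (j + 1)^2; the third is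
    spent in \<open>E_of_bound\<close>.\<close>
  obtain C where C: "C > 0" "\<And>m n. m \<le> n \<Longrightarrow> wt (k + 2) m \<le> C * wt (k + 2) n"
    using wt_almost_mono by blast
  define Z where "Z = (\<Sum>m. 1 / (real m + 1)\<^sup>2)"
  have "wt (k + 2) n * norm (fps_nth b n) \<le> C * B * Z" for n
  proof -
    have le: "wt (k + 2) n * norm (fps_nth a (Suc n + j)) \<le> C * B * (1 / (real j + 1)\<^sup>2)" for j
    proof -
      have "wt (k + 2) n * norm (fps_nth a (Suc n + j)) * (real j + 1)\<^sup>2
        \<le> (C * wt (k + 2) (Suc n + j)) * norm (fps_nth a (Suc n + j)) * (real (Suc n + j) + 1)\<^sup>2"
        using C(1) by (intro mult_mono C(2) power_mono) auto
      also have "\<dots> = C * (wt k (Suc n + j) * norm (fps_nth a (Suc n + j)))"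
        by (simp only: wt_add[of k _ 2] mult_ac)
      also have "\<dots> \<le> C * B" using C(1) B(2) by (intro mult_left_mono) auto
      finally show ?thesis by (simp add: field_simps)
    qed
    have "norm (fps_nth b n) \<le> (\<Sum>j. norm (fps_nth a (Suc n + j)))"
      unfolding b_def fps_nth_Abs_fps
      by (rule order_trans[OF summable_norm suminf_le])
        (use nle[of "Suc n"] in \<open>auto intro!: sn[of "Suc n", simplified] summable_comparison_test'[OF sn[of "Suc n"]]\<close>)
    then have "wt (k + 2) n * norm (fps_nth b n) \<le> wt (k + 2) n * (\<Sum>j. norm (fps_nth a (Suc n + j)))"
      by (intro mult_left_mono) auto
    also have "\<dots> = (\<Sum>j. wt (k + 2) n * norm (fps_nth a (Suc n + j)))"
      by (rule suminf_mult[OF sn, symmetric])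
    also have "\<dots> \<le> (\<Sum>j. C * B * (1 / (real j + 1)\<^sup>2))"
      by (intro suminf_le le summable_mult sn inverse_square_summable)
    also have "\<dots> = C * B * Z" unfolding Z_def by (rule suminf_mult[OF inverse_square_summable])
    finally show ?thesis .
  qed
  then have "b \<in> E (Suc (k + 2))" by (rule E_of_bound)
  with eq that[of b] show ?thesis by (simp add: eval_nat_numeral)
qed

section \<open>Inverses in \<open>E k\<close>\<close>

lemma weight_geometric:
  assumes "\<rho> > 1" obtains K where "K > 0" "\<And>n. \<omega> n \<le> K * \<rho> ^ n"
proof -
  have "\<forall>\<^sub>F n in sequentially. \<omega> n powr (1 / real n) < \<rho>"
    using order_tendstoD(2)[OF weight_root assms] .
  then obtain N where N: "\<And>n. n \<ge> N \<Longrightarrow> \<omega> n powr (1 / real n) < \<rho>"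
    by (auto simp: eventually_at_top_linorder)
  have le: "\<omega> n \<le> \<rho> ^ n" if "n \<ge> N" "n > 0" for n
  proof -
    have "\<omega> n = (\<omega> n powr (1 / real n)) powr real n"
      using that weight_ge_1[of n] by (simp add: powr_powr)
    also have "\<dots> \<le> \<rho> powr real n" using N[OF that(1)] by (intro powr_mono2) auto
    finally show ?thesis using assms by (simp add: powr_realpow)
  qed
  define K where "K = 1 + (\<Sum>n\<le>N. \<omega> n)"
  have "K \<ge> 1" unfolding K_def by (simp add: sum_nonneg order_trans[OF zero_le_one weight_ge_1])
  moreover have "\<omega> n \<le> K * \<rho> ^ n" for n
  proof (cases "n \<le> N")
    case True
    then have "\<omega> n \<le> (\<Sum>n\<le>N. \<omega> n)"
      by (intro member_le_sum) (auto intro: order_trans[OF zero_le_one weight_ge_1])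
    moreover have "K * 1 \<le> K * \<rho> ^ n" using assms \<open>K \<ge> 1\<close> by (intro mult_left_mono one_le_power) auto
    ultimately show ?thesis by (simp add: K_def)
  next
    case False
    have "1 * \<rho> ^ n \<le> K * \<rho> ^ n" using assms \<open>K \<ge> 1\<close> by (intro mult_right_mono) auto
    then show ?thesis using le[of n] False by simp
  qed
  ultimately show ?thesis using that[of K] by simp
qed

text \<open>By condition (i), \<omega> is dominated by r^n for any r > 1, in particular with r <
  \<rho>. So every series converging in a disc of radius greater than 1 is in all
  \<open>E k\<close>.\<close>

lemma nrm_geometric:
  assumes "\<rho> > 1"
  obtains K where "K > 0" "\<And>M B a. B \<ge> 0 \<Longrightarrow> (\<And>n. norm (fps_nth a n) \<le> B / \<rho> ^ n) \<Longrightarrow> nrm k M a \<le> K * B"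
proof -
  define r where "r = (1 + \<rho>) / 2"
  have r: "1 < r" "r < \<rho>" using assms by (auto simp: r_def)
  obtain K where K: "K > 0" "\<And>n. \<omega> n \<le> K * r ^ n" using weight_geometric[OF r(1)] by blast
  have q: "summable (\<lambda>n. (r / \<rho>) ^ n)" using r by (intro summable_geometric) auto
  define S where "S = (\<Sum>n. (r / \<rho>) ^ n)"
  have "nrm k M a \<le> (K * S) * B" if B: "B \<ge> 0" "\<And>n. norm (fps_nth a n) \<le> B / \<rho> ^ n" for M B a
  proof -
    have "nrm k M a \<le> (\<Sum>n\<le>M. wt k n * norm (fps_nth a n))"
      unfolding nrm_def by (rule L2_set_le_sum) auto
    also have "\<dots> \<le> (\<Sum>n\<le>M. K * B * (r / \<rho>) ^ n)"
    proof (rule sum_mono)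
      fix n
      have "wt k n * norm (fps_nth a n) \<le> (K * r ^ n) * (B / \<rho> ^ n)"
        using order_trans[OF wt_antimono[of 0 k n]] K r wt_0 by (intro mult_mono B) auto
      then show "wt k n * norm (fps_nth a n) \<le> K * B * (r / \<rho>) ^ n"
        by (simp add: power_divide mult_ac)
    qed
    also have "\<dots> = K * B * (\<Sum>n\<le>M. (r / \<rho>) ^ n)" by (simp add: sum_distrib_left)
    also have "\<dots> \<le> K * B * S"
      unfolding S_def using K B r by (intro mult_left_mono sum_le_suminf q) auto
    finally show ?thesis by (simp add: mult_ac)
  qed
  moreover have "S > 0" unfolding S_def using r by (intro suminf_pos q) auto
  ultimately show ?thesis using that[of "K * S"] K by simp
qed

lemma E_truncate: assumes "a \<in> E k" "\<epsilon> > 0"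
  obtains p where "\<And>M. nrm k M (fps_of_poly p - a) \<le> \<epsilon>"
proof -
  have s: "summable (\<lambda>n. (wt k n * norm (fps_nth a n))\<^sup>2)" using assms by (simp add: E_def)
  have "(\<lambda>L. \<Sum>n. (wt k (n + L) * norm (fps_nth a (n + L)))\<^sup>2) \<longlonglongrightarrow> 0"
    by (rule suminf_exist_split2[OF s])
  from order_tendstoD(2)[OF this, of "\<epsilon>\<^sup>2"] assms(2)
  obtain L where L: "(\<Sum>n. (wt k (n + L) * norm (fps_nth a (n + L)))\<^sup>2) < \<epsilon>\<^sup>2"
    by (auto simp: eventually_at_top_linorder)
  define p where "p = (\<Sum>i<L. monom (fps_nth a i) i)"
  have p: "coeff p n = (if n < L then fps_nth a n else 0)" for n
    by (simp add: p_def coeff_sum)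
  have "nrm k M (fps_of_poly p - a) \<le> \<epsilon>" for M
  proof -
    have "(\<Sum>n\<le>M. (wt k n * norm (fps_nth (fps_of_poly p - a) n))\<^sup>2)
      = (\<Sum>n\<in>{L..M}. (wt k n * norm (fps_nth a n))\<^sup>2)"
      by (intro sum.mono_neutral_cong_right) (auto simp: p)
    also have "\<dots> \<le> (\<Sum>n\<in>{0+L..M+L}. (wt k n * norm (fps_nth a n))\<^sup>2)"
      by (intro sum_mono2) auto
    also have "\<dots> = (\<Sum>n\<in>{0..M}. (wt k (n + L) * norm (fps_nth a (n + L)))\<^sup>2)"
      by (rule sum.shift_bounds_cl_nat_ivl)
    also have "\<dots> \<le> (\<Sum>n. (wt k (n + L) * norm (fps_nth a (n + L)))\<^sup>2)"
      by (intro sum_le_suminf summable_ignore_initial_segment[OF s]) auto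
    also have "\<dots> \<le> \<epsilon>\<^sup>2" using L by simp
    finally show ?thesis unfolding nrm_def L2_set_def using assms(2) by (simp add: real_le_lsqrt)
  qed
  then show ?thesis using that by blast
qed

lemma nrm_power_le:
  assumes C: "C > 0" "\<And>M a b. nrm k M (a * b) \<le> C * nrm k M a * nrm k M b"
    and "nrm k M a \<le> \<eta>" "n > 0"
  shows "nrm k M (a ^ n) \<le> (C * \<eta>) ^ n / C"
  using assms(4)
proof (induction n rule: nat_induct_non_zero)
  case 1
  then show ?case using C(1) assms(3) by simp
next
  case (Suc n)
  have \<eta>: "\<eta> \<ge> 0" using assms(3) nrm_nonneg[of k M a] by linarith
  have "nrm k M (a ^ Suc n) \<le> C * nrm k M a * nrm k M (a ^ n)" using C(2)[of M a "a ^ n"] by simp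
  also have "\<dots> \<le> C * \<eta> * ((C * \<eta>) ^ n / C)"
    using C(1) \<eta> Suc assms(3) by (intro mult_mono) auto
  finally show ?case by simp
qed

end

text \<open>Cauchy's inequality is applied to 1 / p^m directly, so the growth in m is (1 /
  \<delta>)^m. Multiplying norms m times would bring in the m-th power of an uncontrolled
  constant.\<close>

lemma fps_inverse_poly_power_coeff_bound:
  fixes p :: "complex poly"
  assumes "\<rho> > 0" "\<delta> > 0" and p: "\<And>z. norm z \<le> \<rho> \<Longrightarrow> \<delta> \<le> norm (poly p z)"
  shows "norm (fps_nth (inverse (fps_of_poly p) ^ m) n) \<le> ((1 / \<delta>) ^ m) / \<rho> ^ n"
proof -
  define f :: "complex \<Rightarrow> complex" where "f z = inverse (poly p z) ^ m" for z
  have nz: "poly p z \<noteq> 0" if "norm z \<le> \<rho>" for z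
    using p[OF that] assms(2) by auto
  have p0: "fps_nth (fps_of_poly p) 0 \<noteq> 0" using nz[of 0] assms(1) by (simp add: poly_0_coeff_0)
  have "eval_fps (fps_of_poly p) = poly p" by (rule ext) simp
  then have "poly p has_fps_expansion fps_of_poly p"
    using eval_fps_has_fps_expansion[of "fps_of_poly p"] by simp
  then have "f has_fps_expansion (inverse (fps_of_poly p) ^ m)"
    unfolding f_def by (intro fps_expansion_intros p0)
  then have "fps_nth (inverse (fps_of_poly p) ^ m) n = (deriv ^^ n) f 0 / fact n"
    by (rule fps_nth_fps_expansion)
  moreover have "norm ((deriv ^^ n) f 0) \<le> fact n * ((1 / \<delta>) ^ m) / \<rho> ^ n"
  proof (rule Cauchy_inequality)
    show "f holomorphic_on ball 0 \<rho>"
      unfolding f_def by (intro holomorphic_intros) (use nz in auto)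
    show "continuous_on (cball 0 \<rho>) f"
      unfolding f_def by (intro continuous_intros) (use nz in auto)
    fix z :: complex assume z: "norm (0 - z) = \<rho>"
    have "norm (f z) = (1 / norm (poly p z)) ^ m"
      by (simp add: f_def norm_power norm_divide inverse_eq_divide)
    also have "\<dots> \<le> (1 / \<delta>) ^ m"
      using p[of z] z assms(2) by (intro power_mono divide_left_mono mult_pos_pos) auto
    finally show "norm (f z) \<le> (1 / \<delta>) ^ m" .
  qed fact
  then have "norm ((deriv ^^ n) f 0) / fact n \<le> (fact n * ((1 / \<delta>) ^ m) / \<rho> ^ n) / fact n"
    by (rule divide_right_mono) simp
  ultimately show ?thesis by (simp add: norm_divide)
qed

context smooth_weight begin

text \<open>Wiener's lemma by Newman's approximation argument: for a polynomial \<open>p\<close> close to \<open>g\<close> put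
  \<open>S = (p - g) / p\<close>, so that \<open>1 / g = (1 / p) (1 + S + \<dots> + S ^ (m - 1)) + S ^ m / g\<close>. A power of
  \<open>S\<close> is small, and as \<open>nrm\<close> only sees the coefficients up to \<open>M\<close>, the last term can be absorbed
  into the left-hand side.\<close>

lemma E_inverse:
  assumes g: "g \<in> E k" and nz: "\<And>z. norm z \<le> 1 \<Longrightarrow> eval_fps g z \<noteq> 0"
  shows "inverse g \<in> E k"
proof -
  have "continuous_on (cball 0 1) (\<lambda>z. norm (eval_fps g z))"
    by (intro continuous_intros continuous_on_eval_fps_E[OF g])
  then obtain z0 where z0: "z0 \<in> cball 0 1" "\<And>z. z \<in> cball 0 1 \<Longrightarrow> norm (eval_fps g z0) \<le> norm (eval_fps g z)"
    using continuous_attains_inf[of "cball (0::complex) 1" "\<lambda>z. norm (eval_fps g z)"] by auto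
  define \<delta> where "\<delta> = norm (eval_fps g z0)"
  have \<delta>: "\<delta> > 0" "\<And>z. norm z \<le> 1 \<Longrightarrow> \<delta> \<le> norm (eval_fps g z)"
    using z0 nz by (auto simp: \<delta>_def)
  obtain C where C: "C > 0" "\<And>M a b. nrm k M (a * b) \<le> C * nrm k M a * nrm k M b"
    using nrm_mult by blast
  obtain D where D: "D > 0" "\<And>M a. (\<Sum>n\<le>M. norm (fps_nth a n)) \<le> D * nrm k M a"
    using nrm_ge_norm_sum by blast
  \<comment> \<open>The first bound makes 4 / \<delta> * (C \<eta>) at most 1 / 2, the ratio of the
    powers of S; the second keeps |p| at least \<delta> / 2 on the disc.\<close>
  define \<eta> where "\<eta> = min (\<delta> / (8 * C)) (\<delta> / (2 * D))"
  have \<eta>: "\<eta> > 0" "C * \<eta> \<le> \<delta> / 8" "D * \<eta> \<le> \<delta> / 2"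
    using \<delta>(1) C(1) D(1) by (auto simp: \<eta>_def min_def field_simps)
  obtain p where p: "\<And>M. nrm k M (fps_of_poly p - g) \<le> \<eta>"
    using E_truncate[OF g \<eta>(1)] by blast
  define R where "R = fps_of_poly p - g"
  have R: "R \<in> E k" unfolding R_def using g by blast
  have R_le: "norm (eval_fps R z) \<le> \<delta> / 2" if z: "norm z \<le> 1" for z
  proof -
    have "(\<Sum>n<M. norm (fps_nth R n)) \<le> \<delta> / 2" for M
    proof -
      have "(\<Sum>n<M. norm (fps_nth R n)) \<le> (\<Sum>n\<le>M. norm (fps_nth R n))" by (intro sum_mono2) auto
      also have "\<dots> \<le> D * nrm k M R" by (rule D)
      also have "\<dots> \<le> D * \<eta>" using p[of M] D(1) by (simp add: R_def)
      finally show ?thesis using \<eta>(3) by linarith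
    qed
    then have "(\<Sum>n. norm (fps_nth R n)) \<le> \<delta> / 2"
      by (intro suminf_le_const E_norm_summable[OF R])
    moreover have "norm (eval_fps R z) \<le> (\<Sum>n. norm (fps_nth R n * z ^ n))"
      unfolding eval_fps_def by (intro summable_norm E_summable[OF R z])
    moreover have "\<dots> \<le> (\<Sum>n. norm (fps_nth R n))"
      by (intro suminf_le E_summable[OF R z] E_norm_summable[OF R])
        (use z in \<open>auto simp: norm_mult norm_power intro!: mult_left_le power_le_one\<close>)
    ultimately show ?thesis by linarith
  qed
  have p_ge: "\<delta> / 2 \<le> norm (poly p z)" if z: "norm z \<le> 1" for z
  proof -
    have "poly p z = eval_fps R z + eval_fps g z"
      using eval_fps_add_E[OF R g z] by (simp add: R_def)
    then have "norm (eval_fps g z) \<le> norm (poly p z) + norm (eval_fps R z)"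
      using norm_triangle_ineq4[of "poly p z" "eval_fps R z"] by simp
    then show ?thesis using R_le[OF z] \<delta>(2)[OF z] by linarith
  qed
  \<comment> \<open>A lower bound for |p| on a strictly larger disc is what makes the coefficients
    of 1 / p^m decay geometrically.\<close>
  have "open {z. \<delta> / 4 < norm (poly p z)}" by (intro open_Collect_less continuous_intros)
  moreover have "cball 0 1 \<subseteq> {z. \<delta> / 4 < norm (poly p z)}"
  proof safe
    fix z :: complex assume "z \<in> cball 0 1"
    then show "\<delta> / 4 < norm (poly p z)" using p_ge[of z] \<delta>(1) by simp
  qed
  ultimately obtain \<epsilon> where \<epsilon>: "\<epsilon> > 0" "{z. infdist z (cball 0 1) \<le> \<epsilon>} \<subseteq> {z. \<delta> / 4 < norm (poly p z)}"
    using compact_in_open_separated[of "cball (0::complex) 1" "{z. \<delta> / 4 < norm (poly p z)}"] by auto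
  define \<rho> where "\<rho> = 1 + \<epsilon>"
  have \<rho>: "\<rho> > 1" using \<epsilon> by (simp add: \<rho>_def)
  have p\<rho>: "\<delta> / 4 \<le> norm (poly p z)" if z: "norm z \<le> \<rho>" for z
  proof (cases "norm z \<le> 1")
    case True
    then show ?thesis using p_ge[of z] \<delta>(1) by simp
  next
    case False
    have "of_real (norm z) * sgn z = z"
      using False by (simp add: sgn_eq)
    then have "z - sgn z = of_real (norm z - 1) * sgn z" by (simp add: left_diff_distrib)
    moreover have "norm (of_real (norm z - 1) :: complex) = norm z - 1"
      using False by (simp only: norm_of_real)
    ultimately have "dist z (sgn z) = norm z - 1"
      using False by (auto simp add: dist_norm norm_mult norm_sgn simp del: of_real_diff)
    moreover have "infdist z (cball 0 1) \<le> dist z (sgn z)"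
      using False by (intro infdist_le) (auto simp: norm_sgn)
    ultimately have "infdist z (cball 0 1) \<le> \<epsilon>" using z by (simp add: \<rho>_def)
    then show ?thesis using \<epsilon>(2) by auto
  qed
  define Q where "Q = inverse (fps_of_poly p)"
  obtain K where K: "K > 0"
    "\<And>M B a. B \<ge> 0 \<Longrightarrow> (\<And>n. norm (fps_nth a n) \<le> B / \<rho> ^ n) \<Longrightarrow> nrm k M a \<le> K * B"
    using nrm_geometric[OF \<rho>] by blast
  have Q_le: "nrm k M (Q ^ m) \<le> K * (4 / \<delta>) ^ m" for m M
    using fps_inverse_poly_power_coeff_bound[of \<rho> "\<delta> / 4" p m] \<rho> \<delta>(1) p\<rho>
    unfolding Q_def by (intro K(2)) auto
  have Q: "Q \<in> E k" unfolding E_iff_bounded using Q_le[of _ 1] by auto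
  define S where "S = Q * R"
  have S: "S \<in> E k" unfolding S_def using Q R by blast
  have S_le: "nrm k M (S ^ m) \<le> K * (1 / 2) ^ m" if "m > 0" for m M
  proof -
    have "nrm k M (S ^ m) \<le> C * nrm k M (Q ^ m) * nrm k M (R ^ m)"
      unfolding S_def power_mult_distrib by (rule C)
    also have "\<dots> \<le> C * (K * (4 / \<delta>) ^ m) * ((C * \<eta>) ^ m / C)"
      using nrm_power_le[OF C, of M R \<eta> m] p that C(1) K(1) \<delta>(1) Q_le \<eta>(1)
      by (intro mult_mono mult_nonneg_nonneg) (auto simp: R_def)
    also have "\<dots> = K * (4 / \<delta> * (C * \<eta>)) ^ m" using C(1) by (simp only: power_mult_distrib) simp
    also have "\<dots> \<le> K * (1 / 2) ^ m"
      using \<delta>(1) \<eta> C(1) K(1) by (intro mult_left_mono power_mono) (auto simp: field_simps)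
    finally show ?thesis .
  qed
  have "(\<lambda>m. K * (1 / 2) ^ m) \<longlonglongrightarrow> K * 0"
    by (intro tendsto_intros LIMSEQ_realpow_zero) auto
  then have "\<forall>\<^sub>F m in sequentially. K * (1 / 2) ^ m < 1 / (2 * C)"
    using C(1) by (intro order_tendstoD(2)) auto
  then obtain m0 where m0: "\<And>m. m \<ge> m0 \<Longrightarrow> K * (1 / 2) ^ m < 1 / (2 * C)"
    unfolding eventually_at_top_linorder by blast
  define m where "m = Suc m0"
  have m: "m > 0" "K * (1 / 2) ^ m < 1 / (2 * C)" using m0[of m] by (auto simp: m_def)
  define h where "h = inverse g"
  have g0: "fps_nth g 0 \<noteq> 0" using nz[of 0] by (simp add: eval_fps_at_0)
  then have hg: "h * g = 1" unfolding h_def by (rule inverse_mult_eq_1)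
  have "poly p 0 \<noteq> 0" using p\<rho>[of 0] \<rho> \<delta>(1) by auto
  then have Qp: "Q * fps_of_poly p = 1"
    unfolding Q_def by (intro inverse_mult_eq_1) (simp add: poly_0_coeff_0)
  have "1 - S = Q * g" using Qp by (simp add: S_def R_def algebra_simps)
  then have hS: "h * (1 - S) = Q" using hg by (simp add: mult_ac)
  define A where "A = Q * (\<Sum>i<m. S ^ i)"
  have "h * (1 - S ^ m) = A"
    unfolding one_diff_power_eq A_def mult.assoc[symmetric] hS ..
  then have h: "h = A + S ^ m * h" by (simp add: algebra_simps)
  have "A \<in> E k" unfolding A_def using Q S by blast
  then obtain B where B: "\<And>M. nrm k M A \<le> B" unfolding E_iff_bounded by blast
  have "nrm k M h \<le> 2 * B" for M
  proof -
    have "C * nrm k M (S ^ m) \<le> C * (1 / (2 * C))"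
      using S_le[OF m(1), of M] m(2) C(1) by (intro mult_left_mono) auto
    then have "C * nrm k M (S ^ m) * nrm k M h \<le> 1 / 2 * nrm k M h"
      using C(1) by (intro mult_right_mono) auto
    moreover have "nrm k M h \<le> nrm k M A + nrm k M (S ^ m * h)"
      by (subst h) (rule nrm_add)
    moreover have "nrm k M (S ^ m * h) \<le> C * nrm k M (S ^ m) * nrm k M h" by (rule C)
    ultimately show ?thesis using B[of M] by linarith
  qed
  then show ?thesis unfolding E_iff_bounded h_def by blast
qed

section \<open>Smoothness along the derivation u -> p u'\<close>

primrec W :: "complex fps \<Rightarrow> nat \<Rightarrow> nat \<Rightarrow> complex fps set" where
  "W p K 0 = E K"
| "W p K (Suc j) = {u \<in> E K. p * fps_deriv u \<in> W p K j}"

lemma W_subset_E: "W p K j \<subseteq> E K"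
  by (cases j) auto

lemma W_Suc_subset: "W p K (Suc j) \<subseteq> W p K j"
proof (induction j)
  case 0
  then show ?case using W_subset_E by simp
next
  case (Suc j)
  then show ?case by (auto simp del: W.simps(2) simp: W.simps(2)[of p K "Suc j"] W.simps(2)[of p K j])
qed

lemma W_add: "u \<in> W p K j \<Longrightarrow> v \<in> W p K j \<Longrightarrow> u + v \<in> W p K j"
  by (induction j arbitrary: u v) (auto simp: distrib_left)

lemma W_mult: "u \<in> W p K j \<Longrightarrow> v \<in> W p K j \<Longrightarrow> u * v \<in> W p K j"
proof (induction j arbitrary: u v)
  case (Suc j)
  have "p * fps_deriv (u * v) = u * (p * fps_deriv v) + (p * fps_deriv u) * v"
    by (simp add: algebra_simps)
  also have "\<dots> \<in> W p K j"
  proof (rule W_add)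
    show "u * (p * fps_deriv v) \<in> W p K j" "p * fps_deriv u * v \<in> W p K j"
      using Suc.prems W_Suc_subset[of p K j] by (auto intro!: Suc.IH simp del: mult.assoc)
  qed
  finally show ?case using Suc.prems by auto
qed auto

text \<open>As u -> p u' is a derivation, p (1 / u)' = - (p u') / u^2, and j is raised one step at a
  time. About 1 / u itself only membership in \<open>E K\<close> must be known, and that is Wiener's
  lemma.\<close>

lemma W_inverse:
  assumes "fps_nth u 0 \<noteq> 0" "inverse u \<in> E K"
  shows "u \<in> W p K j \<Longrightarrow> inverse u \<in> W p K j"
proof (induction j)
  case (Suc j)
  have uj: "u \<in> W p K j" using Suc.prems W_Suc_subset by blast
  have "0 \<in> W p K i" for i by (induction i) auto
  then have m1: "(- 1) \<in> W p K j" by (cases j) auto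
  have "p * fps_deriv (inverse u) = (- 1) * (p * fps_deriv u) * (inverse u * inverse u)"
    by (simp add: fps_inverse_deriv[OF assms(1)] power2_eq_square mult_ac)
  also have "\<dots> \<in> W p K j"
    using Suc.prems by (intro W_mult[OF W_mult[OF m1] W_mult] Suc.IH uj) simp
  finally show ?case using assms by simp
qed (use assms in auto)

lemma E_subset_W: assumes "p \<in> E 0" shows "i + j \<le> K \<Longrightarrow> E i \<subseteq> W p K j"
proof (induction j arbitrary: i)
  case 0
  then show ?case using E_mono by auto
next
  case (Suc j)
  have "p * fps_deriv u \<in> E (Suc i)" if "u \<in> E i" for u
    using E_deriv[OF that] E_mono[OF _ assms, of "Suc i"] by auto
  then show ?case using Suc.IH[of "Suc i"] Suc.prems E_mono[of i K] by auto
qed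

text \<open>The factor \<open>p\<close> compensates the loss of smoothness of \<open>f / p\<close>, because
  \<open>p (f / p)' = f' - p' (f / p)\<close>.\<close>

lemma quotient_mem_W:
  assumes p: "p \<in> E 0" "fps_deriv p \<in> E 0" and f: "p * g \<in> E 0" and g: "g \<in> E K"
  shows "j \<le> K \<Longrightarrow> g \<in> W p K j"
proof (induction j)
  case (Suc j)
  have "fps_deriv (p * g) \<in> E 1" using E_deriv[OF f] by simp
  then have "fps_deriv (p * g) \<in> W p K j" using E_subset_W[OF p(1), of 1 j K] Suc.prems by auto
  moreover have "(- 1) * fps_deriv p \<in> W p K j"
    using E_subset_W[OF p(1), of 0 j K] Suc.prems p(2) E_mult[OF E_uminus[OF E_1] p(2)] by auto
  then have "(- 1) * fps_deriv p * g \<in> W p K j"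
    using Suc by (rule_tac W_mult) auto
  ultimately have "fps_deriv (p * g) + (- 1) * fps_deriv p * g \<in> W p K j" by (rule W_add)
  moreover have "fps_deriv (p * g) + (- 1) * fps_deriv p * g = p * fps_deriv g"
    by (simp add: algebra_simps)
  ultimately show ?case using g by simp
qed (use g in auto)

text \<open>Each factor p trades one derivative p u' for a genuine one, by (p^(j+1) u)' = (j+1) p'
  p^j u + p^j (p u'); \<open>E_antideriv\<close> then lowers the index by one. With j = K the index
  0 is reached.\<close>

lemma power_mult_W_mem_E:
  assumes p: "p \<in> E 0" "fps_deriv p \<in> E 0"
  shows "j \<le> K \<Longrightarrow> u \<in> W p K j \<Longrightarrow> p ^ j * u \<in> E (K - j)"
proof (induction j arbitrary: u)
  case (Suc j)
  have "fps_deriv (p ^ Suc j * u) = of_nat (Suc j) * fps_deriv p * (p ^ j * u) + p ^ j * (p * fps_deriv u)"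
    using fps_deriv_power'[of p "Suc j"]
    unfolding fps_deriv_mult diff_Suc_1 by (simp only:) (simp add: algebra_simps)
  also have "\<dots> \<in> E (K - j)"
    using Suc.prems Suc.IH[of u] Suc.IH[of "p * fps_deriv u"] W_Suc_subset[of p K j] E_mono[OF _ p(2), of "K - j"]
    by (intro E_add E_mult[of "_ * _" _ "_ * _"] E_mult[of "of_nat _" _ "fps_deriv p"] E_of_nat) auto
  finally have "fps_deriv (p ^ Suc j * u) \<in> E (Suc (K - Suc j))"
    using Suc.prems by (simp add: Suc_diff_Suc)
  then show ?case by (rule E_antideriv)
qed auto

lemma poly_power_div_mem_E:
  assumes f: "fps_of_poly p * g \<in> E 0" and g: "g \<in> E K"
    and nz: "\<And>z. norm z \<le> 1 \<Longrightarrow> eval_fps g z \<noteq> 0"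
  shows "fps_of_poly p ^ K * inverse g \<in> E 0"
proof -
  have "fps_deriv (fps_of_poly p) \<in> E 0" by (metis E_poly fps_of_poly_pderiv)
  note p = E_poly this
  have "fps_nth g 0 \<noteq> 0" using nz[of 0] by (simp add: eval_fps_at_0)
  then have "inverse g \<in> W (fps_of_poly p) K K"
    using W_inverse E_inverse[OF g nz] quotient_mem_W[OF p f g] by simp
  from power_mult_W_mem_E[OF p order_refl this] show ?thesis by simp
qed

end

section \<open>Quasianalyticity\<close>

locale quasianalytic_weight = smooth_weight +
  assumes weight_log_convex: "log_convex \<omega>"
    and weight_divergence:
      "filterlim (\<lambda>N. \<Sum>n<N. ln (\<omega> n) / (real n powr (3 / 2) + 1)) at_top sequentially"
begin

section \<open>Support lines of the log-convex weight\<close>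

definition support_slope :: "nat \<Rightarrow> nat \<Rightarrow> real \<Rightarrow> bool" where
  "support_slope n0 r \<sigma> \<longleftrightarrow> (\<forall>n\<ge>n0. ln (\<omega> r) + \<sigma> * (ln (real n) - ln (real r)) \<le> ln (\<omega> n))"

text \<open>The chord of log \<omega> over log r and log (r + 1) serves as support line at r. Chord
  slopes increase by convexity, and they are unbounded because \<omega> outgrows every
  power.\<close>

lemma weight_support_line:
  obtains n0 where "n0 \<ge> 1"
    "\<And>q. \<exists>R\<ge>n0. \<forall>r\<ge>R. \<exists>\<sigma>\<ge>q. support_slope n0 r \<sigma>"
proof -
  obtain f t0 where f: "\<And>n. f (real n) = \<omega> n" and cvx: "convex_on {t0..} (\<lambda>t. ln (f (exp t)))"
    using weight_log_convex unfolding log_convex_def by blast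
  define \<phi> where "\<phi> t = ln (f (exp t))" for t
  have \<phi>: "\<phi> (ln (real n)) = ln (\<omega> n)" if "n \<ge> 1" for n
    using that f by (simp add: \<phi>_def)
  define n0 where "n0 = max 1 (nat \<lceil>exp t0\<rceil>)"
  have n0: "n0 \<ge> 1" by (simp add: n0_def)
  have t0: "t0 \<le> ln (real n)" if "n \<ge> n0" for n
  proof -
    have "exp t0 \<le> real n" using that by (simp add: n0_def)
    then have "ln (exp t0) \<le> ln (real n)" by (subst ln_le_cancel_iff) (use that n0 in auto)
    then show ?thesis by simp
  qed
  define slope where "slope m n = (ln (\<omega> m) - ln (\<omega> n)) / (ln (real m) - ln (real n))" for m n
  have conv: "slope m n \<le> slope m l" "slope m l \<le> slope n l" if "n0 \<le> m" "m < n" "n < l" for m n l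
    using convex_on_slope_le[OF cvx, of "ln (real m)" "ln (real l)" "ln (real n)"] t0[of m] t0[of l] that n0
      \<phi>[of m] \<phi>[of n] \<phi>[of l]
    by (auto simp: slope_def \<phi>_def)
  have line: "ln (\<omega> n) \<ge> ln (\<omega> r) + slope r (Suc r) * (ln (real n) - ln (real r))"
    if "r \<ge> n0" "n \<ge> n0" for r n
  proof -
    consider "n < r" | "n = r" | "n = Suc r" | "n > Suc r" by linarith
    then show ?thesis
    proof cases
      case 1
      have "slope n r \<le> slope r (Suc r)" using conv[of n r "Suc r"] 1 that by linarith
      moreover have "ln (real n) < ln (real r)" using 1 n0 that by simp
      ultimately show ?thesis by (simp add: slope_def[of n r] divide_simps algebra_simps split: if_splits)
    next
      case 3
      have "ln (real r) < ln (real n)" using 3 n0 that by simp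
      then show ?thesis using 3 by (simp add: slope_def divide_simps) (simp add: algebra_simps)
    next
      case 4
      have "slope r (Suc r) \<le> slope r n" using conv[of r "Suc r" n] 4 that by linarith
      moreover have "ln (real r) < ln (real n)" using 4 n0 that by simp
      ultimately show ?thesis by (simp add: slope_def[of r n] divide_simps algebra_simps split: if_splits)
    qed simp
  qed
  have big: "\<exists>R\<ge>n0. \<forall>r\<ge>R. slope r (Suc r) \<ge> q" for q
  proof -
    \<comment> \<open>Growth of degree at least |q| + 1 leaves one spare power of r, which outweighs
      the constant c.\<close>
    define k where "k = nat \<lceil>\<bar>q\<bar>\<rceil> + 1"
    have k: "real k \<ge> \<bar>q\<bar> + 1" unfolding k_def by linarith
    obtain b where b: "b > 0" "\<And>n. b \<le> wt k n" using wt_lower by blast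
    define c where "c = ln (\<omega> n0) - ln b + \<bar>q\<bar> * ln (real n0)"
    have "filterlim (\<lambda>r::nat. ln (real r)) at_top sequentially" by real_asymp
    then have "\<forall>\<^sub>F r::nat in sequentially. c + \<bar>q\<bar> * ln (real n0) \<le> ln (real r)"
      unfolding filterlim_at_top by blast
    then obtain R where R: "\<And>r. r \<ge> R \<Longrightarrow> c + \<bar>q\<bar> * ln (real n0) \<le> ln (real r)"
      by (auto simp: eventually_at_top_linorder)
    have "slope r (Suc r) \<ge> q" if "r \<ge> max (Suc n0) R" for r
    proof -
      have r: "r > n0" "real r > 0" using that by auto
      have l0: "0 \<le> ln (real n0)" "ln (real n0) < ln (real r)" "0 \<le> ln (real r)" using n0 r by auto
      have "b * (real r + 1) ^ k \<le> \<omega> r" using b(2)[of r] by (simp add: wt_def field_simps)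
      then have "ln (b * (real r + 1) ^ k) \<le> ln (\<omega> r)"
        using b(1) weight_ge_1[of r] by (subst ln_le_cancel_iff) auto
      then have 1: "ln b + real k * ln (real r + 1) \<le> ln (\<omega> r)"
        using b(1) by (simp add: ln_mult ln_realpow)
      have "(\<bar>q\<bar> + 1) * ln (real r) \<le> real k * ln (real r + 1)"
        using k l0 r by (intro mult_mono) auto
      moreover have "c + \<bar>q\<bar> * ln (real n0) \<le> ln (real r)" using R that by simp
      moreover have "0 \<le> \<bar>q\<bar> * ln (real n0)" using l0 by simp
      ultimately have "ln (\<omega> r) - ln (\<omega> n0) \<ge> \<bar>q\<bar> * (ln (real r) - ln (real n0))"
        using 1 by (simp add: c_def algebra_simps)
      then have "ln (\<omega> n0) - ln (\<omega> r) \<le> \<bar>q\<bar> * (ln (real n0) - ln (real r))"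
        by (simp add: algebra_simps)
      then have "slope n0 r \<ge> \<bar>q\<bar>" using l0 by (simp add: slope_def divide_simps)
      moreover have "slope n0 r \<le> slope r (Suc r)" using conv[of n0 r "Suc r"] r by linarith
      ultimately show ?thesis by linarith
    qed
    then show ?thesis by (intro exI[of _ "max (Suc n0) R"]) auto
  qed
  show ?thesis
  proof (rule that[OF n0])
    fix q
    obtain R where R: "R \<ge> n0" "\<forall>r\<ge>R. slope r (Suc r) \<ge> q" using big by blast
    then show "\<exists>R\<ge>n0. \<forall>r\<ge>R. \<exists>\<sigma>\<ge>q. support_slope n0 r \<sigma>"
      unfolding support_slope_def using line by (meson order_trans)
  qed
qed

text \<open>The exponent \<open>j\<close> is chosen so that \<open>j + k + 2\<close> is the integer part of the slope of the
  support line of \<open>log \<omega>\<close> at \<open>r\<close>.\<close>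

lemma weighted_power_bound:
  obtains D R where "D > 0" "R \<ge> 1"
    "\<And>r. r \<ge> R \<Longrightarrow> \<exists>j. \<forall>n. (real n + 1) ^ k / \<omega> n * real n ^ j
        \<le> D / wt (k + 3) r * real r ^ j * (1 / (real n + 1)\<^sup>2)"
proof -
  obtain n0 where n0: "n0 \<ge> 1"
    "\<And>q. \<exists>R\<ge>n0. \<forall>r\<ge>R. \<exists>\<sigma>\<ge>q. support_slope n0 r \<sigma>"
    using weight_support_line by blast
  obtain R where R: "R \<ge> n0"
    "\<And>r. r \<ge> R \<Longrightarrow> \<exists>\<sigma>\<ge>real k + 4. support_slope n0 r \<sigma>"
    using n0(2)[of "real k + 4"] by blast
  \<comment> \<open>The 4 bounds (n + 1)^2 / n^2 for n >= n0; the other summand is for the finitely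
    many n < n0, whose terms are compared with the one at n0.\<close>
  define K where "K = 4 + \<omega> n0 * (real n0 + 1)\<^sup>2"
  have wpos: "\<omega> n > 0" for n using weight_ge_1[of n] by linarith
  have K: "K > 0" unfolding K_def using wpos[of n0] by (intro add_pos_nonneg) auto
  have main: "\<exists>j. \<forall>n. (real n + 1) ^ k / \<omega> n * real n ^ j
        \<le> 2 ^ k * K / wt (k + 3) r * real r ^ j * (1 / (real n + 1)\<^sup>2)" if r: "r \<ge> R" for r
  proof -
    obtain \<sigma> where \<sigma>: "\<sigma> \<ge> real k + 4"
      "\<And>n. n \<ge> n0 \<Longrightarrow> ln (\<omega> n) \<ge> ln (\<omega> r) + \<sigma> * (ln (real n) - ln (real r))"
      using R(2)[OF r] unfolding support_slope_def by blast
    define j where "j = nat \<lfloor>\<sigma>\<rfloor> - (k + 2)"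
    have j: "real (j + k + 2) \<le> \<sigma>" "\<sigma> \<le> real (j + k + 3)" "j \<ge> 1"
      using \<sigma>(1) unfolding j_def by linarith+
    have r0: "real r \<ge> 1" using r R n0 by simp
    have powr: "\<omega> n \<ge> \<omega> r * (real n / real r) powr \<sigma>" if n: "n \<ge> n0" for n
    proof -
      have "n > 0" using n n0 by simp
      have "exp (ln (\<omega> r) + \<sigma> * (ln (real n) - ln (real r))) \<le> exp (ln (\<omega> n))"
        using \<sigma>(2)[OF n] by simp
      then show ?thesis using r0 \<open>n > 0\<close> wpos by (simp add: exp_add powr_def ln_div)
    qed
    \<comment> \<open>The slope \<sigma> lies between two consecutive integers: the lower one is the
      exponent used where n / r >= 1, the upper one where n / r < 1. Rounding costs one power of r,
      whence \<open>wt (k + 3) r\<close>.\<close>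
    have pow: "real n ^ j * real n ^ (k + 2) / real r ^ (j + k + 3) \<le> (real n / real r) powr \<sigma>"
      if n: "n \<ge> 1" for n
    proof (cases "n \<ge> r")
      case True
      have "real n ^ j * real n ^ (k + 2) / real r ^ (j + k + 3) \<le> real n ^ j * real n ^ (k + 2) / real r ^ (j + k + 2)"
        using r0 by (intro divide_left_mono power_increasing mult_pos_pos) auto
      also have "\<dots> = (real n / real r) powr real (j + k + 2)"
        using r0 n by (subst powr_realpow) (auto simp: power_divide power_add)
      also have "\<dots> \<le> (real n / real r) powr \<sigma>"
        using True r0 by (intro powr_mono j) auto
      finally show ?thesis .
    next
      case False
      have "real n ^ (j + k + 2) \<le> real n ^ (j + k + 3)" using n by (intro power_increasing) auto
      then have "real n ^ j * real n ^ (k + 2) / real r ^ (j + k + 3) \<le> real n ^ (j + k + 3) / real r ^ (j + k + 3)"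
        by (intro divide_right_mono) (auto simp: power_add mult_ac)
      also have "\<dots> = (real n / real r) powr real (j + k + 3)"
        using r0 n by (subst powr_realpow) (auto simp: power_divide)
      also have "\<dots> \<le> (real n / real r) powr \<sigma>"
        using False n r0 j(2) by (intro powr_mono') auto
      finally show ?thesis .
    qed
    define a where "a n = (real n + 1) ^ k / \<omega> n * real n ^ j" for n
    define B where "B = 2 ^ k / wt (k + 3) r * real r ^ j"
    have B: "B \<ge> 0" by (simp add: B_def)
    have large: "a n \<le> B * (1 / (real n)\<^sup>2)" if n: "n \<ge> n0" for n
    proof -
      have n1: "n \<ge> 1" using n n0 by simp
      have "\<omega> r * (real n ^ j * real n ^ (k + 2) / real r ^ (j + k + 3)) \<le> \<omega> r * (real n / real r) powr \<sigma>"
        using wpos[of r] by (intro mult_left_mono pow[OF n1]) auto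
      also have "\<dots> \<le> \<omega> n" by (rule powr[OF n])
      finally have 1: "\<omega> r * (real n ^ j * real n ^ (k + 2)) \<le> \<omega> n * real r ^ (j + k + 3)"
        using r0 by (simp add: divide_simps)
      have "(real n + 1) ^ k \<le> (2 * real n) ^ k" using n1 by (intro power_mono) auto
      then have "(real n + 1) ^ k * real n ^ j * (\<omega> r * (real n)\<^sup>2) \<le> (2 * real n) ^ k * real n ^ j * (\<omega> r * (real n)\<^sup>2)"
        using wpos[of r] by (intro mult_right_mono) auto
      also have "\<dots> = 2 ^ k * (\<omega> r * (real n ^ j * real n ^ (k + 2)))"
        by (simp add: power_mult_distrib power_add power2_eq_square mult_ac)
      also have "\<dots> \<le> 2 ^ k * (\<omega> n * real r ^ (j + k + 3))"
        using 1 by (intro mult_left_mono) auto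
      also have "\<dots> \<le> 2 ^ k * (\<omega> n * (real r ^ j * (real r + 1) ^ (k + 3)))"
        unfolding add.assoc power_add[of _ j] using wpos[of n]
        by (intro mult_left_mono power_mono) auto
      finally show ?thesis
        using wpos[of r] wpos[of n] n1 by (simp add: a_def B_def wt_def field_simps)
    qed
    have "a n \<le> K * B * (1 / (real n + 1)\<^sup>2)" for n
    proof (cases "n \<ge> n0")
      case True
      have "(real n + 1)\<^sup>2 \<le> (2 * real n)\<^sup>2" using True n0 by (intro power_mono) auto
      then have "1 / (real n)\<^sup>2 \<le> 4 * (1 / (real n + 1)\<^sup>2)"
        using True n0 by (simp add: divide_simps)
      also have "\<dots> \<le> K * (1 / (real n + 1)\<^sup>2)"
        using wpos[of n0] by (intro mult_right_mono) (auto simp: K_def)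
      finally have "B * (1 / (real n)\<^sup>2) \<le> B * (K * (1 / (real n + 1)\<^sup>2))"
        using B by (rule mult_left_mono)
      then show ?thesis using large[OF True] by (simp add: mult_ac)
    next
      case False
      have "a n \<le> (real n0 + 1) ^ k / 1 * real n0 ^ j"
        unfolding a_def using False weight_ge_1[of n] by (intro mult_mono frac_le power_mono) auto
      also have "\<dots> = \<omega> n0 * a n0" using wpos[of n0] by (simp add: a_def)
      also have "\<dots> \<le> \<omega> n0 * (B * (1 / (real n0)\<^sup>2))"
        using wpos[of n0] by (intro mult_left_mono large) auto
      also have "\<dots> \<le> \<omega> n0 * (B * ((real n0 + 1)\<^sup>2 * (1 / (real n + 1)\<^sup>2)))"
      proof -
        have "(real n + 1)\<^sup>2 \<le> (real n0 + 1)\<^sup>2" using False by (intro power_mono) auto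
        then have "1 \<le> (real n0 + 1)\<^sup>2 * (1 / (real n + 1)\<^sup>2)" by (simp add: divide_simps)
        moreover have "1 / (real n0)\<^sup>2 \<le> 1" using n0 by (simp add: divide_simps)
        ultimately have "1 / (real n0)\<^sup>2 \<le> (real n0 + 1)\<^sup>2 * (1 / (real n + 1)\<^sup>2)" by linarith
        then show ?thesis using wpos[of n0] B by (intro mult_left_mono) auto
      qed
      also have "\<dots> \<le> K * B * (1 / (real n + 1)\<^sup>2)"
        using B by (simp add: K_def algebra_simps add_divide_distrib)
      finally show ?thesis .
    qed
    then show ?thesis by (intro exI[of _ j]) (simp add: a_def B_def mult_ac)
  qed
  then show ?thesis using that[of "2 ^ k * K" R] K R n0 by simp
qed

end

section \<open>Logarithmic integrals in the upper half-plane\<close>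

lemma upper_half_plane_maximum:
  fixes f :: "complex \<Rightarrow> complex"
  assumes cont: "continuous_on {w. Im w \<ge> 0} f" and hol: "f holomorphic_on {w. Im w > 0}"
    and real: "\<And>x. norm (f (complex_of_real x)) \<le> B" and "B > 0"
    and decay: "\<And>w. Im w \<ge> 0 \<Longrightarrow> w \<noteq> 0 \<Longrightarrow> norm (f w) \<le> K / norm w"
    and w: "Im w > 0"
  shows "norm (f w) \<le> B"
proof -
  \<comment> \<open>At radius |K| / B or more the decay already gives the bound B on the arc, so the
    maximum principle applies to a half-disc.\<close>
  define \<rho> where "\<rho> = max (norm w + 1) (\<bar>K\<bar> / B)"
  have \<rho>: "\<rho> > norm w" "\<rho> > 0" "\<bar>K\<bar> / B \<le> \<rho>"
    using norm_ge_zero[of w] by (auto simp: \<rho>_def less_max_iff_disj intro: add_nonneg_pos)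
  define S where "S = ball 0 \<rho> \<inter> {w. Im w > 0}"
  have "open S" unfolding S_def by (intro open_Int open_ball open_Collect_less continuous_intros)
  then have int: "interior S = S" by (rule interior_open)
  have cl: "closure S \<subseteq> cball 0 \<rho> \<inter> {w. Im w \<ge> 0}"
    by (rule closure_minimal)
      (auto simp: S_def intro!: closed_Int closed_Collect_le continuous_intros)
  show ?thesis
  proof (rule maximum_modulus_frontier[of f S])
    show "f holomorphic_on interior S"
      unfolding int by (rule holomorphic_on_subset[OF hol]) (auto simp: S_def)
    show "continuous_on (closure S) f"
      by (rule continuous_on_subset[OF cont]) (use cl in auto)
    show "bounded S" unfolding S_def by (intro bounded_Int disjI1 bounded_ball)
    show "w \<in> S" using w \<rho> by (simp add: S_def)
    fix z assume "z \<in> frontier S"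
    then have z: "z \<in> closure S" "z \<notin> S" by (auto simp: frontier_def int)
    then have "norm z \<le> \<rho>" "Im z \<ge> 0" using cl by auto
    with z(2) consider "Im z = 0" | "norm z = \<rho>" by (force simp: S_def)
    then show "norm (f z) \<le> B"
    proof cases
      case 1
      then have "z = complex_of_real (Re z)" by (simp add: complex_eq_iff)
      then show ?thesis using real by metis
    next
      case 2
      then have "norm (f z) \<le> K / \<rho>" using decay[OF \<open>Im z \<ge> 0\<close>] \<rho>(2) by auto
      also have "\<dots> \<le> \<bar>K\<bar> / \<rho>" using \<rho>(2) by (intro divide_right_mono) auto
      also have "\<dots> \<le> B" using \<rho>(2,3) \<open>B > 0\<close> by (simp add: field_simps)
      finally show ?thesis .
    qed
  qed
qed

text \<open>The real part of \<open>barrier\<close> is at most the indicator function of \<open>1 / 2 < \<bar>x\<bar>\<close> on the real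
  line, but it is of order \<open>y\<close> at \<open>\<i> y\<close> for small \<open>y\<close>, like the harmonic measure of that set.\<close>

definition barrier :: "complex \<Rightarrow> complex" where
  "barrier w = (1 - \<i> / (w + \<i>)) * (1 - 5 / 8 * (\<i> / (w + \<i>)))"

text \<open>With c in place of 5 / 8 in \<open>barrier\<close> the numerator would be x^2 (x^2 + 1 -
  2 c); the value 5 / 8 puts the sign change at |x| = 1 / 2.\<close>

lemma Re_barrier_real: "Re (barrier (of_real x)) = x\<^sup>2 * (x\<^sup>2 - 1 / 4) / (x\<^sup>2 + 1)\<^sup>2"
proof -
  define s where "s = x\<^sup>2 + 1"
  have s: "s > 0" "s \<noteq> 0" unfolding s_def by (simp_all add: add_nonneg_pos add_nonneg_eq_0_iff)
  have "\<i> / (of_real x + \<i>) = Complex (1 / s) (x / s)"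
    by (simp add: complex_eq_iff Re_divide Im_divide s_def)
  then have "barrier (of_real x) = (1 - Complex (1 / s) (x / s)) * (1 - 5 / 8 * Complex (1 / s) (x / s))"
    by (simp add: barrier_def)
  then have "Re (barrier (of_real x)) = (1 - 1 / s) * (1 - 5 / 8 * (1 / s)) - (x / s) * (5 / 8 * (x / s))"
    by (simp add: mult.commute)
  also have "\<dots> = ((s - 1) * (s - 5 / 8) - 5 / 8 * x\<^sup>2) / s\<^sup>2"
    using s by (simp add: field_simps power2_eq_square)
  also have "(s - 1) * (s - 5 / 8) - 5 / 8 * x\<^sup>2 = x\<^sup>2 * (x\<^sup>2 - 1 / 4)"
    by (simp add: s_def algebra_simps power2_eq_square)
  finally show ?thesis by (simp add: s_def)
qed

lemma Re_barrier_real_le: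
  shows "Re (barrier (of_real x)) \<le> 1" and "x\<^sup>2 \<le> 1 / 4 \<Longrightarrow> Re (barrier (of_real x)) \<le> 0"
proof -
  have "x\<^sup>2 * (x\<^sup>2 - 1 / 4) \<le> (x\<^sup>2 + 1)\<^sup>2"
    by (simp add: power2_eq_square algebra_simps)
  then show "Re (barrier (of_real x)) \<le> 1"
    unfolding Re_barrier_real by (intro divide_le_eq_1[THEN iffD2]) (auto simp: add_nonneg_eq_0_iff)
  show "Re (barrier (of_real x)) \<le> 0" if "x\<^sup>2 \<le> 1 / 4"
    unfolding Re_barrier_real using that by (intro divide_nonpos_nonneg mult_nonneg_nonpos) auto
qed

lemma norm_barrier_le: assumes "Im w \<ge> 0" shows "norm (barrier w) \<le> 4"
proof -
  define v where "v = \<i> / (w + \<i>)"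
  have "1 \<le> norm (w + \<i>)" using abs_Im_le_cmod[of "w + \<i>"] assms by simp
  then have v: "norm v \<le> 1" by (simp add: v_def norm_divide divide_simps)
  have "norm (1 - v) \<le> 2"
    using norm_triangle_ineq4[of 1 v] v by simp
  moreover have "norm (5 / 8 * v) \<le> 1" using v by (simp add: norm_mult norm_divide)
  then have "norm (1 - 5 / 8 * v) \<le> 2"
    using norm_triangle_ineq4[of 1 "5 / 8 * v"] by simp
  ultimately have "norm (1 - v) * norm (1 - 5 / 8 * v) \<le> 2 * 2"
    by (intro mult_mono) auto
  then show ?thesis by (simp add: barrier_def v_def norm_mult)
qed

lemma Re_barrier_imag:
  assumes "y > 0" shows "Re (barrier (\<i> * of_real y)) \<ge> 3 / 8 * (y / (1 + y))"
proof -
  define v where "v = 1 / (1 + y)"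
  have v: "0 < v" "v \<le> 1" "y / (1 + y) = 1 - v" using assms by (auto simp: v_def field_simps)
  have "\<i> / (\<i> * of_real y + \<i>) = of_real v"
    using assms by (auto simp: v_def complex_eq_iff Re_divide Im_divide power2_eq_square field_simps)
  then have "barrier (\<i> * of_real y) = of_real ((1 - v) * (1 - 5 / 8 * v))"
    by (simp add: barrier_def)
  then have "Re (barrier (\<i> * of_real y)) = (1 - v) * (1 - 5 / 8 * v)" by simp
  also have "\<dots> \<ge> (1 - v) * (3 / 8)" using v by (intro mult_left_mono) auto
  finally show ?thesis using v by simp
qed

lemma barrier_holomorphic: "barrier holomorphic_on {w. Im w > -1}"
  unfolding barrier_def
  by (intro holomorphic_intros) (auto simp: complex_eq_iff)

text \<open>A quantitative form of the theorem on the logarithmic integral of a bounded holomorphic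
  function in the half-plane.\<close>

lemma half_plane_log_integral_zero:
  fixes G :: "complex \<Rightarrow> complex" and H :: "nat \<Rightarrow> real"
  assumes cont: "continuous_on {w. Im w \<ge> 0} G" and hol: "G holomorphic_on {w. Im w > 0}"
    and bnd: "\<And>w. Im w \<ge> 0 \<Longrightarrow> norm (G w) \<le> A"
    and decay: "\<And>w. Im w \<ge> 0 \<Longrightarrow> w \<noteq> 0 \<Longrightarrow> norm (G w) \<le> K / norm w"
    and H: "\<And>m n. R \<le> m \<Longrightarrow> m \<le> n \<Longrightarrow> H m \<le> H n" "H R \<ge> 0"
    and small: "\<And>x r. R \<le> r \<Longrightarrow> real r \<le> x\<^sup>2 + 1 \<Longrightarrow> norm (G (complex_of_real x)) \<le> C * exp (- H r)"
    and C: "C > 0"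
    and div: "filterlim (\<lambda>N. \<Sum>n=R..<N. (H (Suc n) - H n) / sqrt (real n + 1)) at_top sequentially"
    and y: "y > 0"
  shows "G (\<i> * of_real y) = 0"
proof -
  define d where "d n = H (Suc n) - H n" for n
  have d: "d n \<ge> 0" if "n \<ge> R" for n using H(1)[of n "Suc n"] that by (simp add: d_def)
  \<comment> \<open>At this scale the sign change of \<open>barrier\<close> at 1 / 2 falls on x^2 =
    n + 1.\<close>
  define s where "s n = 2 * sqrt (real n + 1)" for n
  have s: "s n \<ge> 1" for n
  proof -
    have "1 \<le> sqrt (real n + 1)" by simp
    then show ?thesis unfolding s_def by linarith
  qed
  define e where "e n w = barrier (w / of_real (s n))" for n w
  define B where "B = max A C"
  have B: "B > 0" "A \<le> B" "C \<le> B" using C by (auto simp: B_def)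
  \<comment> \<open>On the real line the n-th term of the exponent has real part at most d n, and
    positive only where x^2 > n + 1. The terms telescope to no more than the smallness of G absorbs,
    so \<Phi> stays bounded by B. At i y the n-th term is at least a multiple of
    \<open>d n / sqrt (n + 1)\<close>, so the exponential factor grows without bound.\<close>
  define \<Phi> where "\<Phi> N w = G w * exp (\<Sum>n=R..<N. of_real (d n) * e n w)" for N w
  have Imdiv: "Im (w / of_real (s n)) = Im w / s n" for w n
    by (simp add: Im_divide_of_real)
  have ehol: "e n holomorphic_on {w. Im w > -1}" for n
  proof -
    have "(barrier \<circ> (\<lambda>w. w / of_real (s n))) holomorphic_on {w. Im w > -1}"
    proof (rule holomorphic_on_compose_gen[OF _ barrier_holomorphic])
      show "(\<lambda>w. w / of_real (s n)) holomorphic_on {w. Im w > -1}"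
        using s[of n] by (intro holomorphic_intros) auto
      show "(\<lambda>w. w / of_real (s n)) ` {w. Im w > -1} \<subseteq> {w. Im w > -1}"
      proof safe
        fix w assume "Im w > -1"
        then show "-1 < Im (w / of_real (s n))"
          using s[of n] unfolding Imdiv by (simp add: field_simps)
      qed
    qed
    then show ?thesis by (simp add: e_def[abs_def] o_def)
  qed
  have \<Phi>_le: "norm (\<Phi> N (\<i> * of_real y)) \<le> B" for N
  proof -
    define L where "L = exp (\<Sum>n=R..<N. d n * 4)"
    show ?thesis
    proof (rule upper_half_plane_maximum[where f = "\<Phi> N" and K = "K * L"])
    show "continuous_on {w. Im w \<ge> 0} (\<Phi> N)"
      unfolding \<Phi>_def
      by (intro continuous_intros cont holomorphic_on_imp_continuous_on[OF holomorphic_on_subset[OF ehol]]) auto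
    show "\<Phi> N holomorphic_on {w. Im w > 0}"
      unfolding \<Phi>_def by (intro holomorphic_intros hol holomorphic_on_subset[OF ehol]) auto
    show "B > 0" by (rule B)
    show "Im (\<i> * of_real y) > 0" using y by simp
    show "norm (\<Phi> N w) \<le> (K * L) / norm w" if w: "Im w \<ge> 0" "w \<noteq> 0" for w
    proof -
      have "norm (exp (\<Sum>n=R..<N. of_real (d n) * e n w)) = exp (\<Sum>n=R..<N. d n * Re (e n w))"
        by simp
      also have "\<dots> \<le> L"
        unfolding L_def exp_le_cancel_iff
      proof (intro sum_mono mult_left_mono)
        fix n
        have "Re (e n w) \<le> norm (barrier (w / of_real (s n)))"
          unfolding e_def by (rule complex_Re_le_cmod)
        also have "\<dots> \<le> 4"
          using s[of n] w(1) by (intro norm_barrier_le) (simp add: Imdiv)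
        finally show "Re (e n w) \<le> 4" .
      qed (use d in auto)
      finally have "norm (\<Phi> N w) \<le> (K / norm w) * L"
        unfolding \<Phi>_def norm_mult using decay[OF w] norm_ge_zero order_trans by (intro mult_mono) blast+
      then show ?thesis by simp
    qed
    show "norm (\<Phi> N (of_real x)) \<le> B" for x
    proof -
      \<comment> \<open>The largest index at which \<open>small\<close> applies to x. Only
        increments d n with n < m count, and from R on they sum to H m - H R.\<close>
      define m where "m = nat \<lfloor>x\<^sup>2 + 1\<rfloor>"
      have x0: "0 \<le> x\<^sup>2 + 1" by simp
      have m: "real m \<le> x\<^sup>2 + 1" "x\<^sup>2 < real m"
        unfolding m_def using x0 by linarith+
      have Re_e: "Re (e n (of_real x)) \<le> (if Suc n \<le> m then 1 else 0)" for n
      proof -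
        have e: "e n (of_real x) = barrier (of_real (x / s n))" by (simp add: e_def)
        show ?thesis
        proof (cases "Suc n \<le> m")
          case False
          then have "x\<^sup>2 \<le> real n + 1" using m by simp
          then have "(x / s n)\<^sup>2 \<le> 1 / 4" by (simp add: s_def power_divide power_mult_distrib field_simps)
          then have "Re (barrier (of_real (x / s n))) \<le> 0" by (rule Re_barrier_real_le(2))
          then show ?thesis using False unfolding e by simp
        qed (use Re_barrier_real_le(1)[of "x / s n"] in \<open>simp add: e\<close>)
      qed
      have "norm (exp (\<Sum>n=R..<N. of_real (d n) * e n (of_real x))) = exp (\<Sum>n=R..<N. d n * Re (e n (of_real x)))"
        by simp
      also have "\<dots> \<le> exp (\<Sum>n=R..<N. d n * (if Suc n \<le> m then 1 else 0))"
        unfolding exp_le_cancel_iff by (intro sum_mono mult_left_mono Re_e) (use d in auto)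
      also have "(\<Sum>n=R..<N. d n * (if Suc n \<le> m then 1 else 0)) = (\<Sum>n\<in>{R..<N} \<inter> {..<m}. d n)"
        by (subst sum.inter_restrict) (auto intro!: sum.cong)
      finally have *: "norm (\<Phi> N (of_real x)) \<le> norm (G (of_real x)) * exp (\<Sum>n\<in>{R..<N} \<inter> {..<m}. d n)"
        unfolding \<Phi>_def norm_mult by (intro mult_left_mono) auto
      show ?thesis
      proof (cases "R \<le> m")
        case True
        have "(\<Sum>n\<in>{R..<N} \<inter> {..<m}. d n) \<le> (\<Sum>n=R..<m. d n)"
          by (intro sum_mono2) (use d in auto)
        also have "\<dots> = H m - H R" unfolding d_def using True by (rule sum_Suc_diff')
        also have "\<dots> \<le> H m" using H(2) by simp
        finally have "norm (G (of_real x)) * exp (\<Sum>n\<in>{R..<N} \<inter> {..<m}. d n) \<le> (C * exp (- H m)) * exp (H m)"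
          using small[OF True m(1)] C by (intro mult_mono) auto
        also have "\<dots> = C" by (simp add: exp_minus)
        finally show ?thesis using * B by linarith
      next
        case False
        then have "{R..<N} \<inter> {..<m} = {}" by auto
        then show ?thesis using * bnd[of "of_real x"] B by simp
      qed
    qed
  qed
  qed
  define D where "D N = (\<Sum>n=R..<N. (H (Suc n) - H n) / sqrt (real n + 1))" for N
  \<comment> \<open>3 / 8 from \<open>Re_barrier_imag\<close>, halved by the factor 2 in s.\<close>
  define c where "c = 3 / 16 * (y / (1 + y))"
  have c: "c > 0" using y by (simp add: c_def)
  have low: "c * D N \<le> (\<Sum>n=R..<N. d n * Re (e n (\<i> * of_real y)))" for N
  proof -
    have "c * (d n / sqrt (real n + 1)) \<le> d n * Re (e n (\<i> * of_real y))" if "n \<ge> R" for n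
    proof -
      have ys: "y / s n > 0" using y s[of n] by simp
      have "y / (1 + y) / s n \<le> (y / s n) / (1 + y / s n)"
      proof -
        have "1 + y / s n = (s n + y) / s n" using s[of n] by (simp add: field_simps)
        then have "(y / s n) / (1 + y / s n) = y / (s n + y)" using s[of n] by simp
        moreover have "y / ((1 + y) * s n) \<le> y / (s n + y)"
        proof -
          have "y * 1 \<le> y * s n" using s[of n] y by (intro mult_left_mono) auto
          then show ?thesis using s[of n] y by (intro divide_left_mono) (auto simp: algebra_simps intro!: mult_pos_pos add_pos_pos)
        qed
        ultimately show ?thesis by (metis divide_divide_eq_left)
      qed
      then have "3 / 8 * (y / (1 + y) / s n) \<le> 3 / 8 * ((y / s n) / (1 + y / s n))"
        by (intro mult_left_mono) auto
      also have "\<dots> \<le> Re (barrier (\<i> * of_real (y / s n)))" by (rule Re_barrier_imag[OF ys])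
      also have "\<i> * of_real (y / s n) = (\<i> * of_real y) / of_real (s n)" by simp
      finally have "3 / 8 * (y / (1 + y) / s n) \<le> Re (e n (\<i> * of_real y))"
        unfolding e_def .
      moreover have "3 / 8 * (y / (1 + y) / s n) = c / sqrt (real n + 1)"
        by (simp add: c_def s_def)
      ultimately have "c / sqrt (real n + 1) \<le> Re (e n (\<i> * of_real y))" by simp
      then have "d n * (c / sqrt (real n + 1)) \<le> d n * Re (e n (\<i> * of_real y))"
        using d[OF that] by (rule mult_left_mono)
      then show ?thesis by (simp add: mult_ac)
    qed
    then show ?thesis unfolding D_def sum_distrib_left by (intro sum_mono) (auto simp: d_def)
  qed
  have lim: "filterlim (\<lambda>N. c * D N) at_top sequentially"
    unfolding D_def by (rule filterlim_tendsto_pos_mult_at_top[OF tendsto_const c div])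
  have "((\<lambda>N. B * exp (- (c * D N))) \<longlongrightarrow> B * 0) sequentially"
    by (intro tendsto_intros filterlim_compose[OF exp_at_bot] filterlim_compose[OF filterlim_uminus_at_bot_at_top] lim)
  moreover have "norm (G (\<i> * of_real y)) \<le> B * exp (- (c * D N))" for N
  proof -
    have "norm (G (\<i> * of_real y)) * exp (c * D N) \<le> norm (G (\<i> * of_real y)) * exp (\<Sum>n=R..<N. d n * Re (e n (\<i> * of_real y)))"
      using low by (intro mult_left_mono) auto
    also have "\<dots> = norm (\<Phi> N (\<i> * of_real y))" by (simp add: \<Phi>_def norm_mult)
    also have "\<dots> \<le> B" by (rule \<Phi>_le)
    finally show ?thesis by (simp add: exp_minus field_simps)
  qed
  ultimately have "norm (G (\<i> * of_real y)) \<le> B * 0"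
    by (intro tendsto_lowerbound[where F = sequentially]) auto
  then show ?thesis by simp
qed

section \<open>Cauchy transforms with poles at the natural numbers\<close>

lemma moments_zero_cauchy_transform_bound:
  fixes a :: "nat \<Rightarrow> complex"
  assumes summ: "\<And>j. summable (\<lambda>n. norm (a n) * real n ^ j)"
    and mom: "\<And>j. (\<Sum>n. a n * of_nat n ^ j) = 0"
    and far: "\<And>n. 1 \<le> norm (of_nat n - z)"
  shows "norm (\<Sum>n. a n / (of_nat n - z)) * norm z ^ j \<le> (\<Sum>n. norm (a n) * real n ^ j)"
proof -
  have le: "norm (a n * of_nat n ^ j / (of_nat n - z)) \<le> norm (a n) * real n ^ j" for n j
  proof -
    have "norm (a n * of_nat n ^ j / (of_nat n - z)) = norm (a n) * real n ^ j / norm (of_nat n - z)"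
      by (simp add: norm_divide norm_mult norm_power)
    also have "\<dots> \<le> norm (a n) * real n ^ j / 1"
      using far[of n] by (intro divide_left_mono) auto
    finally show ?thesis by simp
  qed
  have ns: "summable (\<lambda>n. norm (a n * of_nat n ^ j / (of_nat n - z)))" for j
    by (rule summable_comparison_test'[OF summ[of j]]) (use le in auto)
  have s: "summable (\<lambda>n. a n * of_nat n ^ j / (of_nat n - z))" for j
    by (rule summable_norm_cancel[OF ns])
  have sm: "summable (\<lambda>n. a n * of_nat n ^ j)" for j
    by (rule summable_norm_cancel) (use summ[of j] in \<open>simp add: norm_mult norm_power\<close>)
  \<comment> \<open>Since z / (n - z) = n / (n - z) - 1, each factor z becomes a factor n at the
    price of a moment, and the moments vanish.\<close>
  have "(\<Sum>n. a n / (of_nat n - z)) * z ^ j = (\<Sum>n. a n * of_nat n ^ j / (of_nat n - z))"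
  proof (induction j)
    case (Suc j)
    have "(\<Sum>n. a n / (of_nat n - z)) * z ^ Suc j = z * (\<Sum>n. a n * of_nat n ^ j / (of_nat n - z))"
      using Suc by (simp add: mult_ac)
    also have "\<dots> = (\<Sum>n. z * (a n * of_nat n ^ j / (of_nat n - z)))"
      by (rule suminf_mult[OF s, symmetric])
    also have "\<dots> = (\<Sum>n. a n * of_nat n ^ Suc j / (of_nat n - z) - a n * of_nat n ^ j)"
    proof (rule suminf_cong)
      fix n
      have "of_nat n - z \<noteq> 0" using far[of n] by auto
      then show "z * (a n * of_nat n ^ j / (of_nat n - z)) = a n * of_nat n ^ Suc j / (of_nat n - z) - a n * of_nat n ^ j"
        by (simp add: field_simps)
    qed
    also have "\<dots> = (\<Sum>n. a n * of_nat n ^ Suc j / (of_nat n - z)) - (\<Sum>n. a n * of_nat n ^ j)"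
      by (rule suminf_diff[OF s sm, symmetric])
    finally show ?case by (simp add: mom)
  qed simp
  then have "norm (\<Sum>n. a n / (of_nat n - z)) * norm z ^ j = norm (\<Sum>n. a n * of_nat n ^ j / (of_nat n - z))"
    by (metis norm_mult norm_power)
  also have "\<dots> \<le> (\<Sum>n. norm (a n * of_nat n ^ j / (of_nat n - z)))"
    by (rule summable_norm[OF ns])
  also have "\<dots> \<le> (\<Sum>n. norm (a n) * real n ^ j)"
    by (intro suminf_le le ns summ)
  finally show ?thesis .
qed

text \<open>The difference factors over sqrt n, and both sqrt n - (w + i) and sqrt n + (w + i) have
  imaginary part of modulus at least 1. This is the purpose of the shift by i.\<close>

lemma nat_minus_square_far:
  assumes "Im w \<ge> 0" shows "1 \<le> norm (of_nat n - (w + \<i>)\<^sup>2)"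
proof -
  define s where "s = complex_of_real (sqrt (real n))"
  have "s\<^sup>2 = of_nat n" unfolding s_def by (simp flip: of_real_power)
  then have "of_nat n - (w + \<i>)\<^sup>2 = (s - (w + \<i>)) * (s + (w + \<i>))"
    by (simp add: algebra_simps power2_eq_square)
  moreover have "1 \<le> norm (s - (w + \<i>))" "1 \<le> norm (s + (w + \<i>))"
    using abs_Im_le_cmod[of "s - (w + \<i>)"] abs_Im_le_cmod[of "s + (w + \<i>)"] assms by (auto simp: s_def)
  then have "1 * 1 \<le> norm (s - (w + \<i>)) * norm (s + (w + \<i>))" by (intro mult_mono) auto
  ultimately show ?thesis by (simp add: norm_mult)
qed

text \<open>The vanishing of the transform on a real interval continues analytically up to m, where
  the residue is \<open>a m\<close> up to sign. Induction on m removes the poles to the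
  left.\<close>

lemma cauchy_transform_zero_imp_zero:
  fixes a :: "nat \<Rightarrow> complex"
  assumes summ: "summable (\<lambda>n. norm (a n))"
    and zero: "\<And>s. s > 1 \<Longrightarrow> (\<Sum>n. a n / (of_nat n + complex_of_real s)) = 0"
  shows "a m = 0"
proof (induction m rule: less_induct)
  case (less m)
  \<comment> \<open>The disc of radius L contains m and the segment (-3, -1); the condition Re z < m
    + 1 / 2 in U excludes the poles beyond m.\<close>
  define L where "L = real m + 4"
  define U where "U = ball (0::complex) L \<inter> {z. Re z < real m + 1 / 2}"
  have U: "open U" "convex U"
    unfolding U_def by (auto intro!: open_Int open_Collect_less continuous_intros convex_Int convex_halfspace_Re_lt)
  \<comment> \<open>This is the n-th term times m - z. The case n = m stands apart because (m - z) /
    (m - z) evaluates to 0 at z = m.\<close>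
  define f where "f n z = (if n < m then 0 else if n = m then a m else a n * ((of_nat m - z) / (of_nat n - z)))" for n z
  have away: "1 / 2 \<le> norm (of_nat n - z)" if "z \<in> U" "n > m" for n z
  proof -
    have "1 / 2 \<le> Re (of_nat n - z)" using that by (simp add: U_def)
    then show ?thesis using complex_Re_le_cmod order_trans by blast
  qed
  have fle: "norm (f n z) \<le> norm (a n) * (4 * L)" if z: "z \<in> U" for n z
  proof -
    consider "n < m" | "n = m" | "n > m" by linarith
    then show ?thesis
    proof cases
      case 2
      have "norm (a m) * 1 \<le> norm (a m) * (4 * L)" by (intro mult_left_mono) (auto simp: L_def)
      then show ?thesis using 2 by (simp add: f_def)
    next
      case 3
      have "norm (of_nat m - z) \<le> 2 * L"
        using norm_triangle_ineq4[of "of_nat m" z] z by (simp add: U_def L_def)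
      then have "norm (of_nat m - z) / norm (of_nat n - z) \<le> 2 * L / (1 / 2)"
        by (intro frac_le away[OF z 3]) (auto simp: L_def)
      then have "norm ((of_nat m - z) / (of_nat n - z)) \<le> 4 * L" by (simp add: norm_divide)
      moreover have "f n z = a n * ((of_nat m - z) / (of_nat n - z))" using 3 by (simp add: f_def)
      ultimately show ?thesis by (simp only: norm_mult) (intro mult_left_mono, auto)
    qed (auto simp: f_def L_def)
  qed
  define g where "g z = (\<Sum>n. f n z)" for z
  have unif: "uniform_limit U (\<lambda>N z. \<Sum>n<N. f n z) g sequentially"
    unfolding g_def by (rule Weierstrass_m_test[OF fle summable_mult2[OF summ]])
  have fhol: "f n holomorphic_on U" for n
  proof -
    have "(\<lambda>z. a n * ((of_nat m - z) / (of_nat n - z))) holomorphic_on U" if "n > m"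
      using away[OF _ that] by (intro holomorphic_intros) force
    then show ?thesis unfolding f_def by (cases "n < m"; cases "n = m") auto
  qed
  have ghol: "g holomorphic_on U"
  proof (rule holomorphic_uniform_sequence[OF U(1)])
    show "(\<lambda>z. \<Sum>n<N. f n z) holomorphic_on U" for N
      by (intro holomorphic_intros fhol)
    fix z assume "z \<in> U"
    then obtain d where "d > 0" "cball z d \<subseteq> U" using U(1) open_contains_cball by blast
    then show "\<exists>d>0. cball z d \<subseteq> U \<and> uniform_limit (cball z d) (\<lambda>N z. \<Sum>n<N. f n z) g sequentially"
      using uniform_limit_on_subset[OF unif] by blast
  qed
  have g0: "g (of_real (-s)) = 0" if s: "s > 1" for s :: real
  proof -
    have "f n (of_real (-s)) = (of_nat m + of_real s) * (a n / (of_nat n + of_real s))" for n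
    proof -
      have "of_nat n + complex_of_real s \<noteq> 0"
        using s by (simp add: complex_eq_iff add_nonneg_eq_0_iff)
      then show ?thesis using less by (auto simp: f_def)
    qed
    moreover have "summable (\<lambda>n. a n / (of_nat n + complex_of_real s))"
    proof (rule summable_norm_cancel, rule summable_comparison_test'[OF summ])
      fix n
      have "1 \<le> norm (of_nat n + complex_of_real s)"
        using complex_Re_le_cmod[of "of_nat n + complex_of_real s"] s by simp
      then have "norm (a n) / norm (of_nat n + complex_of_real s) \<le> norm (a n) / 1"
        by (intro divide_left_mono) auto
      then show "norm (norm (a n / (of_nat n + complex_of_real s))) \<le> norm (a n)"
        by (simp add: norm_divide)
    qed
    ultimately show ?thesis
      using suminf_mult[of "\<lambda>n. a n / (of_nat n + complex_of_real s)" "of_nat m + of_real s"] zero[OF s]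
      by (simp add: g_def)
  qed
  define V where "V = (\<lambda>s. complex_of_real (-s)) ` {1<..<3}"
  have "g (of_nat m) = 0"
  proof (rule analytic_continuation[OF ghol U(1) convex_connected[OF U(2)], of V "of_real (-2)"])
    show "V \<subseteq> U" by (auto simp: V_def U_def L_def norm_minus_cancel simp flip: of_real_minus)
    show "complex_of_real (- 2) \<in> U" by (simp add: U_def L_def)
    show "complex_of_real (- 2) islimpt V"
      unfolding islimpt_sequential
    proof (intro exI[of _ "\<lambda>n. complex_of_real (- (2 + 1 / real (Suc (Suc n))))"] conjI allI)
      show "complex_of_real (- (2 + 1 / real (Suc (Suc n)))) \<in> V - {complex_of_real (- 2)}" for n
        unfolding V_def Diff_iff singleton_iff of_real_eq_iff by (intro conjI imageI) (auto simp: divide_simps)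
      have "(\<lambda>n. - (2 + 1 / real (Suc (Suc n)))) \<longlonglongrightarrow> -2" by real_asymp
      then show "(\<lambda>n. complex_of_real (- (2 + 1 / real (Suc (Suc n))))) \<longlonglongrightarrow> complex_of_real (- 2)"
        by (rule tendsto_of_real)
    qed
    show "g z = 0" if "z \<in> V" for z using that g0 by (auto simp: V_def)
    show "of_nat m \<in> U" by (simp add: U_def L_def)
  qed
  moreover have "g (of_nat m) = a m"
  proof -
    have "f n (of_nat m) = (if n = m then a m else 0)" for n by (simp add: f_def)
    then show ?thesis using sums_unique[OF sums_single[of m "\<lambda>_. a m"]] by (simp add: g_def)
  qed
  ultimately show ?case by simp
qed


section \<open>Vanishing moments under the divergence condition\<close>

context quasianalytic_weight begin

text \<open>Summation by parts against \<open>1 / sqrt (n + 1)\<close>, whose decrements are of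
  order n^(-3/2), turns condition (iv) into the divergence required in the half-plane. Passing from
  \<omega> to \<open>wt q\<close> costs q log n / n^(3/2), which is summable.\<close>

lemma log_weight_energy_divergence:
  assumes mono: "\<And>m n. R \<le> m \<Longrightarrow> m \<le> n \<Longrightarrow> ln (wt q m) \<le> ln (wt q n)" and R0: "ln (wt q R) \<ge> 0"
  shows "filterlim (\<lambda>N. \<Sum>n=R..<N. (ln (wt q (Suc n)) - ln (wt q n)) / sqrt (real n + 1)) at_top sequentially"
proof -
  define H where "H n = ln (wt q n)" for n
  have H: "H n \<ge> 0" if "n \<ge> R" for n using mono[of R n] R0 that by (simp add: H_def)
  define b where "b n = 1 / sqrt (real n + 1)" for n
  have b_diff: "1 / (2 * (real n + 2) powr (3 / 2)) \<le> b n - b (Suc n)" for n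
  proof -
    define u where "u = sqrt (real n + 1)"
    define v where "v = sqrt (real n + 2)"
    have uv: "u > 0" "v > 0" "u \<le> v" by (auto simp: u_def v_def)
    have "v\<^sup>2 - u\<^sup>2 = 1" by (simp add: u_def v_def)
    then have vu: "(v - u) * (v + u) = 1" by (simp add: power2_eq_square algebra_simps)
    have "(real n + 2) powr (3 / 2) = (v\<^sup>2) powr (3 / 2)" by (simp add: v_def)
    also have "\<dots> = v ^ 3" using uv by (simp add: powr_powr powr_realpow flip: powr_numeral)
    finally have p: "(real n + 2) powr (3 / 2) = v ^ 3" .
    have "u * v * (v + u) \<le> v * v * (2 * v)" using uv by (intro mult_mono) auto
    then have "1 / (2 * v ^ 3) \<le> 1 / (u * v * (v + u))"
      using uv by (intro divide_left_mono) (auto simp: power3_eq_cube intro!: mult_pos_pos add_pos_pos)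
    also have "\<dots> = (v - u) * (v + u) / (u * v * (v + u))" by (simp add: vu)
    also have "\<dots> = (v - u) / (u * v)" using uv by simp
    also have "\<dots> = 1 / u - 1 / v" using uv by (simp add: diff_divide_distrib)
    finally show ?thesis unfolding p b_def by (simp add: u_def v_def add.commute)
  qed
  have abel: "(\<Sum>n=R..<N. H (Suc n) / (2 * (real n + 2) powr (3 / 2))) - H R * b R + H N * b N
      \<le> (\<Sum>n=R..<N. (H (Suc n) - H n) * b n)" if "N \<ge> R" for N
    using that
  proof (induction N rule: dec_induct)
    case (step N)
    have "H (Suc N) * (1 / (2 * (real N + 2) powr (3 / 2))) \<le> H (Suc N) * (b N - b (Suc N))"
      using H[of "Suc N"] step.hyps by (intro mult_left_mono b_diff) auto
    then show ?case using step by (simp add: algebra_simps)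
  qed simp
  define g where "g n = ln (\<omega> n) / (real n powr (3 / 2) + 1)" for n
  define l where "l n = ln (real n + 2) / (real n + 2) powr (3 / 2)" for n
  have l0: "l n \<ge> 0" for n unfolding l_def by simp
  have "summable (\<lambda>n. 4 * real (n + 2) powr (- (5 / 4)))"
    by (intro summable_mult summable_ignore_initial_segment) (simp add: summable_real_powr_iff)
  moreover have "norm (l n) \<le> 4 * real (n + 2) powr (- (5 / 4))" for n
  proof -
    have "ln (real n + 2) \<le> (real n + 2) powr (1 / 4) / (1 / 4)" by (rule ln_powr_bound) auto
    then have "l n \<le> 4 * (real n + 2) powr (1 / 4) / (real n + 2) powr (3 / 2)"
      unfolding l_def by (intro divide_right_mono) auto
    also have "\<dots> = 4 * (real n + 2) powr (1 / 4 - 3 / 2)" by (simp only: powr_diff times_divide_eq_right)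
    finally show ?thesis using l0[of n] by (simp add: add.commute)
  qed
  ultimately have ls: "summable l" by (rule summable_comparison_test'[where N = 0])
  \<comment> \<open>The 6 is 2 * 3: the 2 is that of \<open>b_diff\<close>, and 3 bounds 2 powr (3 /
    2) in the passage from n + 2 to n + 1.\<close>
  have H_ge: "H (Suc n) / (2 * (real n + 2) powr (3 / 2)) \<ge> g (Suc n) / 6 - real q * l n" for n
  proof -
    have "(real n + 2) powr (3 / 2) \<le> (2 * (real n + 1)) powr (3 / 2)" by (intro powr_mono2) auto
    also have "\<dots> = 2 powr (3 / 2) * (real n + 1) powr (3 / 2)" by (rule powr_mult)
    also have "\<dots> \<le> 3 * (real n + 1) powr (3 / 2)"
    proof (rule mult_right_mono)
      have "(2 powr (3 / 2)) ^ 2 = (2::real) powr 3" by (simp add: powr_powr flip: powr_realpow)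
      then have "(2 powr (3 / 2)) ^ 2 \<le> (3::real) ^ 2" by simp
      then show "2 powr (3 / 2) \<le> (3::real)" by (rule power2_le_imp_le) simp
    qed simp
    finally have le: "(real n + 2) powr (3 / 2) \<le> 3 * ((real n + 1) powr (3 / 2) + 1)" by simp
    have \<omega>0: "ln (\<omega> (Suc n)) \<ge> 0" using weight_ge_1 by simp
    have "g (Suc n) / 3 = ln (\<omega> (Suc n)) / (3 * ((real n + 1) powr (3 / 2) + 1))"
      by (simp add: g_def add.commute)
    also have "\<dots> \<le> ln (\<omega> (Suc n)) / (real n + 2) powr (3 / 2)"
      using le \<omega>0 by (intro divide_left_mono mult_pos_pos add_nonneg_pos) auto
    finally have 1: "g (Suc n) / 3 \<le> ln (\<omega> (Suc n)) / (real n + 2) powr (3 / 2)" .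
    have "H (Suc n) = ln (\<omega> (Suc n)) - real q * ln (real n + 2)"
      using weight_ge_1[of "Suc n"] by (simp add: H_def wt_def ln_div ln_realpow add.commute)
    then have "H (Suc n) / (2 * (real n + 2) powr (3 / 2))
        = (ln (\<omega> (Suc n)) / (real n + 2) powr (3 / 2)) / 2 - real q * l n / 2"
      by (simp add: l_def diff_divide_distrib)
    moreover have "real q * l n \<ge> 0" using l0 by simp
    moreover have "x / 6 - u \<le> v" if "v = w / 2 - u / 2" "0 \<le> u" "x / 3 \<le> w" for x u v w :: real
      using that by linarith
    ultimately show ?thesis using 1 by blast
  qed
  define c where "c = (\<Sum>n<Suc R. g n)"
  have bound: "((\<Sum>n<Suc N. g n) - c) / 6 - real q * suminf l - H R * b R \<le> (\<Sum>n=R..<N. (H (Suc n) - H n) * b n)"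
    if "N \<ge> R" for N
  proof -
    have "(\<Sum>n=R..<N. g (Suc n)) = (\<Sum>n<Suc N. g n) - c"
      unfolding c_def sum.shift_bounds_Suc_ivl[symmetric] using that
      by (subst sum_diff_nat_ivl[of 0 "Suc R" "Suc N" g, symmetric]) (auto simp: atLeast0LessThan)
    moreover have "(\<Sum>n=R..<N. l n) \<le> suminf l" using l0 by (intro sum_le_suminf ls) auto
    then have "real q * (\<Sum>n=R..<N. l n) \<le> real q * suminf l" by (intro mult_left_mono) auto
    moreover have "(\<Sum>n=R..<N. g (Suc n) / 6 - real q * l n) \<le> (\<Sum>n=R..<N. H (Suc n) / (2 * (real n + 2) powr (3 / 2)))"
      by (intro sum_mono H_ge)
    then have "(\<Sum>n=R..<N. g (Suc n)) / 6 - real q * (\<Sum>n=R..<N. l n) \<le> (\<Sum>n=R..<N. H (Suc n) / (2 * (real n + 2) powr (3 / 2)))"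
      by (simp only: sum_subtractf sum_divide_distrib sum_distrib_left)
    moreover have "H N * b N \<ge> 0" using H[OF that] by (simp add: b_def)
    moreover have "(v - w) / 6 - y - h \<le> t"
      if "s = v - w" "p \<le> y" "s / 6 - p \<le> x" "0 \<le> e" "x - h + e \<le> t" for s v w p y x e h t :: real
      using that by argo
    ultimately show ?thesis using abel[OF that] by blast
  qed
  have "filterlim (\<lambda>N. \<Sum>n<N. g n) at_top sequentially"
    using weight_divergence by (simp add: g_def)
  then have "filterlim (\<lambda>N. \<Sum>n<Suc N. g n) at_top sequentially"
    by (rule filterlim_compose[OF _ filterlim_Suc])
  then have "filterlim (\<lambda>N. (- c / 6 - real q * suminf l - H R * b R) + 1 / 6 * (\<Sum>n<Suc N. g n)) at_top sequentially"
    by (intro filterlim_tendsto_add_at_top[OF tendsto_const] filterlim_tendsto_pos_mult_at_top[OF tendsto_const]) auto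
  then have "filterlim (\<lambda>N. \<Sum>n=R..<N. (H (Suc n) - H n) * b n) at_top sequentially"
  proof (rule filterlim_at_top_mono)
    show "\<forall>\<^sub>F N in sequentially. (- c / 6 - real q * suminf l - H R * b R) + 1 / 6 * (\<Sum>n<Suc N. g n)
        \<le> (\<Sum>n=R..<N. (H (Suc n) - H n) * b n)"
      using eventually_ge_at_top[of R]
    proof eventually_elim
      case (elim N)
      show ?case using bound[OF elim] by (simp add: diff_divide_distrib del: sum.lessThan_Suc)
    qed
  qed
  then show ?thesis by (simp add: H_def b_def)
qed

theorem moments_zero_imp_zero:
  fixes a :: "nat \<Rightarrow> complex"
  assumes bound: "\<And>n. norm (a n) \<le> A * ((real n + 1) ^ k / \<omega> n)"
    and mom: "\<And>j. (\<Sum>n. a n * of_nat n ^ j) = 0"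
  shows "a m = 0"
proof -
  define Z where "Z = (\<Sum>m. 1 / (real m + 1)\<^sup>2)"
  have Z: "Z \<ge> 0" unfolding Z_def by (intro suminf_nonneg inverse_square_summable) auto
  have "0 \<le> A * (1 / \<omega> 0)" using order_trans[OF norm_ge_zero bound[of 0]] by simp
  then have A: "A \<ge> 0" using weight_ge_1[of 0] by (simp add: zero_le_divide_iff)
  obtain D R1 where D: "D > 0" "R1 \<ge> 1" "\<And>r. r \<ge> R1 \<Longrightarrow> \<exists>j. \<forall>n. (real n + 1) ^ k / \<omega> n * real n ^ j
        \<le> D / wt (k + 3) r * real r ^ j * (1 / (real n + 1)\<^sup>2)"
    using weighted_power_bound[of k] by blast
  define q where "q = k + 3"
  obtain R2 where R2: "\<And>m n. R2 \<le> m \<Longrightarrow> m \<le> n \<Longrightarrow> wt q m \<le> wt q n"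
    using wt_eventually_mono by blast
  obtain b where b: "b > 0" "\<And>n. b \<le> wt (Suc q) n" using wt_lower by blast
  \<comment> \<open>The last entry makes \<open>wt q R = wt (Suc q) R * (R + 1)\<close> at least 1,
    so that its logarithm is nonnegative.\<close>
  define R where "R = max R1 (max R2 (nat \<lceil>1 / b\<rceil>))"
  have "1 / b \<le> real R" unfolding R_def by linarith
  then have "1 \<le> b * (real R + 1)" using b(1) by (simp add: field_simps)
  also have "\<dots> \<le> wt q R" unfolding wt_Suc[of q] by (intro mult_right_mono b) auto
  finally have R0: "ln (wt q R) \<ge> 0" by simp
  have mono: "ln (wt q m) \<le> ln (wt q n)" if "R \<le> m" "m \<le> n" for m n
    using R2[of m n] that by (simp add: R_def)
  have summ: "summable (\<lambda>n. norm (a n) * real n ^ j)" for j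
  proof -
    obtain c where c: "c > 0" "\<And>n. c \<le> wt (k + j + 2) n" using wt_lower by blast
    have "norm (norm (a n) * real n ^ j) \<le> A / c * (1 / (real n + 1)\<^sup>2)" for n
    proof -
      have "norm (a n) * real n ^ j \<le> A * ((real n + 1) ^ k / \<omega> n) * (real n + 1) ^ j"
        by (intro mult_mono bound power_mono order_trans[OF norm_ge_zero bound]) auto
      also have "\<dots> = A / (wt (k + j + 2) n * (real n + 1)\<^sup>2)"
        unfolding wt_add[of "k + j" n 2, symmetric] by (simp add: wt_def power_add)
      also have "\<dots> \<le> A / (c * (real n + 1)\<^sup>2)"
        using A c by (intro divide_left_mono mult_right_mono c mult_pos_pos) auto
      finally show ?thesis by simp
    qed
    then show ?thesis by (intro summable_comparison_test'[OF summable_mult[OF inverse_square_summable, of "A / c"]]) auto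
  qed
  have a_summ: "summable (\<lambda>n. norm (a n))" using summ[of 0] by simp
  define h where "h n w = a n / (of_nat n - (w + \<i>)\<^sup>2)" for n w
  define G where "G w = (\<Sum>n. h n w)" for w
  \<comment> \<open>Used with three kinds of j: 0 for boundedness, 1 for the decay 1 / |w|, and at a
    real point x the j belonging to an integer r <= x^2 + 1, for smallness of order
    \<open>1 / wt q r\<close>.\<close>
  have key: "norm (G w) * norm ((w + \<i>)\<^sup>2) ^ j \<le> (\<Sum>n. norm (a n) * real n ^ j)" if "Im w \<ge> 0" for w j
    unfolding G_def h_def by (intro moments_zero_cauchy_transform_bound summ mom nat_minus_square_far that)
  have nz: "of_nat n \<noteq> (w + \<i>)\<^sup>2" if "Im w \<ge> 0" for w n
    using nat_minus_square_far[OF that, of n] by auto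
  have unif: "uniform_limit {w. Im w \<ge> 0} (\<lambda>N w. \<Sum>n<N. h n w) G sequentially"
    unfolding G_def
  proof (rule Weierstrass_m_test[OF _ a_summ])
    fix n w assume "w \<in> {w. Im w \<ge> 0}"
    then have "norm (a n) / norm (of_nat n - (w + \<i>)\<^sup>2) \<le> norm (a n) / 1"
      using nat_minus_square_far[of w n] by (intro divide_left_mono) auto
    then show "norm (h n w) \<le> norm (a n)" by (simp add: h_def norm_divide)
  qed
  have G0: "G (\<i> * of_real y) = 0" if "y > 0" for y
  proof (rule half_plane_log_integral_zero[of G _ "\<Sum>n. norm (a n) * real n ^ 1" R "\<lambda>r. ln (wt q r)" "A * D * Z + 1"])
    show "continuous_on {w. Im w \<ge> 0} G"
      by (rule uniform_limit_theorem[OF _ unif])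
        (auto intro!: always_eventually continuous_intros simp: nz h_def)
    show "G holomorphic_on {w. Im w > 0}"
    proof (rule holomorphic_uniform_sequence)
      show op: "open {w. Im w > 0}" by (intro open_Collect_less continuous_intros)
      show "(\<lambda>w. \<Sum>n<N. h n w) holomorphic_on {w. Im w > 0}" for N
        unfolding h_def by (intro holomorphic_intros) (auto simp: nz)
      fix w assume "w \<in> {w. Im w > 0}"
      then obtain d where d: "d > 0" "cball w d \<subseteq> {w. Im w > 0}"
        using op open_contains_cball by blast
      then have "cball w d \<subseteq> {w. Im w \<ge> 0}" by force
      then show "\<exists>d>0. cball w d \<subseteq> {w. Im w > 0} \<and>
          uniform_limit (cball w d) (\<lambda>N w. \<Sum>n<N. h n w) G sequentially"
        using d uniform_limit_on_subset[OF unif] by blast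
    qed
    show "norm (G w) \<le> (\<Sum>n. norm (a n) * real n ^ 0)" if "Im w \<ge> 0" for w
      using key[OF that, of 0] by simp
    show "norm (G w) \<le> (\<Sum>n. norm (a n) * real n ^ 1) / norm w" if w: "Im w \<ge> 0" "w \<noteq> 0" for w
    proof -
      have "norm w \<le> norm (w + \<i>)"
        unfolding cmod_def using w power_mono[of "Im w" "Im w + 1" 2] by (intro real_sqrt_le_mono) simp
      moreover have "1 \<le> norm (w + \<i>)" using abs_Im_le_cmod[of "w + \<i>"] w by simp
      ultimately have "norm w * 1 \<le> norm (w + \<i>) * norm (w + \<i>)" by (intro mult_mono) auto
      then have "norm (G w) * norm w \<le> norm (G w) * norm ((w + \<i>)\<^sup>2) ^ 1"
        by (intro mult_left_mono) (auto simp: norm_power power2_eq_square norm_mult)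
      also have "\<dots> \<le> (\<Sum>n. norm (a n) * real n ^ 1)" by (rule key[OF w(1)])
      finally show ?thesis using w by (simp add: field_simps)
    qed
    show "ln (wt q m) \<le> ln (wt q n)" if "R \<le> m" "m \<le> n" for m n by (rule mono[OF that])
    show "ln (wt q R) \<ge> 0" by (rule R0)
    show "A * D * Z + 1 > 0" using A D Z by (intro add_nonneg_pos mult_nonneg_nonneg) auto
    show "filterlim (\<lambda>N. \<Sum>n=R..<N. (ln (wt q (Suc n)) - ln (wt q n)) / sqrt (real n + 1)) at_top sequentially"
      by (rule log_weight_energy_divergence[OF mono R0])
    show "y > 0" by fact
    show "norm (G (complex_of_real x)) \<le> (A * D * Z + 1) * exp (- ln (wt q r))"
      if r: "R \<le> r" "real r \<le> x\<^sup>2 + 1" for x r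
    proof -
      have r1: "r \<ge> R1" "real r > 0" using r D(2) by (auto simp: R_def)
      obtain j where j: "\<And>n. (real n + 1) ^ k / \<omega> n * real n ^ j \<le> D / wt q r * real r ^ j * (1 / (real n + 1)\<^sup>2)"
        using D(3)[OF r1(1)] unfolding q_def by blast
      have nrm: "norm ((complex_of_real x + \<i>)\<^sup>2) = x\<^sup>2 + 1"
        by (simp add: norm_power cmod_power2)
      have le: "norm (a n) * real n ^ j \<le> A * D / wt q r * real r ^ j * (1 / (real n + 1)\<^sup>2)" for n
      proof -
        have "norm (a n) * real n ^ j \<le> A * ((real n + 1) ^ k / \<omega> n) * real n ^ j"
          by (intro mult_right_mono bound) auto
        also have "\<dots> = A * ((real n + 1) ^ k / \<omega> n * real n ^ j)" by simp
        also have "\<dots> \<le> A * (D / wt q r * real r ^ j * (1 / (real n + 1)\<^sup>2))"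
          by (intro mult_left_mono j A)
        finally show ?thesis by simp
      qed
      have "norm (G (of_real x)) * real r ^ j \<le> norm (G (of_real x)) * norm ((complex_of_real x + \<i>)\<^sup>2) ^ j"
        unfolding nrm using r by (intro mult_left_mono power_mono) auto
      also have "\<dots> \<le> (\<Sum>n. norm (a n) * real n ^ j)" by (rule key) simp
      also have "\<dots> \<le> (\<Sum>n. A * D / wt q r * real r ^ j * (1 / (real n + 1)\<^sup>2))"
        by (intro suminf_le le summ summable_mult inverse_square_summable)
      also have "\<dots> = A * D / wt q r * real r ^ j * Z"
        unfolding Z_def by (rule suminf_mult[OF inverse_square_summable])
      also have "\<dots> = (A * D * Z / wt q r) * real r ^ j" by simp
      finally have "norm (G (of_real x)) \<le> A * D * Z / wt q r"
        by (rule mult_right_le_imp_le) (use r1 in simp)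
      also have "\<dots> \<le> (A * D * Z + 1) / wt q r" by (intro divide_right_mono) auto
      finally show ?thesis by (simp add: exp_minus divide_inverse)
    qed
  qed
  show ?thesis
  proof (rule cauchy_transform_zero_imp_zero[OF a_summ])
    fix s :: real assume s: "s > 1"
    \<comment> \<open>Then (i y + i)^2 = - s, so the half-axis y > 0 corresponds exactly to s >
      1.\<close>
    define y where "y = sqrt s - 1"
    have "sqrt s > 1" using s by simp
    then have y: "y > 0" by (simp add: y_def)
    have "(\<i> * of_real y + \<i>)\<^sup>2 = - (of_real (y + 1))\<^sup>2" by (simp add: power2_eq_square algebra_simps)
    also have "\<dots> = - of_real ((y + 1)\<^sup>2)" by simp
    also have "(y + 1)\<^sup>2 = s" using s by (simp add: y_def)
    finally show "(\<Sum>n. a n / (of_nat n + complex_of_real s)) = 0"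
      using G0[OF y] by (simp add: G_def h_def)
  qed
qed

end

section \<open>Zeros and polynomials in invariant subspaces\<close>

context smooth_weight begin

text \<open>Division by X - z raises the index k, so zeros are split off in the union of the
  scale.\<close>

definition Einf :: "complex fps set" where
  "Einf = (\<Union>k. E k)"

lemma EinfI: "a \<in> E k \<Longrightarrow> a \<in> Einf"
  by (auto simp: Einf_def)

lemma Einf_cases2:
  assumes "a \<in> Einf" "b \<in> Einf" obtains k where "a \<in> E k" "b \<in> E k"
proof -
  obtain i j where "a \<in> E i" "b \<in> E j" using assms by (auto simp: Einf_def)
  then show ?thesis using that[of "max i j"] E_mono[of i "max i j"] E_mono[of j "max i j"] by auto
qed

lemma Einf_add: "a \<in> Einf \<Longrightarrow> b \<in> Einf \<Longrightarrow> a + b \<in> Einf"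
  and Einf_mult: "a \<in> Einf \<Longrightarrow> b \<in> Einf \<Longrightarrow> a * b \<in> Einf"
  using E_add E_mult EinfI by (meson Einf_cases2)+

lemma Einf_deriv: "a \<in> Einf \<Longrightarrow> fps_deriv a \<in> Einf"
  using E_deriv by (auto simp: Einf_def)

lemma Einf_poly: "fps_of_poly p \<in> Einf"
  by (rule EinfI[OF E_poly])

lemma fps_linear_eq_poly: "fps_X - fps_const z = fps_of_poly [:- z, 1:]" for z :: complex
  by (simp add: fps_of_poly_pCons)

lemma eval_fps_linear_power_mult:
  assumes "g \<in> Einf" "norm w \<le> 1"
  shows "eval_fps ((fps_X - fps_const z) ^ m * g) w = (w - z) ^ m * eval_fps g w"
proof -
  obtain k where k: "g \<in> E k" using assms by (auto simp: Einf_def)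
  have eq: "(fps_X - fps_const z) ^ m = fps_of_poly ([:- z, 1:] ^ m)"
    by (simp only: fps_linear_eq_poly fps_of_poly_power)
  show ?thesis unfolding eq eval_fps_mult_E[OF E_poly k assms(2)] by simp
qed

lemma Einf_divide_linear:
  assumes "a \<in> Einf" "norm z \<le> 1" "eval_fps a z = 0"
  obtains b where "b \<in> Einf" "a = (fps_X - fps_const z) * b"
proof -
  obtain k where "a \<in> E k" using assms by (auto simp: Einf_def)
  from E_divide_linear[OF this assms(2,3)] EinfI that show ?thesis by metis
qed

text \<open>The Euler operator z d/dz. It multiplies coefficient n by n, so the value of
  \<open>(theta ^^ j) f\<close> at z is the j-th moment of
  \<open>fps_nth f n * z ^ n\<close>.\<close>

definition theta :: "complex fps \<Rightarrow> complex fps" where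
  "theta u = fps_X * fps_deriv u"

text \<open>Each application lowers the order of vanishing by one, which does no harm at a zero of
  infinite order.\<close>

lemma theta_power_divisible:
  assumes flat: "\<And>m. \<exists>g\<in>Einf. f = (fps_X - fps_const z) ^ m * g"
  shows "\<exists>g\<in>Einf. (theta ^^ j) f = (fps_X - fps_const z) ^ m * g"
proof (induction j arbitrary: m)
  case (Suc j)
  define L where "L = fps_X - fps_const z"
  obtain g where g: "g \<in> Einf" "(theta ^^ j) f = L ^ Suc m * g"
    using Suc[of "Suc m"] by (auto simp: L_def)
  define h where "h = of_nat (Suc m) * fps_X * g + L * fps_X * fps_deriv g"
  have "L \<in> Einf" unfolding L_def fps_linear_eq_poly by (rule Einf_poly)
  then have "h \<in> Einf" unfolding h_def
    by (intro Einf_add Einf_mult Einf_deriv g EinfI[OF E_of_nat] EinfI[OF E_X]) auto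
  moreover have "fps_deriv (L ^ Suc m) = of_nat (Suc m) * L ^ m"
    using fps_deriv_power'[of L "Suc m"] by (simp only: diff_Suc_1) (simp add: L_def)
  then have "theta (L ^ Suc m * g) = L ^ m * h"
    unfolding theta_def fps_deriv_mult by (simp add: h_def algebra_simps)
  ultimately show ?case unfolding L_def[symmetric] using g(2) by auto
qed (use flat in auto)

lemma fps_nth_theta_power: "fps_nth ((theta ^^ j) f) n = of_nat n ^ j * fps_nth f n"
  by (induction j) (auto simp: theta_def split: nat.splits)

end

context quasianalytic_weight begin

text \<open>For z = 0 the sequence \<open>fps_nth f n * z ^ n\<close> says nothing about n > 0; that
  case is settled by formal divisibility by powers of X.\<close>

lemma flat_imp_zero:
  assumes f: "f \<in> Einf" and z: "norm z \<le> 1"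
    and flat: "\<And>m. \<exists>g\<in>Einf. f = (fps_X - fps_const z) ^ m * g"
  shows "f = 0"
proof (cases "z = 0")
  case True
  have "fps_nth f n = 0" for n
  proof -
    obtain g where "f = fps_X ^ Suc n * g" using flat[of "Suc n"] True by auto
    then show ?thesis by (simp only: fps_X_power_mult_nth) simp
  qed
  then show ?thesis by (simp add: fps_eq_iff)
next
  case False
  obtain k where k: "f \<in> E k" using f by (auto simp: Einf_def)
  obtain B where B: "B > 0" "\<And>n. wt k n * norm (fps_nth f n) \<le> B" using E_bound[OF k] by blast
  have "fps_nth f n * z ^ n = 0" for n
  proof (rule moments_zero_imp_zero[of "\<lambda>n. fps_nth f n * z ^ n" B k])
    fix n
    have "norm (fps_nth f n * z ^ n) \<le> norm (fps_nth f n)"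
      using z by (simp add: norm_mult norm_power mult_left_le power_le_one)
    also have "\<dots> \<le> B * ((real n + 1) ^ k / \<omega> n)"
      using B(2)[of n] weight_ge_1[of n] by (simp add: wt_def field_simps)
    finally show "norm (fps_nth f n * z ^ n) \<le> B * ((real n + 1) ^ k / \<omega> n)" .
  next
    fix j
    obtain g where g: "g \<in> Einf" "(theta ^^ j) f = (fps_X - fps_const z) ^ 1 * g"
      using theta_power_divisible[OF flat, of j 1] by blast
    have "eval_fps ((theta ^^ j) f) z = 0"
      unfolding g(2) eval_fps_linear_power_mult[OF g(1) z] by simp
    then show "(\<Sum>n. fps_nth f n * z ^ n * of_nat n ^ j) = 0"
      by (simp add: eval_fps_def fps_nth_theta_power mult_ac)
  qed
  then show ?thesis using False by (simp add: fps_eq_iff)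
qed

lemma finite_order_factorization:
  assumes f: "f \<in> Einf" "f \<noteq> 0" and z: "norm z \<le> 1"
  obtains m g where "g \<in> Einf" "f = (fps_X - fps_const z) ^ m * g" "eval_fps g z \<noteq> 0"
proof (rule ccontr)
  assume no: "\<not> thesis"
  have "\<exists>g\<in>Einf. f = (fps_X - fps_const z) ^ m * g" for m
  proof (induction m)
    case (Suc m)
    then obtain g where g: "g \<in> Einf" "f = (fps_X - fps_const z) ^ m * g" by blast
    then have "eval_fps g z = 0" using no that by blast
    then obtain h where "h \<in> Einf" "g = (fps_X - fps_const z) * h"
      using Einf_divide_linear[OF g(1) z] by blast
    then show ?case using g(2) by (intro bexI[of _ h]) (simp_all add: mult_ac)
  qed (use f in auto)
  then show False using flat_imp_zero[OF f(1) z] f(2) by blast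
qed

text \<open>A limit point of zeros may lie on the unit circle, across which f need not extend
  holomorphically. Finite order of the zero there and continuity of the cofactor on the closed disc
  exclude it.\<close>

lemma finite_zeros:
  assumes f: "f \<in> Einf" "f \<noteq> 0"
  shows "finite {z. norm z \<le> 1 \<and> eval_fps f z = 0}" (is "finite ?Z")
proof (rule ccontr)
  assume inf: "infinite ?Z"
  have "?Z \<subseteq> cball 0 1" by auto
  then obtain z where z: "z \<in> cball 0 1" "z islimpt ?Z"
    using inf compact_cball[of "0::complex" 1] unfolding compact_eq_Bolzano_Weierstrass by blast
  then have nz: "norm z \<le> 1" by simp
  obtain m g where g: "g \<in> Einf" "f = (fps_X - fps_const z) ^ m * g" "eval_fps g z \<noteq> 0"
    using finite_order_factorization[OF f nz] by blast
  obtain k where "g \<in> E k" using g(1) by (auto simp: Einf_def)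
  then have "continuous_on (cball 0 1) (eval_fps g)" by (rule continuous_on_eval_fps_E)
  then obtain \<delta> where \<delta>: "\<delta> > 0"
    "\<And>w. w \<in> cball 0 1 \<Longrightarrow> dist w z < \<delta> \<Longrightarrow> dist (eval_fps g w) (eval_fps g z) < norm (eval_fps g z)"
    using z(1) g(3) unfolding continuous_on_iff by (metis zero_less_norm_iff)
  obtain w where w: "w \<in> ?Z" "w \<noteq> z" "dist w z < \<delta>"
    using z(2) \<delta>(1) unfolding islimpt_approachable by blast
  then have "eval_fps g w \<noteq> 0" using \<delta>(2)[of w] by auto
  moreover have "(w - z) ^ m * eval_fps g w = 0"
    using w(1) eval_fps_linear_power_mult[OF g(1), of w z m] g(2) by simp
  ultimately show False using w(2) by simp
qed

lemma zero_free_factorization: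
  assumes "f \<in> Einf" "f \<noteq> 0"
  shows "\<exists>p g. p \<noteq> 0 \<and> (\<forall>z. poly p z = 0 \<longrightarrow> norm z \<le> 1) \<and> g \<in> Einf
      \<and> f = fps_of_poly p * g \<and> (\<forall>z. norm z \<le> 1 \<longrightarrow> eval_fps g z \<noteq> 0)"
  using assms
proof (induction "card {z. norm z \<le> 1 \<and> eval_fps f z = 0}" arbitrary: f)
  case 0
  then have "{z. norm z \<le> 1 \<and> eval_fps f z = 0} = {}" using finite_zeros by simp
  then show ?case using 0 by (intro exI[of _ 1] exI[of _ f]) auto
next
  case (Suc n)
  note fin = finite_zeros[OF Suc.prems]
  have "{z. norm z \<le> 1 \<and> eval_fps f z = 0} \<noteq> {}" using Suc.hyps(2) by (metis card.empty nat.distinct(1))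
  then obtain z where z: "norm z \<le> 1" "eval_fps f z = 0" by blast
  obtain m h where h: "h \<in> Einf" "f = (fps_X - fps_const z) ^ m * h" "eval_fps h z \<noteq> 0"
    using finite_order_factorization[OF Suc.prems z(1)] by blast
  have ev: "eval_fps f w = (w - z) ^ m * eval_fps h w" if "norm w \<le> 1" for w
    using eval_fps_linear_power_mult[OF h(1) that] h(2) by simp
  have "m \<noteq> 0" using ev[OF z(1)] z h(3) by auto
  then have "{w. norm w \<le> 1 \<and> eval_fps h w = 0} = {w. norm w \<le> 1 \<and> eval_fps f w = 0} - {z}"
    using ev h(3) by auto
  then have "card {w. norm w \<le> 1 \<and> eval_fps h w = 0} = n"
    using Suc.hyps(2) z by (simp add: card_Diff_singleton)
  moreover have "h \<noteq> 0" using h Suc.prems by auto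
  ultimately obtain p g where pg: "p \<noteq> 0" "\<forall>z. poly p z = 0 \<longrightarrow> norm z \<le> 1" "g \<in> Einf"
      "h = fps_of_poly p * g" "\<forall>z. norm z \<le> 1 \<longrightarrow> eval_fps g z \<noteq> 0"
    using Suc.hyps(1)[of h] h(1) by metis
  show ?case
  proof (intro exI[of _ "[:- z, 1:] ^ m * p"] exI[of _ g] conjI allI impI)
    show "[:- z, 1:] ^ m * p \<noteq> 0" using pg(1) by simp
    show "norm w \<le> 1" if "poly ([:- z, 1:] ^ m * p) w = 0" for w
      using that pg(2) z(1) by (auto split: if_splits)
    show "f = fps_of_poly ([:- z, 1:] ^ m * p) * g"
      unfolding fps_of_poly_mult fps_of_poly_power fps_linear_eq_poly[symmetric]
      by (simp add: h(2) pg(4) mult.assoc)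
  qed (use pg in auto)
qed

text \<open>With f = p g and g in \<open>E k\<close>, the series p^k / g lies in \<open>E 0\<close>
  and multiplies f to p^(k+1), which has the same zeros as p.\<close>

theorem ideal_contains_polynomial:
  assumes f: "f \<in> E 0" "f \<noteq> 0"
  obtains q u where "q \<noteq> 0" "\<And>z. poly q z = 0 \<Longrightarrow> norm z \<le> 1" "u \<in> E 0" "fps_of_poly q = u * f"
proof -
  obtain p g where pg: "p \<noteq> 0" "\<And>z. poly p z = 0 \<Longrightarrow> norm z \<le> 1" "g \<in> Einf"
      "f = fps_of_poly p * g" "\<And>z. norm z \<le> 1 \<Longrightarrow> eval_fps g z \<noteq> 0"
    using zero_free_factorization[OF EinfI[OF f(1)] f(2)] by metis
  obtain k where k: "g \<in> E k" using pg(3) by (auto simp: Einf_def)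
  define u where "u = fps_of_poly p ^ k * inverse g"
  have "u \<in> E 0" unfolding u_def using f(1) pg(4,5) k by (intro poly_power_div_mem_E) auto
  moreover have "fps_nth g 0 \<noteq> 0" using pg(5)[of 0] by (simp add: eval_fps_at_0)
  then have "inverse g * g = 1" by (rule inverse_mult_eq_1)
  then have "fps_of_poly (p ^ Suc k) = u * f"
    by (simp add: u_def pg(4) fps_of_poly_power fps_of_poly_mult mult_ac)
  moreover have "p ^ Suc k \<noteq> 0" using pg(1) by simp
  moreover have "norm z \<le> 1" if "poly (p ^ Suc k) z = 0" for z
    using that pg(2) by auto
  ultimately show ?thesis using that by blast
qed

end

section \<open>The Hilbert space as the algebra \<open>E 0\<close>\<close>

context smooth_weight begin

definition fps_of_ell2 :: "ell2 \<Rightarrow> complex fps" where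
  "fps_of_ell2 x = Abs_fps (\<lambda>n. coord x n / of_real (\<omega> n))"

definition ell2_of_fps :: "complex fps \<Rightarrow> ell2" where
  "ell2_of_fps a = Abs_ell2 (\<lambda>n. of_real (\<omega> n) * fps_nth a n)"

lemma weight_nz [simp]: "\<omega> n \<noteq> 0"
  using weight_ge_1[of n] by linarith

lemma weight_pos [simp]: "\<omega> n > 0"
  using weight_ge_1[of n] by linarith

lemma norm_weight: "norm (complex_of_real (\<omega> n)) = \<omega> n"
  by (simp add: abs_of_pos)

lemma coord_ell2_of_fps: "a \<in> E 0 \<Longrightarrow> coord (ell2_of_fps a) n = of_real (\<omega> n) * fps_nth a n"
  unfolding ell2_of_fps_def
  by (subst Abs_ell2_inverse) (auto simp: E_def wt_0 norm_mult norm_weight simp del: norm_of_real)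

lemma fps_of_ell2_E [simp]: "fps_of_ell2 x \<in> E 0"
  using summable_coord[of x]
  by (simp add: E_def wt_0 fps_of_ell2_def norm_divide norm_weight del: norm_of_real)

lemma fps_of_ell2_of_fps: "a \<in> E 0 \<Longrightarrow> fps_of_ell2 (ell2_of_fps a) = a"
  by (simp add: fps_eq_iff fps_of_ell2_def coord_ell2_of_fps)

lemma ell2_of_fps_of_ell2: "ell2_of_fps (fps_of_ell2 x) = x"
  by (rule ell2_eqI, subst coord_ell2_of_fps[OF fps_of_ell2_E]) (simp add: fps_of_ell2_def)

lemma fps_of_ell2_inject: "fps_of_ell2 x = fps_of_ell2 y \<longleftrightarrow> x = y"
  by (metis ell2_of_fps_of_ell2)

lemma fps_of_ell2_add: "fps_of_ell2 (x + y) = fps_of_ell2 x + fps_of_ell2 y"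
  and fps_of_ell2_diff: "fps_of_ell2 (x - y) = fps_of_ell2 x - fps_of_ell2 y"
  and fps_of_ell2_scaleC: "fps_of_ell2 (c *\<^sub>C x) = fps_const c * fps_of_ell2 x"
  and fps_of_ell2_0: "fps_of_ell2 0 = 0"
  by (simp_all add: fps_eq_iff fps_of_ell2_def add_divide_distrib diff_divide_distrib)

lemma norm_ell2_le_iff_nrm:
  assumes "B \<ge> 0" shows "norm x \<le> B \<longleftrightarrow> (\<forall>M. nrm 0 M (fps_of_ell2 x) \<le> B)"
proof -
  have eq: "nrm 0 M (fps_of_ell2 x) = sqrt (\<Sum>n\<le>M. (norm (coord x n))\<^sup>2)" for M
    by (simp add: nrm_def L2_set_def wt_0 fps_of_ell2_def norm_divide norm_weight del: norm_of_real)
  have "sqrt (\<Sum>n\<le>M. (norm (coord x n))\<^sup>2) \<le> norm x" for M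
    unfolding norm_ell2 by (intro real_sqrt_le_mono sum_le_suminf summable_coord) auto
  moreover have "norm x \<le> B" if "\<And>M. sqrt (\<Sum>n\<le>M. (norm (coord x n))\<^sup>2) \<le> B"
  proof -
    have "(\<Sum>n<M. (norm (coord x n))\<^sup>2) \<le> B\<^sup>2" for M
    proof -
      have "(\<Sum>n<M. (norm (coord x n))\<^sup>2) \<le> (\<Sum>n\<le>M. (norm (coord x n))\<^sup>2)" by (intro sum_mono2) auto
      also have "\<dots> \<le> B\<^sup>2" using that[of M] by (rule sqrt_le_D)
      finally show ?thesis .
    qed
    then have "(norm x)\<^sup>2 \<le> B\<^sup>2" unfolding power2_norm_ell2 by (intro suminf_le_const summable_coord)
    then show ?thesis using assms by (rule power2_le_imp_le)
  qed
  ultimately show ?thesis unfolding eq using order_trans by blast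
qed

lemma is_weighted_shift: "is_weighted_shift \<omega> (weighted_shift \<omega>)"
proof (rule is_weighted_shift_weighted_shift, rule shift_weights_bounded)
  show "eventually_concave (\<lambda>n. ln (\<omega> n))" using weight_concave[of 0] by simp
qed (rule weight_ge_1)

lemma weighted_shift_bounded_op: "weighted_shift \<omega> \<in> bounded_ops"
  using is_weighted_shift by (simp add: is_weighted_shift_def)

text \<open>The shift is specified on basis vectors only. On the partial sums of x each coordinate
  of the image is eventually constant, and continuity gives its value at x.\<close>

lemma fps_of_weighted_shift:
  "fps_of_ell2 (weighted_shift \<omega> x) = fps_X * fps_of_ell2 x"
proof -
  let ?T = "weighted_shift \<omega>"
  let ?p = "\<lambda>K. \<Sum>k<K. coord x k *\<^sub>C basis_vec k"
  define l where "l n = (if n = 0 then 0 else of_real (\<omega> n / \<omega> (n - 1)) * coord x (n - 1))" for n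
  have "bounded_linear (\<lambda>x. coord x n)" for n
    by (rule bounded_linear_intro[where K = 1]) (auto simp: norm_coord_le scaleR_conv_of_real)
  then have "(\<lambda>K. coord (?T (?p K)) n) \<longlonglongrightarrow> coord (?T x) n" for n
    by (rule bounded_linear.tendsto) (intro tendsto_intros basis_expansion)
  moreover have c: "coord (?T (?p K)) n = (if n = 0 \<or> n > K then 0 else of_real (\<omega> n / \<omega> (n - 1)) * coord x (n - 1))" for K n
  proof -
    have "?T (?p K) = (\<Sum>k<K. coord x k *\<^sub>C of_real (\<omega> (k + 1) / \<omega> k) *\<^sub>C basis_vec (k + 1))"
      using is_weighted_shift unfolding is_weighted_shift_def bounded_ops_def by (simp add: blinfun.sum_right)
    then show ?thesis by (cases n) (auto simp: coord_sum if_distrib[of "\<lambda>t. _ * t"] cong: if_cong)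
  qed
  have "\<forall>\<^sub>F K in sequentially. l n = coord (?T (?p K)) n" for n
    using eventually_ge_at_top[of n] by eventually_elim (auto simp: c l_def)
  from Lim_transform_eventually[OF tendsto_const this]
  have "(\<lambda>K. coord (?T (?p K)) n) \<longlonglongrightarrow> l n" for n .
  ultimately have "coord (?T x) n = l n" for n
    using LIMSEQ_unique by blast
  then show ?thesis by (simp add: l_def fps_eq_iff fps_of_ell2_def)
qed

text \<open>For a polynomial u this is invariance and linearity. A general u is approximated by its
  truncations, and multiplication by x is continuous by \<open>nrm_mult\<close>.\<close>

lemma Lat_mult_closed:
  assumes M: "M \<in> Lat (weighted_shift \<omega>)" and x: "x \<in> M" and u: "u \<in> E 0"
  shows "ell2_of_fps (u * fps_of_ell2 x) \<in> M"
proof -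
  have M': "closed M" "0 \<in> M" "\<And>x y. x \<in> M \<Longrightarrow> y \<in> M \<Longrightarrow> x + y \<in> M" "\<And>c x. x \<in> M \<Longrightarrow> c *\<^sub>C x \<in> M"
    "\<And>x. x \<in> M \<Longrightarrow> weighted_shift \<omega> x \<in> M"
    using M by (auto simp: Lat_def closed_csubspace_def)
  have pol: "ell2_of_fps (fps_of_poly p * fps_of_ell2 x) \<in> M" for p
  proof (induction p)
    case 0
    have "ell2_of_fps 0 = 0" using ell2_of_fps_of_ell2[of 0] by (simp add: fps_of_ell2_0)
    then show ?case using M'(2) by simp
  next
    case (pCons c p)
    define y where "y = ell2_of_fps (fps_of_poly p * fps_of_ell2 x)"
    have y: "fps_of_ell2 y = fps_of_poly p * fps_of_ell2 x"
      unfolding y_def by (intro fps_of_ell2_of_fps E_mult E_poly fps_of_ell2_E)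
    have "fps_of_ell2 (c *\<^sub>C x + weighted_shift \<omega> y) = fps_of_poly (pCons c p) * fps_of_ell2 x"
      by (simp add: fps_of_ell2_add fps_of_ell2_scaleC fps_of_weighted_shift y fps_of_poly_pCons algebra_simps)
    then have "ell2_of_fps (fps_of_poly (pCons c p) * fps_of_ell2 x) = c *\<^sub>C x + weighted_shift \<omega> y"
      by (metis ell2_of_fps_of_ell2)
    then show ?case using M'(3,4,5) x pCons(2) by (simp add: y_def)
  qed
  obtain C where C: "C > 0" "\<And>M a b. nrm 0 M (a * b) \<le> C * nrm 0 M a * nrm 0 M b"
    using nrm_mult by blast
  have "\<exists>y\<in>M. dist y (ell2_of_fps (u * fps_of_ell2 x)) < e" if e: "e > 0" for e
  proof -
    define N where "N = norm x + 1"
    have N: "N > 0" by (simp add: N_def add_nonneg_pos)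
    define \<epsilon> where "\<epsilon> = e / (2 * C * N)"
    have \<epsilon>: "\<epsilon> > 0" using e C(1) N by (simp add: \<epsilon>_def)
    obtain p where p: "\<And>M. nrm 0 M (fps_of_poly p - u) \<le> \<epsilon>" using E_truncate[OF u \<epsilon>] by blast
    define y where "y = ell2_of_fps (fps_of_poly p * fps_of_ell2 x)"
    have "norm (y - ell2_of_fps (u * fps_of_ell2 x)) \<le> e / 2"
      unfolding norm_ell2_le_iff_nrm[OF less_imp_le[OF half_gt_zero[OF e]]]
    proof
      fix M
      have "fps_of_ell2 (y - ell2_of_fps (u * fps_of_ell2 x)) = (fps_of_poly p - u) * fps_of_ell2 x"
        unfolding y_def fps_of_ell2_diff
        using u by (simp add: fps_of_ell2_of_fps E_mult E_poly left_diff_distrib)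
      then have "nrm 0 M (fps_of_ell2 (y - ell2_of_fps (u * fps_of_ell2 x)))
          \<le> C * nrm 0 M (fps_of_poly p - u) * nrm 0 M (fps_of_ell2 x)" by (simp add: C(2))
      also have "\<dots> \<le> C * \<epsilon> * N"
      proof (intro mult_mono p order_refl)
        show "nrm 0 M (fps_of_ell2 x) \<le> N"
          using norm_ell2_le_iff_nrm[of "norm x" x] by (simp add: N_def add_increasing2)
      qed (use C(1) \<epsilon> in auto)
      also have "\<dots> = e / 2" using C(1) N by (simp add: \<epsilon>_def)
      finally show "nrm 0 M (fps_of_ell2 (y - ell2_of_fps (u * fps_of_ell2 x))) \<le> e / 2" .
    qed
    then show ?thesis using pol[of p] e by (intro bexI[of _ y]) (auto simp: y_def dist_norm)
  qed
  then have "ell2_of_fps (u * fps_of_ell2 x) \<in> closure M" by (simp add: closure_approachable)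
  then show ?thesis using M'(1) by simp
qed

end

context quasianalytic_weight begin

theorem Lat_contains_polynomial:
  assumes M: "M \<in> Lat (weighted_shift \<omega>)" and "M \<noteq> {0}"
  obtains q where "q \<noteq> 0" "\<And>z. poly q z = 0 \<Longrightarrow> norm z \<le> 1" "ell2_of_fps (fps_of_poly q) \<in> M"
proof -
  have "0 \<in> M" using M by (simp add: Lat_def closed_csubspace_def)
  then obtain x where x: "x \<in> M" "x \<noteq> 0" using assms(2) by blast
  then have "fps_of_ell2 x \<noteq> 0" using fps_of_ell2_inject[of x 0] by (simp add: fps_of_ell2_0)
  then obtain q u where "q \<noteq> 0" "\<And>z. poly q z = 0 \<Longrightarrow> norm z \<le> 1" "u \<in> E 0"
      "fps_of_poly q = u * fps_of_ell2 x"
    using ideal_contains_polynomial[of "fps_of_ell2 x"] by auto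
  then show ?thesis using that[of q] Lat_mult_closed[OF M x(1), of u] by simp
qed

end

section \<open>Orthogonal projections and stability\<close>

lemma cinner_commute: "cinner x y = cnj (cinner y x)"
proof -
  have "cnj (cinner y x) = (\<Sum>n. cnj (coord y n * cnj (coord x n)))"
    unfolding cinner_def by (rule bounded_linear.suminf[OF bounded_linear_cnj cinner_summable])
  then show ?thesis by (simp add: cinner_def mult.commute)
qed

lemma cinner_eq_inner: "cinner x y = Complex (inner x y) (inner x (\<i> *\<^sub>C y))"
  by (simp add: complex_eq_iff inner_ell2_def cinner_scaleC_right)

lemma scaleC_eq_scaleR: "c *\<^sub>C x = Re c *\<^sub>R x + Im c *\<^sub>R (\<i> *\<^sub>C x)"
  by (rule ell2_eqI) (simp add: complex_eq_iff)

lemma continuous_on_cinner [continuous_intros]: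
  "continuous_on A f \<Longrightarrow> continuous_on A (\<lambda>x. cinner (f x) y)"
  unfolding cinner_eq_inner by (simp add: Complex_eq) (intro continuous_intros)

lemma continuous_on_scaleC [continuous_intros]:
  "continuous_on A f \<Longrightarrow> continuous_on A (\<lambda>x. f x *\<^sub>C y)"
  unfolding scaleC_eq_scaleR[of "f _"] by (intro continuous_intros)

lemma bounded_linear_scaleC: "bounded_linear (\<lambda>x. c *\<^sub>C x)"
  by (rule bounded_linear_intro[where K = "norm c"])
    (auto intro!: ell2_eqI simp: norm_scaleC algebra_simps)

lemma scaleC_add_right: "c *\<^sub>C (x + y) = c *\<^sub>C x + c *\<^sub>C y"
  and scaleC_add_left: "(c + d) *\<^sub>C x = c *\<^sub>C x + d *\<^sub>C x"
  and scaleC_diff_right: "c *\<^sub>C (x - y) = c *\<^sub>C x - c *\<^sub>C y"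
  and scaleC_assoc: "c *\<^sub>C d *\<^sub>C x = (c * d) *\<^sub>C x"
  and scaleC_commute: "c *\<^sub>C d *\<^sub>C x = d *\<^sub>C c *\<^sub>C x"
  and scaleC_0: "c *\<^sub>C 0 = 0" "0 *\<^sub>C x = 0" and scaleC_1: "1 *\<^sub>C x = x"
  by (auto intro!: ell2_eqI simp: algebra_simps)

context
  fixes M :: "ell2 set" assumes M: "closed_csubspace M"
begin

lemma closed_csubspaceD:
  "closed M" "0 \<in> M" "\<And>x y. x \<in> M \<Longrightarrow> y \<in> M \<Longrightarrow> x + y \<in> M" "\<And>c x. x \<in> M \<Longrightarrow> c *\<^sub>C x \<in> M"
  "\<And>x y. x \<in> M \<Longrightarrow> y \<in> M \<Longrightarrow> x - y \<in> M"
  using M closed_csubspace_diff by (auto simp: closed_csubspace_def)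

lemma orth_proj_mem: "orth_proj M x \<in> M"
  and orth_proj_orth: "y \<in> M \<Longrightarrow> cinner (x - orth_proj M x) y = 0"
  using is_orth_proj_orth_proj[OF M] by (auto simp: is_orth_proj_def)

lemma orth_proj_eqI: "p \<in> M \<Longrightarrow> (\<And>y. y \<in> M \<Longrightarrow> cinner (x - p) y = 0) \<Longrightarrow> orth_proj M x = p"
  by (rule orth_point_unique[where x = x, OF M orth_proj_mem]) (simp_all add: orth_proj_orth)

lemma orth_proj_inner: "y \<in> M \<Longrightarrow> inner (x - orth_proj M x) y = 0"
  using orth_proj_orth by (simp add: inner_ell2_def)

lemma orth_proj_pythagoras:
  assumes "y \<in> M"
  shows "(norm (x - y))\<^sup>2 = (norm (x - orth_proj M x))\<^sup>2 + (norm (orth_proj M x - y))\<^sup>2"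
  using norm_add_Pythagorean[of "x - orth_proj M x" "orth_proj M x - y"]
    orth_proj_inner[OF closed_csubspaceD(5)[OF orth_proj_mem assms], of x] by (simp add: orthogonal_def)

lemma orth_proj_best: "y \<in> M \<Longrightarrow> norm (x - orth_proj M x) \<le> norm (x - y)"
  by (rule power2_le_imp_le) (simp_all add: orth_proj_pythagoras[of y x])

lemma norm_orth_proj_le: "norm (orth_proj M x) \<le> norm x"
  using orth_proj_pythagoras[OF closed_csubspaceD(2), of x] by (rule_tac power2_le_imp_le) simp_all

end

text \<open>Split (P - Q) x = P (x - Q x) - (Q x - P (Q x)). The second term is small because N is
  close to M. For y = P (x - Q x), pair y with x - Q x: this is orthogonal to N and sees only y - w
  for w in N.\<close>

lemma orth_proj_gap:
  assumes M: "closed_csubspace M" and N: "closed_csubspace N" and "\<epsilon> \<ge> 0"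
    and MN: "\<And>x. x \<in> M \<Longrightarrow> \<exists>y\<in>N. norm (x - y) \<le> \<epsilon> * norm x"
    and NM: "\<And>y. y \<in> N \<Longrightarrow> \<exists>x\<in>M. norm (y - x) \<le> \<epsilon> * norm y"
  shows "norm (orth_proj M - orth_proj N) \<le> 2 * \<epsilon>"
proof (rule norm_blinfun_bound)
  fix x
  let ?P = "blinfun_apply (orth_proj M)" and ?Q = "blinfun_apply (orth_proj N)"
  obtain m where m: "m \<in> M" "norm (?Q x - m) \<le> \<epsilon> * norm (?Q x)"
    using NM[OF orth_proj_mem[OF N]] by blast
  have "norm (?Q x - ?P (?Q x)) \<le> norm (?Q x - m)" by (rule orth_proj_best[OF M m(1)])
  also have "\<dots> \<le> \<epsilon> * norm x"
    by (rule order_trans[OF m(2) mult_left_mono[OF norm_orth_proj_le[OF N] \<open>\<epsilon> \<ge> 0\<close>]])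
  finally have 1: "norm (?Q x - ?P (?Q x)) \<le> \<epsilon> * norm x" .
  define y where "y = ?P (x - ?Q x)"
  have y: "y \<in> M" unfolding y_def by (rule orth_proj_mem[OF M])
  obtain w where w: "w \<in> N" "norm (y - w) \<le> \<epsilon> * norm y" using MN[OF y] by blast
  have "norm (x - ?Q x) \<le> norm x"
    using orth_proj_best[OF N closed_csubspaceD(2)[OF N], of x] by simp
  have "inner y y = inner (x - ?Q x) y"
    using orth_proj_inner[OF M y, of "x - ?Q x"] by (simp add: y_def inner_diff_left)
  also have "\<dots> = inner (x - ?Q x) (y - w)"
    using orth_proj_inner[OF N w(1), of x] by (simp add: inner_diff_right)
  also have "\<dots> \<le> norm (x - ?Q x) * norm (y - w)" by (rule norm_cauchy_schwarz)
  also have "\<dots> \<le> norm x * (\<epsilon> * norm y)"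
    using w(2) \<open>norm (x - ?Q x) \<le> norm x\<close> by (intro mult_mono) auto
  finally have "norm y * norm y \<le> (\<epsilon> * norm x) * norm y"
    unfolding power2_norm_eq_inner[symmetric] power2_eq_square by (simp only: mult_ac)
  then have 2: "norm y \<le> \<epsilon> * norm x"
    using \<open>\<epsilon> \<ge> 0\<close> by (cases "norm y = 0") auto
  have "(orth_proj M - orth_proj N) x = y - (?Q x - ?P (?Q x))"
    by (simp add: y_def blinfun.diff_left blinfun.diff_right)
  then show "norm ((orth_proj M - orth_proj N) x) \<le> 2 * \<epsilon> * norm x"
    using norm_triangle_ineq4[of y "?Q x - ?P (?Q x)"] 1 2 by simp
qed (use \<open>\<epsilon> \<ge> 0\<close> in simp)

section \<open>Orthogonal complements and finite codimension\<close>

definition ocomp :: "ell2 set \<Rightarrow> ell2 set" where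
  "ocomp M = {x. \<forall>y\<in>M. cinner x y = 0}"

lemma closed_csubspace_ocomp: "closed_csubspace (ocomp M)"
proof -
  have "closed {x. cinner x y = 0}" for y
    by (intro closed_Collect_eq continuous_intros)
  then have "closed (\<Inter>y\<in>M. {x. cinner x y = 0})" by (intro closed_INT) auto
  also have "(\<Inter>y\<in>M. {x. cinner x y = 0}) = ocomp M" by (auto simp: ocomp_def)
  finally show ?thesis
    unfolding closed_csubspace_def
    by (auto simp: ocomp_def cinner_add_left cinner_scaleC_left) (simp add: cinner_def)
qed

lemma orth_proj_ocomp:
  assumes M: "closed_csubspace M" shows "orth_proj (ocomp M) = id_blinfun - orth_proj M"
proof (rule blinfun_eqI)
  fix x
  show "blinfun_apply (orth_proj (ocomp M)) x = (id_blinfun - orth_proj M) x"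
  proof (rule orth_proj_eqI[OF closed_csubspace_ocomp])
    show "(id_blinfun - orth_proj M) x \<in> ocomp M"
      using orth_proj_orth[OF M] by (simp add: ocomp_def blinfun.diff_left)
    fix y assume "y \<in> ocomp M"
    then have "cinner y (orth_proj M x) = 0"
      using orth_proj_mem[OF M] by (simp add: ocomp_def)
    then show "cinner (x - (id_blinfun - orth_proj M) x) y = 0"
      by (subst cinner_commute) (simp add: blinfun.diff_left)
  qed
qed

text \<open>Lets subspaces of finite codimension be compared through their finite-dimensional
  complements.\<close>

lemma norm_orth_proj_ocomp_diff:
  assumes "closed_csubspace M" "closed_csubspace N"
  shows "norm (orth_proj (ocomp M) - orth_proj (ocomp N)) = norm (orth_proj M - orth_proj N)"
  by (simp add: orth_proj_ocomp assms norm_minus_commute)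

lemma ocomp_ocomp:
  assumes M: "closed_csubspace M" shows "ocomp (ocomp M) = M"
proof safe
  fix x assume "x \<in> M"
  show "x \<in> ocomp (ocomp M)" unfolding ocomp_def[of "ocomp M"]
  proof (intro CollectI ballI)
    fix y assume "y \<in> ocomp M"
    then have "cinner y x = 0" using \<open>x \<in> M\<close> by (simp add: ocomp_def)
    then show "cinner x y = 0" by (subst cinner_commute) simp
  qed
next
  fix x assume x: "x \<in> ocomp (ocomp M)"
  have "blinfun_apply (orth_proj (ocomp M)) x = 0"
    by (rule orth_proj_eqI[OF closed_csubspace_ocomp closed_csubspaceD(2)[OF closed_csubspace_ocomp]])
      (use x in \<open>simp add: ocomp_def[of "ocomp M"]\<close>)
  then have "x = orth_proj M x" by (simp add: orth_proj_ocomp[OF M] blinfun.diff_left)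
  then show "x \<in> M" using orth_proj_mem[OF M] by metis
qed

instance ell2 :: banach ..

lemma closed_csubspace_subspace: "closed_csubspace M \<Longrightarrow> subspace M"
  using closed_csubspace_scaleR by (auto simp: subspace_def closed_csubspace_def)

lemma closed_image_bounded_below:
  fixes f :: "'a::banach \<Rightarrow> 'b::banach"
  assumes "bounded_linear f" "subspace S" "closed S" "c > 0" "\<And>x. x \<in> S \<Longrightarrow> c * norm x \<le> norm (f x)"
  shows "closed (f ` S)"
  using complete_isometric_image[of c S f] assms by (simp add: complete_eq_closed)

definition add_line :: "ell2 set \<Rightarrow> ell2 \<Rightarrow> ell2 set" where
  "add_line M e = {m + c *\<^sub>C e | m c. m \<in> M}"

text \<open>Closedness is the point: M plus the line is the solution set of a continuous equation,
  written with the component u of e orthogonal to M.\<close>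

lemma closed_csubspace_add_line:
  assumes M: "closed_csubspace M" shows "closed_csubspace (add_line M e)"
proof -
  let ?P = "blinfun_apply (orth_proj M)"
  define u where "u = e - ?P e"
  have u: "cinner u y = 0" "cinner y u = 0" if "y \<in> M" for y
    using orth_proj_orth[OF M that, of e] cinner_commute[of y u] by (auto simp: u_def)
  \<comment> \<open>For e in M the vector u is 0, the quotient is 0 by convention, and both sides
    are M.\<close>
  have "add_line M e = {x. x - ?P x = (cinner x u / cinner u u) *\<^sub>C u}" (is "_ = ?R")
  proof safe
    fix x assume "x \<in> add_line M e"
    then obtain m c where m: "x = m + c *\<^sub>C e" "m \<in> M" by (auto simp: add_line_def)
    then have x: "x = (m + c *\<^sub>C ?P e) + c *\<^sub>C u" by (simp add: u_def scaleC_diff_right)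
    have mem: "m + c *\<^sub>C ?P e \<in> M" using m(2) closed_csubspaceD[OF M] orth_proj_mem[OF M] by blast
    have "?P x = m + c *\<^sub>C ?P e"
      by (rule orth_proj_eqI[OF M mem]) (simp add: x cinner_scaleC_left u)
    then have "x - ?P x = c *\<^sub>C u" using x by simp
    moreover have "cinner x u = c * cinner u u"
      unfolding x by (simp only: cinner_add_left[of "m + c *\<^sub>C ?P e"] u(2)[OF mem] cinner_scaleC_left) simp
    moreover have "c *\<^sub>C u = 0" if "cinner u u = 0"
    proof -
      have "inner u u = 0" using that by (simp add: inner_ell2_def)
      then show ?thesis by (simp add: scaleC_0)
    qed
    ultimately show "x - ?P x = (cinner x u / cinner u u) *\<^sub>C u"
      by (cases "cinner u u = 0") (auto simp: scaleC_0)
  next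
    fix x assume x: "x - ?P x = (cinner x u / cinner u u) *\<^sub>C u"
    define c where "c = cinner x u / cinner u u"
    have "x = (?P x - c *\<^sub>C ?P e) + c *\<^sub>C e"
      using x by (simp add: u_def scaleC_diff_right c_def algebra_simps)
    moreover have "?P x - c *\<^sub>C ?P e \<in> M"
      using closed_csubspaceD[OF M] orth_proj_mem[OF M] by blast
    ultimately show "x \<in> add_line M e" unfolding add_line_def by blast
  qed
  moreover have "closed ?R"
    unfolding divide_inverse by (intro closed_Collect_eq continuous_intros)
  ultimately have "closed (add_line M e)" by simp
  moreover have "0 \<in> add_line M e"
    using closed_csubspaceD(2)[OF M] unfolding add_line_def by (auto intro!: exI[of _ 0] simp: scaleC_0)
  moreover have "x + y \<in> add_line M e" if xy: "x \<in> add_line M e" "y \<in> add_line M e" for x y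
  proof -
    obtain m c n d where "x = m + c *\<^sub>C e" "m \<in> M" "y = n + d *\<^sub>C e" "n \<in> M"
      using xy by (auto simp: add_line_def)
    then have "x + y = (m + n) + (c + d) *\<^sub>C e" "m + n \<in> M"
      using closed_csubspaceD(3)[OF M] by (auto simp: scaleC_add_left)
    then show ?thesis unfolding add_line_def by blast
  qed
  moreover have "a *\<^sub>C x \<in> add_line M e" if x: "x \<in> add_line M e" for a x
  proof -
    obtain m c where "x = m + c *\<^sub>C e" "m \<in> M" using x by (auto simp: add_line_def)
    then have "a *\<^sub>C x = a *\<^sub>C m + (a * c) *\<^sub>C e" "a *\<^sub>C m \<in> M"
      using closed_csubspaceD(4)[OF M] by (auto simp: scaleC_add_right scaleC_assoc)
    then show ?thesis unfolding add_line_def by blast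
  qed
  ultimately show ?thesis unfolding closed_csubspace_def by blast
qed

lemma subset_add_line: "M \<subseteq> add_line M e"
proof
  fix x assume "x \<in> M"
  moreover have "x = x + 0 *\<^sub>C e" by (simp add: scaleC_0)
  ultimately show "x \<in> add_line M e" unfolding add_line_def by blast
qed

lemma mem_add_line: assumes "0 \<in> M" shows "e \<in> add_line M e"
  unfolding add_line_def using assms by (auto intro!: exI[of _ 0] exI[of _ 1] simp: scaleC_1)

text \<open>Encodes finite codimension of M as \<open>add_lines M es = UNIV\<close> for some list
  es.\<close>

primrec add_lines :: "ell2 set \<Rightarrow> ell2 list \<Rightarrow> ell2 set" where
  "add_lines M [] = M"
| "add_lines M (e # es) = add_lines (add_line M e) es"

lemma closed_csubspace_add_lines: "closed_csubspace M \<Longrightarrow> closed_csubspace (add_lines M es)"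
  by (induction es arbitrary: M) (auto intro: closed_csubspace_add_line)

lemma subset_add_lines: "M \<subseteq> add_lines M es"
proof (induction es arbitrary: M)
  case (Cons e es)
  then show ?case using subset_add_line[of M e] by fastforce
qed simp

lemma mem_add_lines: "0 \<in> M \<Longrightarrow> e \<in> set es \<Longrightarrow> e \<in> add_lines M es"
proof (induction es arbitrary: M)
  case (Cons a es)
  have "0 \<in> add_line M a" using subset_add_line[of M a] Cons.prems by blast
  then show ?case
    using Cons mem_add_line[of M a] subset_add_lines[of "add_line M a" es] by auto
qed simp

lemma add_lines_subset:
  "M \<subseteq> S \<Longrightarrow> (\<And>x c e. x \<in> S \<Longrightarrow> e \<in> set es \<Longrightarrow> x + c *\<^sub>C e \<in> S) \<Longrightarrow> add_lines M es \<subseteq> S"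
proof (induction es arbitrary: M)
  case (Cons a es)
  have "add_line M a \<subseteq> S" using Cons.prems unfolding add_line_def by auto
  then show ?case using Cons by simp
qed simp

text \<open>The unit sphere of a finite-dimensional orthogonal complement is compact, so that strong
  convergence is uniform on it; the induction removes one dimension at a time.\<close>

lemma strong_limit_uniform_on_ocomp:
  fixes D :: "'a \<Rightarrow> ell2 \<Rightarrow> ell2"
  assumes M: "closed_csubspace M" "add_lines M es = UNIV"
    and add: "\<And>r x y. D r (x + y) = D r x + D r y" and scale: "\<And>r c x. D r (c *\<^sub>C x) = c *\<^sub>C D r x"
    and lim: "\<And>x. ((\<lambda>r. D r x) \<longlongrightarrow> x) F"
    and \<epsilon>: "\<epsilon> > 0"
  shows "\<forall>\<^sub>F r in F. \<forall>v\<in>ocomp M. norm (v - D r v) \<le> \<epsilon> * norm v"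
  using M \<epsilon>
proof (induction es arbitrary: M \<epsilon>)
  case Nil
  then have "v = 0" if "v \<in> ocomp M" for v
  proof -
    have "cinner v v = 0" using that Nil by (simp add: ocomp_def)
    then have "inner v v = 0" by (simp add: inner_ell2_def)
    then show ?thesis by simp
  qed
  moreover have "D r 0 = 0" for r using scale[of r 0 0] by (simp add: scaleC_0)
  ultimately have "norm (v - D r v) \<le> \<epsilon> * norm v" if "v \<in> ocomp M" for v r
    using that by (metis diff_zero norm_zero mult_zero_right order_refl)
  then show ?case by (intro always_eventually) blast
next
  case (Cons e es)
  let ?P = "blinfun_apply (orth_proj M)"
  define u where "u = e - ?P e"
  have uM: "cinner u y = 0" if "y \<in> M" for y
    using orth_proj_orth[OF Cons.prems(1) that, of e] by (simp add: u_def)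
  have IH: "\<forall>\<^sub>F r in F. \<forall>v\<in>ocomp (add_line M e). norm (v - D r v) \<le> (\<epsilon> / 2) * norm v"
    using Cons.prems by (intro Cons.IH closed_csubspace_add_line) auto
  \<comment> \<open>The projection of v to \<open>add_line M e\<close> is orthogonal to M, hence a
    multiple of u: this is the dimension split off.\<close>
  have dec: "\<exists>c v'. v = c *\<^sub>C u + v' \<and> v' \<in> ocomp (add_line M e) \<and> norm (c *\<^sub>C u) \<le> norm v \<and> norm v' \<le> norm v"
    if v: "v \<in> ocomp M" for v
  proof -
    let ?L = "add_line M e"
    have L: "closed_csubspace ?L" by (rule closed_csubspace_add_line[OF Cons.prems(1)])
    define w where "w = orth_proj ?L v"
    have v': "v - w \<in> ocomp ?L" using orth_proj_orth[OF L] by (simp add: ocomp_def w_def)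
    obtain m c where "w = m + c *\<^sub>C e" "m \<in> M"
      using orth_proj_mem[OF L, of v] by (auto simp: w_def add_line_def)
    then have w: "w = (m + c *\<^sub>C ?P e) + c *\<^sub>C u" by (simp add: u_def scaleC_diff_right)
    have mem: "m + c *\<^sub>C ?P e \<in> M"
      using \<open>m \<in> M\<close> closed_csubspaceD[OF Cons.prems(1)] orth_proj_mem[OF Cons.prems(1)] by blast
    have "cinner (v - w) (m + c *\<^sub>C ?P e) = 0" using v' mem subset_add_line unfolding ocomp_def by blast
    then have "cinner (m + c *\<^sub>C ?P e) (m + c *\<^sub>C ?P e) = 0"
      using v uM[OF mem] mem
      by (simp add: w ocomp_def cinner_diff_left cinner_add_left[of "m + c *\<^sub>C ?P e"] cinner_scaleC_left)
    then have "inner (m + c *\<^sub>C ?P e) (m + c *\<^sub>C ?P e) = 0" by (simp add: inner_ell2_def)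
    then have "w = c *\<^sub>C u" using w by simp
    moreover have "norm w \<le> norm v" unfolding w_def by (rule norm_orth_proj_le[OF L])
    moreover have "norm (v - w) \<le> norm v"
      using orth_proj_best[OF L closed_csubspaceD(2)[OF L], of v] by (simp add: w_def)
    ultimately show ?thesis using v' by (intro exI[of _ c] exI[of _ "v - w"]) simp
  qed
  have "((\<lambda>r. norm (u - D r u)) \<longlongrightarrow> norm (u - u)) F" by (intro tendsto_intros lim)
  then have "\<forall>\<^sub>F r in F. norm (u - D r u) \<le> \<epsilon> / 2 * norm u"
  proof (cases "u = 0")
    case True
    then have "D r u = 0" for r using scale[of r 0 u] by (simp add: scaleC_0)
    then show ?thesis using True by simp
  next
    case False
    then have "\<epsilon> / 2 * norm u > 0" using Cons.prems(3) by simp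
    moreover assume "((\<lambda>r. norm (u - D r u)) \<longlongrightarrow> norm (u - u)) F"
    ultimately have "\<forall>\<^sub>F r in F. norm (u - D r u) < \<epsilon> / 2 * norm u"
      by (intro order_tendstoD(2)) auto
    then show ?thesis by eventually_elim simp
  qed
  with IH show ?case
  proof eventually_elim
    case (elim r)
    show ?case
    proof
      fix v assume "v \<in> ocomp M"
      then obtain c v' where v: "v = c *\<^sub>C u + v'" "v' \<in> ocomp (add_line M e)" "norm (c *\<^sub>C u) \<le> norm v" "norm v' \<le> norm v"
        using dec by blast
      have "v - D r v = c *\<^sub>C (u - D r u) + (v' - D r v')"
        unfolding v(1) add scale scaleC_diff_right by simp
      then have "norm (v - D r v) \<le> norm c * norm (u - D r u) + norm (v' - D r v')"
        using norm_triangle_ineq by (metis norm_scaleC)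
      also have "\<dots> \<le> norm c * (\<epsilon> / 2 * norm u) + \<epsilon> / 2 * norm v'"
        using elim v(2) by (intro add_mono mult_left_mono) auto
      also have "\<dots> = \<epsilon> / 2 * norm (c *\<^sub>C u) + \<epsilon> / 2 * norm v'" by (simp add: norm_scaleC)
      also have "\<dots> \<le> \<epsilon> / 2 * norm v + \<epsilon> / 2 * norm v"
        using v(3,4) Cons.prems(3) by (intro add_mono mult_left_mono) auto
      finally show "norm (v - D r v) \<le> \<epsilon> * norm v" by simp
    qed
  qed
qed

section \<open>Norm stability of ranges\<close>

lemma zero_mem_Lat: "{0} \<in> Lat T"
  by (simp add: Lat_def closed_csubspace_def scaleC_0 blinfun.zero_right)

text \<open>One inequality per \<epsilon> instead of a sequence of subspaces, a form that passes to
  limits of M. For the converse, \<open>Mn n\<close> is taken within 1 / (n + 1) of the infimum of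
  the distances, which tends to 0.\<close>

lemma norm_stable_iff:
  "norm_stable T M \<longleftrightarrow> (\<forall>Tn. (\<forall>n::nat. Tn n \<in> bounded_ops) \<longrightarrow> (\<lambda>n. norm (Tn n - T)) \<longlonglongrightarrow> 0 \<longrightarrow>
     (\<forall>\<epsilon>>0. \<forall>\<^sub>F n in sequentially. \<exists>N\<in>Lat (Tn n). norm (orth_proj N - orth_proj M) < \<epsilon>))"
proof (intro iffI allI impI)
  fix Tn :: "nat \<Rightarrow> ell2 \<Rightarrow>\<^sub>L ell2" and \<epsilon> :: real
  assume "norm_stable T M" "\<forall>n. Tn n \<in> bounded_ops" "(\<lambda>n. norm (Tn n - T)) \<longlonglongrightarrow> 0" "\<epsilon> > 0"
  then obtain Mn where Mn: "\<And>n. Mn n \<in> Lat (Tn n)" "(\<lambda>n. norm (orth_proj (Mn n) - orth_proj M)) \<longlonglongrightarrow> 0"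
    unfolding norm_stable_def by blast
  have "\<forall>\<^sub>F n in sequentially. norm (orth_proj (Mn n) - orth_proj M) < \<epsilon>"
    by (rule order_tendstoD(2)[OF Mn(2) \<open>\<epsilon> > 0\<close>])
  then show "\<forall>\<^sub>F n in sequentially. \<exists>N\<in>Lat (Tn n). norm (orth_proj N - orth_proj M) < \<epsilon>"
    by eventually_elim (use Mn(1) in blast)
next
  assume *: "\<forall>Tn. (\<forall>n::nat. Tn n \<in> bounded_ops) \<longrightarrow> (\<lambda>n. norm (Tn n - T)) \<longlonglongrightarrow> 0 \<longrightarrow>
     (\<forall>\<epsilon>>0. \<forall>\<^sub>F n in sequentially. \<exists>N\<in>Lat (Tn n). norm (orth_proj N - orth_proj M) < \<epsilon>)"
  show "norm_stable T M"
    unfolding norm_stable_def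
  proof (intro allI impI)
    fix Tn :: "nat \<Rightarrow> ell2 \<Rightarrow>\<^sub>L ell2"
    assume Tn: "\<forall>n. Tn n \<in> bounded_ops" "(\<lambda>n. norm (Tn n - T)) \<longlonglongrightarrow> 0"
    define d where "d n N = norm (orth_proj N - orth_proj M)" for n :: nat and N
    define a where "a n = (INF N\<in>Lat (Tn n). d n N)" for n
    have bdd: "bdd_below (d n ` Lat (Tn n))" for n
      by (rule bdd_belowI2[of _ 0]) (simp add: d_def)
    have ne: "Lat (Tn n) \<noteq> {}" for n using zero_mem_Lat by blast
    have "\<exists>N\<in>Lat (Tn n). d n N < a n + 1 / real (Suc n)" for n
    proof -
      have "(INF N\<in>Lat (Tn n). d n N) < a n + 1 / real (Suc n)" by (simp add: a_def)
      then show ?thesis unfolding cINF_less_iff[OF ne bdd] .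
    qed
    then obtain Mn where Mn: "\<And>n. Mn n \<in> Lat (Tn n)" "\<And>n. d n (Mn n) < a n + 1 / real (Suc n)"
      by metis
    have a0: "a n \<ge> 0" for n unfolding a_def by (intro cINF_greatest ne) (simp add: d_def)
    have "a \<longlonglongrightarrow> 0"
    proof (rule order_tendstoI)
      fix e :: real assume "e < 0"
      then show "\<forall>\<^sub>F n in sequentially. e < a n" using a0 by (intro always_eventually) (metis less_le_trans)
    next
      fix e :: real assume "0 < e"
      then have "\<forall>\<^sub>F n in sequentially. \<exists>N\<in>Lat (Tn n). d n N < e" using * Tn by (simp add: d_def)
      then show "\<forall>\<^sub>F n in sequentially. a n < e"
        by eventually_elim (simp add: a_def cINF_less_iff[OF ne bdd])
    qed
    then have "(\<lambda>n. a n + 1 / real (Suc n)) \<longlonglongrightarrow> 0 + 0"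
      by (intro tendsto_add LIMSEQ_Suc[OF lim_1_over_n])
    then have "(\<lambda>n. a n + 1 / real (Suc n)) \<longlonglongrightarrow> 0" by simp
    then have "(\<lambda>n. d n (Mn n)) \<longlonglongrightarrow> 0"
      by (rule tendsto_sandwich[OF _ _ tendsto_const, rotated 2])
        (use Mn(2) in \<open>auto intro!: always_eventually less_imp_le simp: d_def simp del: of_nat_Suc\<close>)
    then show "\<exists>Mn. (\<forall>n. Mn n \<in> Lat (Tn n)) \<and> (\<lambda>n. norm (orth_proj (Mn n) - orth_proj M)) \<longlonglongrightarrow> 0"
      using Mn(1) by (auto simp: d_def)
  qed
qed

lemma norm_stable_limit:
  assumes "\<And>\<epsilon>. \<epsilon> > 0 \<Longrightarrow> \<exists>M'. norm_stable T M' \<and> norm (orth_proj M' - orth_proj M) < \<epsilon>"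
  shows "norm_stable T M"
  unfolding norm_stable_iff
proof (intro allI impI)
  fix Tn :: "nat \<Rightarrow> ell2 \<Rightarrow>\<^sub>L ell2" and \<epsilon> :: real
  assume Tn: "\<forall>n. Tn n \<in> bounded_ops" "(\<lambda>n. norm (Tn n - T)) \<longlonglongrightarrow> 0" and "\<epsilon> > 0"
  then obtain M' where M': "norm_stable T M'" "norm (orth_proj M' - orth_proj M) < \<epsilon> / 2"
    using assms[of "\<epsilon> / 2"] by auto
  have "\<forall>\<^sub>F n in sequentially. \<exists>N\<in>Lat (Tn n). norm (orth_proj N - orth_proj M') < \<epsilon> / 2"
    using M'(1) Tn \<open>\<epsilon> > 0\<close> unfolding norm_stable_iff by (meson half_gt_zero)
  then show "\<forall>\<^sub>F n in sequentially. \<exists>N\<in>Lat (Tn n). norm (orth_proj N - orth_proj M) < \<epsilon>"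
  proof eventually_elim
    case (elim n)
    then obtain N where N: "N \<in> Lat (Tn n)" "norm (orth_proj N - orth_proj M') < \<epsilon> / 2" by blast
    have "norm (orth_proj N - orth_proj M) < \<epsilon>"
      using norm_diff_triangle_less[OF N(2) M'(2)] by simp
    then show ?case using N(1) by blast
  qed
qed

definition cscale :: "complex \<Rightarrow> ell2 \<Rightarrow>\<^sub>L ell2" where
  "cscale c = Blinfun (\<lambda>x. c *\<^sub>C x)"

lemma cscale_apply [simp]: "cscale c x = c *\<^sub>C x"
  by (simp add: cscale_def bounded_linear_Blinfun_apply[OF bounded_linear_scaleC])

text \<open>A function of T, so that the same product can be formed with the perturbations
  \<open>Tn\<close>.\<close>

primrec linear_factors :: "complex list \<Rightarrow> (ell2 \<Rightarrow>\<^sub>L ell2) \<Rightarrow> ell2 \<Rightarrow>\<^sub>L ell2" where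
  "linear_factors [] T = id_blinfun"
| "linear_factors (c # cs) T = (T - cscale c) o\<^sub>L linear_factors cs T"

lemma bounded_opsD: "T \<in> bounded_ops \<Longrightarrow> T (c *\<^sub>C x) = c *\<^sub>C T x"
  by (simp add: bounded_ops_def)

lemma linear_factors_bounded_ops:
  assumes "T \<in> bounded_ops" shows "linear_factors cs T \<in> bounded_ops"
proof -
  have "linear_factors cs T (c *\<^sub>C x) = c *\<^sub>C linear_factors cs T x" for c x
    by (induction cs) (auto simp: blinfun.diff_left bounded_opsD[OF assms] scaleC_diff_right scaleC_commute)
  then show ?thesis by (simp add: bounded_ops_def)
qed

lemma linear_factors_commute:
  assumes "T \<in> bounded_ops"
  shows "T (linear_factors cs T x) = linear_factors cs T (T x)"
  by (induction cs) (auto simp: blinfun.diff_left blinfun.diff_right bounded_opsD[OF assms])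

lemma tendsto_linear_factors:
  assumes "(Tn \<longlongrightarrow> T) F" shows "((\<lambda>n. linear_factors cs (Tn n)) \<longlongrightarrow> linear_factors cs T) F"
  by (induction cs) (auto intro!: tendsto_intros assms bounded_bilinear.tendsto[OF bounded_bilinear_blinfun_compose])

lemma range_linear_factors_Lat:
  assumes T: "T \<in> bounded_ops" and c: "c > 0" "\<And>x. c * norm x \<le> norm (linear_factors cs T x)"
  shows "range (blinfun_apply (linear_factors cs T)) \<in> Lat T"
proof -
  let ?A = "blinfun_apply (linear_factors cs T)"
  have "closed (range ?A)"
    by (rule closed_image_bounded_below[where c = c]) (use c in \<open>auto intro: blinfun.bounded_linear_right\<close>)
  moreover have "0 \<in> range ?A" using blinfun.zero_right[of "linear_factors cs T"] by (metis rangeI)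
  moreover have "?A x + ?A y \<in> range ?A" for x y
    by (simp add: blinfun.add_right[symmetric])
  moreover have "a *\<^sub>C ?A x \<in> range ?A" for a x
    using bounded_opsD[OF linear_factors_bounded_ops[OF T], of cs a x] by (metis rangeI)
  ultimately show ?thesis
    unfolding Lat_def closed_csubspace_def by (auto simp: linear_factors_commute[OF T])
qed

text \<open>Boundedness below survives small perturbations, so p(Tn) has closed range, invariant
  under Tn. The vectors p(T) x and p(Tn) x differ by at most \<delta> |x|, and the lower bounds turn
  |x| into a multiple of the norm of either image.\<close>

lemma norm_stable_range_linear_factors:
  assumes T: "T \<in> bounded_ops" and c: "c > 0" "\<And>x. c * norm x \<le> norm (linear_factors cs T x)"
  shows "norm_stable T (range (blinfun_apply (linear_factors cs T)))"
  unfolding norm_stable_iff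
proof (intro allI impI)
  fix Tn :: "nat \<Rightarrow> ell2 \<Rightarrow>\<^sub>L ell2" and \<epsilon> :: real
  assume Tn: "\<forall>n. Tn n \<in> bounded_ops" "(\<lambda>n. norm (Tn n - T)) \<longlonglongrightarrow> 0" and \<epsilon>: "\<epsilon> > 0"
  let ?A = "linear_factors cs T" and ?An = "\<lambda>n. linear_factors cs (Tn n)"
  let ?R = "range (blinfun_apply ?A)" and ?Rn = "\<lambda>n. range (blinfun_apply (?An n))"
  \<comment> \<open>The first entry keeps p(Tn) bounded below by c / 2; the second then makes each
    gap \<epsilon> / 4, which \<open>orth_proj_gap\<close> doubles.\<close>
  define \<delta> where "\<delta> = min (c / 2) (c * \<epsilon> / 8)"
  have \<delta>: "\<delta> > 0" using c(1) \<epsilon> by (simp add: \<delta>_def)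
  have "Tn \<longlonglongrightarrow> T" using Tn(2) by (simp add: tendsto_norm_zero_iff LIM_zero_iff)
  then have "?An \<longlonglongrightarrow> ?A" by (rule tendsto_linear_factors)
  then have "\<forall>\<^sub>F n in sequentially. dist (?An n) ?A < \<delta>" using \<delta> by (rule tendstoD)
  then show "\<forall>\<^sub>F n in sequentially. \<exists>N\<in>Lat (Tn n). norm (orth_proj N - orth_proj ?R) < \<epsilon>"
  proof eventually_elim
    case (elim n)
    have close: "norm (?An n x - ?A x) \<le> \<delta> * norm x" for x
    proof -
      have "norm ((?An n - ?A) x) \<le> norm (?An n - ?A) * norm x" by (rule norm_blinfun)
      also have "\<dots> \<le> \<delta> * norm x" using elim by (intro mult_right_mono) (auto simp: dist_norm)
      finally show ?thesis by (simp add: blinfun.diff_left)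
    qed
    have below: "c / 2 * norm x \<le> norm (?An n x)" for x
    proof -
      have "norm (?A x) \<le> norm (?An n x) + \<delta> * norm x"
        using close[of x] norm_triangle_sub[of "?A x" "?An n x"]
        by (simp add: norm_minus_commute)
      moreover have "\<delta> * norm x \<le> c / 2 * norm x" by (intro mult_right_mono) (auto simp: \<delta>_def)
      ultimately show ?thesis using c(2)[of x] by (simp add: field_simps)
    qed
    have small: "\<delta> * norm x \<le> (\<epsilon> / 4) * y" if "c / 2 * norm x \<le> y" for x :: ell2 and y
    proof -
      have "\<delta> * norm x \<le> (c * \<epsilon> / 8) * norm x" by (intro mult_right_mono) (auto simp: \<delta>_def)
      also have "\<dots> = (\<epsilon> / 4) * (c / 2 * norm x)" by simp
      also have "\<dots> \<le> (\<epsilon> / 4) * y" using \<epsilon> that by (intro mult_left_mono) auto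
      finally show ?thesis .
    qed
    have Lat1: "?Rn n \<in> Lat (Tn n)"
      using range_linear_factors_Lat[of "Tn n" "c / 2" cs] Tn(1) c(1) below by simp
    have Lat2: "?R \<in> Lat T" by (rule range_linear_factors_Lat[OF T c])
    have "norm (orth_proj (?Rn n) - orth_proj ?R) \<le> 2 * (\<epsilon> / 4)"
    proof (rule orth_proj_gap)
      show "closed_csubspace (?Rn n)" "closed_csubspace ?R"
        using Lat1 Lat2 by (auto simp: Lat_def)
      fix y assume "y \<in> ?Rn n"
      then obtain x where x: "y = ?An n x" by blast
      have "norm (y - ?A x) \<le> \<epsilon> / 4 * norm y"
        unfolding x using close[of x] small[OF below] by (rule order_trans)
      then show "\<exists>z\<in>?R. norm (y - z) \<le> \<epsilon> / 4 * norm y" by blast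
    next
      fix y assume "y \<in> ?R"
      then obtain x where x: "y = ?A x" by blast
      have "c / 2 * norm x \<le> c * norm x" using c(1) by simp
      then have "c / 2 * norm x \<le> norm y" using c(2)[of x] x by simp
      then have "norm (y - ?An n x) \<le> \<epsilon> / 4 * norm y"
        unfolding x using close[of x] small by (metis norm_minus_commute order_trans)
      then show "\<exists>z\<in>?Rn n. norm (y - z) \<le> \<epsilon> / 4 * norm y" by blast
    qed (use \<epsilon> in simp)
    then have "norm (orth_proj (?Rn n) - orth_proj ?R) < \<epsilon>"
      using \<epsilon> by simp
    then show ?case using Lat1 by blast
  qed
qed

lemma norm_stable_zero: "norm_stable T {0}"
  unfolding norm_stable_iff using zero_mem_Lat by (intro allI impI always_eventually) (auto intro!: bexI[of _ "{0}"])

lemma complex_poly_splits: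
  fixes q :: "complex poly"
  assumes "q \<noteq> 0"
  obtains c cs where "c \<noteq> 0" "q = smult c (\<Prod>z\<leftarrow>cs. [:- z, 1:])" "length cs = degree q"
proof -
  obtain A where A: "size A = degree q" "q = smult (lead_coeff q) (\<Prod>z\<in>#A. [:- z, 1:])"
    using alg_closed_imp_factorization[OF assms] by blast
  obtain cs where cs: "mset cs = A" using ex_mset by blast
  have "(\<Prod>z\<in>#A. [:- z, 1:]) = (\<Prod>z\<leftarrow>cs. [:- z, 1:])"
    unfolding cs[symmetric] mset_map[symmetric] by (rule prod_mset_prod_list)
  then show ?thesis using that[of "lead_coeff q" cs] A assms cs by auto
qed

lemma degree_prod_linear: "degree (\<Prod>z\<leftarrow>cs. [:- z, 1:]) = length cs" for cs :: "complex list"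
proof (induction cs)
  case (Cons z cs)
  have "(\<Prod>z\<leftarrow>cs. [:- z, 1:]) \<noteq> 0" by (auto simp: prod_list_zero_iff)
  then have "degree ([:- z, 1:] * (\<Prod>z\<leftarrow>cs. [:- z, 1:])) = Suc (length cs)"
    using Cons by (subst degree_mult_eq) auto
  then show ?case by (simp del: mult_pCons_left)
qed simp

lemma poly_prod_linear_root: "w \<in> set cs \<Longrightarrow> poly (\<Prod>z\<leftarrow>cs. [:- z, 1:]) w = 0" for cs :: "complex list"
  by (induction cs) auto

text \<open>In terms of power series, \<open>dilation r\<close> is the map \<open>f(z) \<mapsto> f(r z)\<close>.\<close>

definition dilation :: "real \<Rightarrow> ell2 \<Rightarrow> ell2" where
  "dilation r x = Abs_ell2 (\<lambda>n. of_real (r ^ n) * coord x n)"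

context
  fixes r :: real assumes r: "0 < r" "r < 1"
begin

lemma norm_coord_dilation_le: "(norm (of_real (r ^ n) * coord x n))\<^sup>2 \<le> (norm (coord x n))\<^sup>2"
  using r power_le_one[of r n] by (intro power_mono) (auto simp: norm_mult norm_power mult_left_le_one_le)

lemma coord_dilation [simp]: "coord (dilation r x) n = of_real (r ^ n) * coord x n"
proof -
  have "summable (\<lambda>n. (norm (of_real (r ^ n) * coord x n))\<^sup>2)"
    by (rule summable_comparison_test'[OF summable_coord[of x]]) (use norm_coord_dilation_le in auto)
  then show ?thesis unfolding dilation_def by (subst Abs_ell2_inverse) auto
qed

lemma norm_dilation_le: "norm (dilation r x) \<le> norm x"
  unfolding norm_ell2
  by (intro real_sqrt_le_mono suminf_le summable_coord)
    (simp only: coord_dilation norm_coord_dilation_le)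

lemma bounded_linear_dilation: "bounded_linear (dilation r)"
  by (rule bounded_linear_intro[where K = 1])
    (auto intro!: ell2_eqI simp: norm_dilation_le algebra_simps)

lemma dilation_add: "dilation r (x + y) = dilation r x + dilation r y"
  and dilation_diff: "dilation r (x - y) = dilation r x - dilation r y"
  and dilation_scaleC: "dilation r (c *\<^sub>C x) = c *\<^sub>C dilation r x"
  and dilation_0: "dilation r 0 = 0"
  by (auto intro!: ell2_eqI simp: algebra_simps)

text \<open>Self-adjointness, by which preimages of subspaces under dilation become complements of
  images.\<close>

lemma cinner_dilation: "cinner (dilation r x) y = cinner x (dilation r y)"
  unfolding cinner_def by (intro suminf_cong) (simp add: mult_ac)

end

lemma tendsto_dilation: "((\<lambda>r. dilation r x) \<longlongrightarrow> x) (at_left 1)"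
proof (rule tendstoI)
  fix e :: real assume e: "e > 0"
  have "\<forall>\<^sub>F K in sequentially. dist (\<Sum>k<K. coord x k *\<^sub>C basis_vec k) x < e / 3"
    using e by (intro tendstoD basis_expansion) auto
  then obtain K where K: "dist (\<Sum>k<K. coord x k *\<^sub>C basis_vec k) x < e / 3"
    by (auto simp: eventually_at_top_linorder)
  define p where "p = (\<Sum>k<K. coord x k *\<^sub>C basis_vec k)"
  have "((\<lambda>r. (\<Sum>k<K. r ^ k *\<^sub>R coord x k *\<^sub>C basis_vec k)) \<longlongrightarrow> (\<Sum>k<K. 1 ^ k *\<^sub>R coord x k *\<^sub>C basis_vec k)) (at_left (1::real))"
    by (intro tendsto_intros)
  then have "\<forall>\<^sub>F r in at_left (1::real). dist (\<Sum>k<K. r ^ k *\<^sub>R coord x k *\<^sub>C basis_vec k) p < e / 3"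
    unfolding p_def using e by (intro tendstoD) auto
  moreover have "\<forall>\<^sub>F r in at_left (1::real). 0 < r \<and> r < 1"
    using eventually_at_left_real[of 0 "1::real"] by (auto elim!: eventually_mono)
  ultimately show "\<forall>\<^sub>F r in at_left 1. dist (dilation r x) x < e"
  proof eventually_elim
    case (elim r)
    then have r: "0 < r" "r < 1" by auto
    have "dilation r p = (\<Sum>k<K. r ^ k *\<^sub>R coord x k *\<^sub>C basis_vec k)"
    proof (rule ell2_eqI)
      fix n
      show "coord (dilation r p) n = coord (\<Sum>k<K. r ^ k *\<^sub>R coord x k *\<^sub>C basis_vec k) n"
        by (simp add: p_def coord_dilation[OF r] coord_sum if_distrib[of "\<lambda>t. _ * t"] cong: if_cong)
    qed
    then have 1: "dist (dilation r p) p < e / 3" using elim by simp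
    have "dist (dilation r x) (dilation r p) \<le> dist x p"
      using norm_dilation_le[OF r, of "x - p"] by (simp add: dist_norm dilation_diff[OF r])
    then have 2: "dist (dilation r x) (dilation r p) < e / 3" using K by (simp add: p_def dist_commute)
    have "dist (dilation r x) x \<le> dist (dilation r x) (dilation r p) + (dist (dilation r p) p + dist p x)"
      using dist_triangle[of "dilation r x" x "dilation r p"] dist_triangle[of "dilation r p" x p] by linarith
    then show ?case using 1 2 K by (simp add: p_def)
  qed
qed

section \<open>Polynomials in the weighted shift and their dilates\<close>

context smooth_weight begin

abbreviation "T \<equiv> weighted_shift \<omega>"

text \<open>\<omega> is increasing up to a constant factor. That the constant does not depend on n
  is essential for \<open>weighted_shift_minus_below\<close>.\<close>

lemma weighted_shift_power_below:
  obtains C where "C > 0" "\<And>n x. norm x \<le> C * norm ((blinfun_apply T ^^ n) x)"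
proof -
  obtain C where C: "C > 0" "\<And>m n. m \<le> n \<Longrightarrow> wt 0 m \<le> C * wt 0 n" using wt_almost_mono by blast
  have fps: "fps_of_ell2 ((blinfun_apply T ^^ n) x) = fps_X ^ n * fps_of_ell2 x" for n x
    by (induction n) (auto simp: fps_of_weighted_shift mult_ac)
  have "norm x \<le> C * norm ((blinfun_apply T ^^ n) x)" for n x
  proof -
    define y where "y = (blinfun_apply T ^^ n) x"
    have coord_y: "coord x m = of_real (\<omega> m / \<omega> (m + n)) * coord y (m + n)" for m
    proof -
      have "fps_nth (fps_of_ell2 y) (m + n) = fps_nth (fps_of_ell2 x) m"
        by (simp add: y_def fps fps_X_power_mult_nth)
      then show ?thesis by (simp add: fps_of_ell2_def field_simps)
    qed
    have le: "(norm (coord x m))\<^sup>2 \<le> C\<^sup>2 * (norm (coord y (m + n)))\<^sup>2" for m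
    proof -
      have "norm (coord x m) = (\<omega> m / \<omega> (m + n)) * norm (coord y (m + n))"
        unfolding coord_y[of m] norm_mult norm_of_real by (simp add: abs_of_pos)
      also have "\<dots> \<le> C * norm (coord y (m + n))"
        using C(2)[of m "m + n"] by (intro mult_right_mono) (auto simp: wt_0 divide_le_eq)
      finally have "(norm (coord x m))\<^sup>2 \<le> (C * norm (coord y (m + n)))\<^sup>2" by (rule power_mono) simp
      then show ?thesis by (simp add: power_mult_distrib)
    qed
    have s: "summable (\<lambda>m. (norm (coord y (m + n)))\<^sup>2)"
      by (rule summable_ignore_initial_segment[OF summable_coord])
    have "(norm x)\<^sup>2 \<le> (\<Sum>m. C\<^sup>2 * (norm (coord y (m + n)))\<^sup>2)"
      unfolding power2_norm_ell2 by (intro suminf_le le summable_coord summable_mult s)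
    also have "\<dots> = C\<^sup>2 * (\<Sum>m. (norm (coord y (m + n)))\<^sup>2)" by (rule suminf_mult[OF s])
    also have "\<dots> \<le> C\<^sup>2 * (norm y)\<^sup>2"
      unfolding power2_norm_ell2 suminf_split_initial_segment[OF summable_coord[of y], of n]
      by (intro mult_left_mono) (auto intro: sum_nonneg)
    finally have "(norm x)\<^sup>2 \<le> (C * norm y)\<^sup>2" by (simp add: power_mult_distrib)
    then show ?thesis unfolding y_def by (rule power2_le_imp_le) (use C(1) in simp)
  qed
  then show ?thesis using that C(1) by blast
qed

text \<open>T^n - \<mu>^n has the factor T - \<mu>, so its norm at x is at most a multiple of that
  of (T - \<mu>) x. Once C |\<mu>|^n < 1 / 2, the uniform lower bound for T^n absorbs \<mu>^n
  x.\<close>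

lemma weighted_shift_minus_below:
  assumes "norm \<mu> < 1"
  obtains c where "c > 0" "\<And>x. c * norm x \<le> norm ((T - cscale \<mu>) x)"
proof -
  define d where "d x = norm ((T - cscale \<mu>) x)" for x
  define e where "e n x = (blinfun_apply T ^^ n) x - \<mu> ^ n *\<^sub>C x" for n x
  obtain C where C: "C > 0" "\<And>n x. norm x \<le> C * norm ((blinfun_apply T ^^ n) x)"
    using weighted_shift_power_below by blast
  have lip: "\<exists>L\<ge>0. \<forall>x. norm (e n x) \<le> L * d x" for n
  proof (induction n)
    case 0
    then show ?case by (intro exI[of _ 0]) (auto simp: e_def d_def scaleC_1)
  next
    case (Suc n)
    then obtain L where L: "L \<ge> 0" "\<And>x. norm (e n x) \<le> L * d x"
      by blast
    have "norm (e (Suc n) x) \<le> (norm T * L + norm (\<mu> ^ n)) * d x" for x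
    proof -
      have "e (Suc n) x
          = T (e n x) + \<mu> ^ n *\<^sub>C (T - cscale \<mu>) x"
        by (simp add: e_def blinfun.diff_left blinfun.diff_right bounded_opsD[OF weighted_shift_bounded_op]
            scaleC_diff_right scaleC_assoc mult_ac)
      then have "norm (e (Suc n) x)
          \<le> norm T * norm (e n x) + norm (\<mu> ^ n) * d x"
        unfolding d_def by (metis norm_triangle_le add_mono norm_blinfun norm_scaleC order_refl)
      also have "\<dots> \<le> norm T * (L * d x) + norm (\<mu> ^ n) * d x"
        by (intro add_mono mult_left_mono L(2)) (auto simp: d_def)
      finally show ?thesis by (simp add: algebra_simps)
    qed
    then show ?case using L(1) by (intro exI[of _ "norm T * L + norm (\<mu> ^ n)"]) auto
  qed
  have "(\<lambda>n. C * norm \<mu> ^ n) \<longlonglongrightarrow> C * 0"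
    using assms by (intro tendsto_intros LIMSEQ_realpow_zero) auto
  then have "\<forall>\<^sub>F n in sequentially. C * norm \<mu> ^ n < 1 / 2" by (intro order_tendstoD(2)) auto
  then obtain n where n: "C * norm \<mu> ^ n < 1 / 2" by (auto simp: eventually_at_top_linorder)
  obtain L where L: "L \<ge> 0" "\<And>x. norm (e n x) \<le> L * d x"
    using lip by blast
  define k where "k = 2 * C * L + 1"
  have k: "k > 0" unfolding k_def using C(1) L(1) by (intro add_nonneg_pos mult_nonneg_nonneg) auto
  have "1 / k * norm x \<le> d x" for x
  proof -
    have "norm ((blinfun_apply T ^^ n) x) \<le> L * d x + norm \<mu> ^ n * norm x"
      using L(2)[of x] norm_triangle_sub[of "(blinfun_apply T ^^ n) x" "\<mu> ^ n *\<^sub>C x"]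
      by (simp add: e_def norm_scaleC norm_power)
    then have "C * norm ((blinfun_apply T ^^ n) x) \<le> C * (L * d x + norm \<mu> ^ n * norm x)"
      using C(1) by (intro mult_left_mono) auto
    then have "norm x \<le> C * L * d x + (C * norm \<mu> ^ n) * norm x"
      using C(2)[of x n] by (simp add: algebra_simps)
    moreover have "(C * norm \<mu> ^ n) * norm x \<le> 1 / 2 * norm x" using n by (intro mult_right_mono) auto
    ultimately have "norm x \<le> 2 * C * L * d x" by simp
    also have "\<dots> \<le> k * d x" by (simp add: k_def d_def algebra_simps)
    finally show ?thesis using k by (simp add: pos_divide_le_eq mult.commute)
  qed
  moreover have "1 / k > 0" using k by simp
  ultimately show ?thesis using that unfolding d_def by blast
qed

lemma linear_factors_below:
  assumes "\<And>\<mu>. \<mu> \<in> set cs \<Longrightarrow> norm \<mu> < 1"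
  shows "\<exists>c>0. \<forall>x. c * norm x \<le> norm (linear_factors cs T x)"
  using assms
proof (induction cs)
  case (Cons \<mu> cs)
  then obtain c where c: "c > 0" "\<And>x. c * norm x \<le> norm (linear_factors cs T x)" by auto
  obtain d where d: "d > 0" "\<And>x. d * norm x \<le> norm ((T - cscale \<mu>) x)"
    using weighted_shift_minus_below Cons.prems by (metis list.set_intros(1))
  have "d * c * norm x \<le> norm (blinfun_apply (linear_factors (\<mu> # cs) T) x)" for x
  proof -
    have "d * (c * norm x) \<le> d * norm (linear_factors cs T x)"
      using c d by (intro mult_left_mono) auto
    also have "\<dots> \<le> norm (blinfun_apply (linear_factors (\<mu> # cs) T) x)" using d(2) by simp
    finally show ?thesis by simp
  qed
  then show ?case using c d by (intro exI[of _ "d * c"]) auto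
qed (auto intro: exI[of _ 1])

lemma fps_of_linear_factors:
  "fps_of_ell2 (linear_factors cs T x) = fps_of_poly (\<Prod>z\<leftarrow>cs. [:- z, 1:]) * fps_of_ell2 x"
proof (induction cs)
  case (Cons c cs)
  then show ?case
    by (simp add: blinfun.diff_left fps_of_ell2_diff fps_of_ell2_scaleC fps_of_weighted_shift
        fps_of_poly_mult fps_linear_eq_poly[symmetric] algebra_simps
        del: mult_pCons_left fps_of_poly_pCons)
qed simp

lemma fps_of_dilation:
  assumes "0 < r" "r < 1"
  shows "fps_nth (fps_of_ell2 (dilation r x)) n = of_real r ^ n * fps_nth (fps_of_ell2 x) n"
  by (simp add: fps_of_ell2_def coord_dilation[OF assms])

lemma dilation_weighted_shift:
  assumes r: "0 < r" "r < 1"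
  shows "dilation r (T x) = of_real r *\<^sub>C T (dilation r x)"
proof -
  have "fps_of_ell2 (dilation r (T x)) = fps_of_ell2 (of_real r *\<^sub>C T (dilation r x))"
  proof (rule fps_ext)
    fix n
    show "fps_nth (fps_of_ell2 (dilation r (T x))) n = fps_nth (fps_of_ell2 (of_real r *\<^sub>C T (dilation r x))) n"
      by (cases n) (simp_all add: fps_of_dilation[OF r] fps_of_weighted_shift fps_of_ell2_scaleC)
  qed
  then show ?thesis by (simp add: fps_of_ell2_inject)
qed

text \<open>Dilation after T is r T after dilation. So dilation carries the range of the operator
  with zeros r z into the range of the one with zeros z.\<close>

lemma dilation_linear_factors:
  assumes r: "0 < r" "r < 1"
  shows "dilation r (blinfun_apply (linear_factors (map (\<lambda>c. of_real r * c) cs) T) x)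
    = of_real r ^ length cs *\<^sub>C linear_factors cs T (dilation r x)"
proof (induction cs)
  case (Cons c cs)
  then show ?case
    by (simp add: blinfun.diff_left dilation_diff[OF r] dilation_weighted_shift[OF r] dilation_scaleC[OF r]
        bounded_opsD[OF weighted_shift_bounded_op] scaleC_assoc scaleC_diff_right mult_ac)
qed (simp add: scaleC_1)

definition poly_vec :: "complex poly \<Rightarrow> ell2" where
  "poly_vec p = ell2_of_fps (fps_of_poly p)"

lemma fps_of_poly_vec [simp]: "fps_of_ell2 (poly_vec p) = fps_of_poly p"
  unfolding poly_vec_def by (rule fps_of_ell2_of_fps[OF E_poly])

lemma poly_vec_eqI: "fps_of_ell2 x = fps_of_poly p \<Longrightarrow> x = poly_vec p"
  by (simp flip: fps_of_ell2_inject)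

lemma poly_vec_0: "poly_vec 0 = 0"
  by (simp flip: fps_of_ell2_inject add: fps_of_ell2_0)

lemma poly_vec_diff: "poly_vec (p - q) = poly_vec p - poly_vec q"
  and poly_vec_smult: "poly_vec (smult c p) = c *\<^sub>C poly_vec p"
  by (simp_all flip: fps_of_ell2_inject
      add: fps_of_ell2_diff fps_of_ell2_scaleC fps_of_poly_diff fps_of_poly_smult)

lemma basis_vec_eq_poly_vec: "basis_vec k = poly_vec (monom (1 / of_real (\<omega> k)) k)"
  by (rule poly_vec_eqI) (auto simp: fps_eq_iff fps_of_ell2_def)

lemma poly_vec_in_span:
  assumes N: "closed_csubspace N" and b: "\<And>k. k < d \<Longrightarrow> basis_vec k \<in> N" and p: "\<And>k. k \<ge> d \<Longrightarrow> coeff p k = 0"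
  shows "poly_vec p \<in> N"
proof -
  have mem: "(\<Sum>k<K. c k *\<^sub>C basis_vec k) \<in> N" if "K \<le> d" for K c
    using that by (induction K) (use closed_csubspaceD[OF N] b in auto)
  have "poly_vec p = (\<Sum>k<d. (of_real (\<omega> k) * coeff p k) *\<^sub>C basis_vec k)"
  proof (rule ell2_eqI)
    fix n
    show "coord (poly_vec p) n = coord (\<Sum>k<d. (of_real (\<omega> k) * coeff p k) *\<^sub>C basis_vec k) n"
      using p[of n] by (simp add: poly_vec_def coord_ell2_of_fps[OF E_poly] coord_sum
          if_distrib[of "\<lambda>t. _ * t"] cong: if_cong)
  qed
  then show ?thesis using mem by simp
qed

lemma poly_vec_dense:
  assumes N: "closed_csubspace N" and p: "\<And>p. poly_vec p \<in> N"
  shows "N = UNIV"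
proof -
  have "x \<in> N" for x
  proof (rule closed_sequentially[OF closed_csubspaceD(1)[OF N] _ basis_expansion])
    fix K
    show "(\<Sum>k<K. coord x k *\<^sub>C basis_vec k) \<in> N"
      by (induction K) (use closed_csubspaceD[OF N] p in \<open>auto simp: basis_vec_eq_poly_vec\<close>)
  qed
  then show ?thesis by blast
qed

text \<open>By division with remainder, polynomials modulo multiples of q are spanned by the first
  \<open>degree q\<close> basis vectors; polynomials are dense.\<close>

lemma add_lines_basis_UNIV:
  assumes N: "closed_csubspace N" and q: "q \<noteq> 0" and mult: "\<And>s. poly_vec (q * s) \<in> N"
  shows "add_lines N (map basis_vec [0..<degree q]) = UNIV"
proof (rule poly_vec_dense)
  let ?L = "add_lines N (map basis_vec [0..<degree q])"
  show L: "closed_csubspace ?L" by (rule closed_csubspace_add_lines[OF N])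
  fix p
  have "poly_vec (p mod q) \<in> ?L"
  proof (rule poly_vec_in_span[OF L])
    show "basis_vec k \<in> ?L" if "k < degree q" for k
      using that closed_csubspaceD(2)[OF N] by (intro mem_add_lines) auto
    show "coeff (p mod q) k = 0" if "k \<ge> degree q" for k
      using that degree_mod_less[OF q, of p] coeff_eq_0[of "p mod q" k] by auto
  qed
  moreover have "poly_vec (q * (p div q)) \<in> ?L" using mult subset_add_lines by blast
  moreover have "poly_vec p - poly_vec (p mod q) = poly_vec (q * (p div q))"
    unfolding poly_vec_diff[symmetric] by (simp add: minus_mod_eq_mult_div)
  then have "poly_vec p = poly_vec (q * (p div q)) + poly_vec (p mod q)" by (simp add: algebra_simps)
  ultimately show "poly_vec p \<in> ?L" using closed_csubspaceD(3)[OF L] by simp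
qed

lemma Lat_poly_mult:
  assumes M: "M \<in> Lat T" and q: "poly_vec q \<in> M" and x: "fps_of_ell2 x = fps_of_poly q * fps_of_ell2 y"
  shows "x \<in> M"
proof -
  have "ell2_of_fps (fps_of_ell2 y * fps_of_ell2 (poly_vec q)) \<in> M"
    by (rule Lat_mult_closed[OF M q fps_of_ell2_E])
  then show ?thesis using x ell2_of_fps_of_ell2[of x] by (simp add: mult.commute)
qed

end

context quasianalytic_weight begin

text \<open>The dilates of \<open>M\<close> are ranges of operators \<open>p(T)\<close> that are bounded below, as the zeros of \<open>p\<close>
  have been moved into the open disc.\<close>

theorem Lat_norm_stable:
  assumes M: "M \<in> Lat T"
  shows "norm_stable T M"
proof (cases "M = {0}")
  case True
  then show ?thesis using norm_stable_zero by simp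
next
  case False
  have Mc: "closed_csubspace M" using M by (simp add: Lat_def)
  obtain q0 where q0: "q0 \<noteq> 0" "\<And>z. poly q0 z = 0 \<Longrightarrow> norm z \<le> 1" "poly_vec q0 \<in> M"
    using Lat_contains_polynomial[OF M False] by (metis poly_vec_def)
  \<comment> \<open>Minimality makes q divide q0, which places its roots in the closed disc. It is
    used again in \<open>range_A\<close>, where a polynomial in M of smaller degree must
    vanish.\<close>
  obtain q where q: "q \<noteq> 0" "poly_vec q \<in> M"
    and q_min: "\<And>p. p \<noteq> 0 \<Longrightarrow> poly_vec p \<in> M \<Longrightarrow> degree q \<le> degree p"
    using ex_has_least_nat[of "\<lambda>q. q \<noteq> 0 \<and> poly_vec q \<in> M" q0 degree] q0 by blast
  have mult: "poly_vec (q * s) \<in> M" for s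
    by (rule Lat_poly_mult[OF M q(2), of _ "poly_vec s"]) (simp add: fps_of_poly_mult)
  have "poly_vec (q0 mod q) = poly_vec q0 - poly_vec (q * (q0 div q))"
    unfolding poly_vec_diff[symmetric] by (simp add: minus_mult_div_eq_mod)
  then have "poly_vec (q0 mod q) \<in> M" using closed_csubspaceD(5)[OF Mc q0(3) mult] by simp
  then have "q0 mod q = 0" using q_min[of "q0 mod q"] degree_mod_less[OF q(1), of q0] by linarith
  then have "q dvd q0" by (simp add: mod_eq_0_iff_dvd)
  then have root: "norm z \<le> 1" if "poly q z = 0" for z
    using that q0(2) by (metis dvd_trans poly_eq_0_iff_dvd)
  obtain a cs where cs: "a \<noteq> 0" "q = smult a (\<Prod>z\<leftarrow>cs. [:- z, 1:])" "length cs = degree q"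
    using complex_poly_splits[OF q(1)] by blast
  have cs_root: "norm z \<le> 1" if "z \<in> set cs" for z
    using poly_prod_linear_root[OF that] by (intro root) (simp add: cs(2))
  define V where "V = ocomp M"
  have V: "closed_csubspace V" "ocomp V = M"
    by (simp_all add: V_def closed_csubspace_ocomp ocomp_ocomp[OF Mc])
  \<comment> \<open>\<open>strong_limit_uniform_on_ocomp\<close> asks for linearity at every
    parameter, while \<open>dilation\<close> is controlled for 0 < r < 1; elsewhere an arbitrary
    admissible value is taken.\<close>
  define D where "D r = dilation (if 0 < r \<and> r < 1 then r else 1 / 2)" for r
  have unit: "\<forall>\<^sub>F r in at_left (1::real). 0 < r \<and> r < 1"
    using eventually_at_left_real[of 0 "1::real"] by (auto elim!: eventually_mono)
  have uniform: "\<forall>\<^sub>F r in at_left 1. \<forall>v\<in>V. norm (v - D r v) \<le> \<delta> * norm v" if "\<delta> > 0" for \<delta>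
    unfolding V_def
  proof (rule strong_limit_uniform_on_ocomp[OF Mc add_lines_basis_UNIV[OF Mc q(1) mult] _ _ _ that])
    show "D r (x + y) = D r x + D r y" for r x y by (simp add: D_def dilation_add)
    show "D r (c *\<^sub>C x) = c *\<^sub>C D r x" for r c x by (simp add: D_def dilation_scaleC)
    show "((\<lambda>r. D r x) \<longlongrightarrow> x) (at_left 1)" for x
      using unit by (intro Lim_transform_eventually[OF tendsto_dilation]) (auto simp: D_def elim!: eventually_mono)
  qed
  show ?thesis
  proof (rule norm_stable_limit)
    fix \<epsilon> :: real assume \<epsilon>: "\<epsilon> > 0"
    \<comment> \<open>1 / 2 makes \<open>dilation r\<close> bounded below by 1 / 2 on V; \<epsilon>
      / 8 keeps the final gap 2 * (2 \<delta>) below \<epsilon>.\<close>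
    define \<delta> where "\<delta> = min (1 / 2) (\<epsilon> / 8)"
    have \<delta>: "\<delta> > 0" "\<delta> \<le> 1 / 2" "4 * \<delta> < \<epsilon>" using \<epsilon> by (auto simp: \<delta>_def min_def)
    have "\<forall>\<^sub>F r in at_left 1. (0 < r \<and> r < 1) \<and> (\<forall>v\<in>V. norm (v - D r v) \<le> \<delta> * norm v)"
      by (intro eventually_conj unit uniform \<delta>)
    then obtain r where "0 < r \<and> r < 1" and Dr: "\<forall>v\<in>V. norm (v - D r v) \<le> \<delta> * norm v"
      using eventually_happens'[OF trivial_limit_at_left_real] by blast
    then have r: "0 < r" "r < 1" and close: "\<And>v. v \<in> V \<Longrightarrow> norm (v - dilation r v) \<le> \<delta> * norm v"
      by (auto simp: D_def)
    define rs where "rs = map (\<lambda>z. of_real r * z) cs"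
    define A where "A = blinfun_apply (linear_factors rs T)"
    have "norm \<mu> < 1" if \<mu>: "\<mu> \<in> set rs" for \<mu>
    proof -
      obtain z where z: "\<mu> = of_real r * z" "z \<in> set cs" using \<mu> by (auto simp: rs_def)
      have "norm \<mu> = r * norm z" using r by (simp add: z(1) norm_mult)
      also have "\<dots> \<le> r * 1" using cs_root[OF z(2)] r by (intro mult_left_mono) auto
      finally show ?thesis using r by simp
    qed
    then obtain c where c: "c > 0" "\<And>x. c * norm x \<le> norm (linear_factors rs T x)"
      using linear_factors_below by blast
    have stable: "norm_stable T (range A)" and lat: "range A \<in> Lat T"
      unfolding A_def
      by (rule norm_stable_range_linear_factors[OF weighted_shift_bounded_op c]
          range_linear_factors_Lat[OF weighted_shift_bounded_op c])+
    have Ac: "closed_csubspace (range A)" using lat by (simp add: Lat_def)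
    have sub: "dilation r (A x) \<in> M" for x
    proof -
      let ?y = "linear_factors cs T (dilation r x)"
      have "a *\<^sub>C ?y \<in> M"
        by (rule Lat_poly_mult[OF M q(2), of _ "dilation r x"])
          (simp add: cs(2) fps_of_ell2_scaleC fps_of_linear_factors fps_of_poly_smult mult.assoc)
      then have "(of_real r ^ length cs / a) *\<^sub>C a *\<^sub>C ?y \<in> M" by (rule closed_csubspaceD(4)[OF Mc])
      then show ?thesis using cs(1) by (simp add: A_def rs_def dilation_linear_factors[OF r] scaleC_assoc)
    qed
    \<comment> \<open>For the harder inclusion x is reduced modulo \<open>range A\<close> to a
      polynomial of degree below \<open>degree q\<close>. Its dilate lies in M, hence is 0 by
      minimality of q, and so is the polynomial.\<close>
    have range_A: "range A = {x. dilation r x \<in> M}"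
    proof safe
      fix x assume x: "dilation r x \<in> M"
      define qr where "qr = (\<Prod>z\<leftarrow>rs. [:- z, 1:])"
      have qr: "qr \<noteq> 0" "degree qr = degree q"
        using degree_prod_linear[of rs] cs(3) by (auto simp: qr_def rs_def prod_list_zero_iff)
      have "poly_vec (qr * s) \<in> range A" for s
      proof -
        have "A (poly_vec s) = poly_vec (qr * s)"
          by (rule poly_vec_eqI) (simp add: A_def fps_of_linear_factors qr_def fps_of_poly_mult)
        then show ?thesis by (metis rangeI)
      qed
      then have U: "add_lines (range A) (map basis_vec [0..<degree q]) = UNIV"
        using add_lines_basis_UNIV[OF Ac qr(1)] qr(2) by simp
      define S where "S = {n + poly_vec p | n p. n \<in> range A \<and> (\<forall>k\<ge>degree q. coeff p k = 0)}"
      have "add_lines (range A) (map basis_vec [0..<degree q]) \<subseteq> S"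
      proof (rule add_lines_subset)
        show "range A \<subseteq> S"
        proof
          fix n assume "n \<in> range A"
          moreover have "n = n + poly_vec 0" by (simp add: poly_vec_0)
          moreover have "\<forall>k\<ge>degree q. coeff (0 :: complex poly) k = 0" by simp
          ultimately show "n \<in> S" unfolding S_def by blast
        qed
        fix y b e assume y: "y \<in> S" and e: "e \<in> set (map basis_vec [0..<degree q])"
        obtain n p where np: "y = n + poly_vec p" "n \<in> range A" "\<And>k. k \<ge> degree q \<Longrightarrow> coeff p k = 0"
          using y by (auto simp: S_def)
        obtain i where i: "i < degree q" "e = basis_vec i" using e by auto
        define p' where "p' = p - smult (- b) (monom (1 / of_real (\<omega> i)) i)"
        have "y + b *\<^sub>C e = n + poly_vec p'"
          unfolding np(1) i(2) p'_def poly_vec_diff poly_vec_smult basis_vec_eq_poly_vec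
          by (rule ell2_eqI) simp
        moreover have "coeff p' k = 0" if "k \<ge> degree q" for k
          using that i(1) np(3) by (simp add: p'_def)
        ultimately show "y + b *\<^sub>C e \<in> S" unfolding S_def using np(2) by blast
      qed
      then have "x \<in> S" using U by blast
      then obtain n p where np: "x = n + poly_vec p" "n \<in> range A" "\<And>k. k \<ge> degree q \<Longrightarrow> coeff p k = 0"
        by (auto simp: S_def)
      define p' where "p' = pcompose p [:0, of_real r:]"
      have p': "coeff p' k = of_real r ^ k * coeff p k" for k
        by (simp add: p'_def coeff_pcompose_linear)
      have "dilation r (poly_vec p) = poly_vec p'"
        by (rule poly_vec_eqI) (simp add: fps_eq_iff fps_of_dilation[OF r] p')
      moreover have "dilation r (poly_vec p) = dilation r x - dilation r n"
        by (simp add: np(1) dilation_add[OF r])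
      moreover have "dilation r n \<in> M" using np(2) sub by auto
      ultimately have "poly_vec p' \<in> M" using x closed_csubspaceD(5)[OF Mc] by metis
      have "p' = 0"
      proof (rule ccontr)
        assume "p' \<noteq> 0"
        then have "degree q \<le> degree p'" using q_min \<open>poly_vec p' \<in> M\<close> by blast
        then have "coeff p' (degree p') = 0" by (simp add: p' np(3))
        then show False using \<open>p' \<noteq> 0\<close> by simp
      qed
      then have "coeff p k = 0" for k using p'[of k] r by simp
      then have "p = 0" by (simp add: poly_eq_iff)
      then show "x \<in> range A" using np by (simp add: poly_vec_0)
    qed (rule sub)
    \<comment> \<open>By self-adjointness \<open>range A\<close> is the complement of W. So it
      suffices to compare W with V, where dilation is uniformly close to the identity.\<close>
    define W where "W = dilation r ` V"
    have below: "1 / 2 * norm v \<le> norm (dilation r v)" if "v \<in> V" for v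
    proof -
      have "norm v \<le> norm (dilation r v) + norm (v - dilation r v)" by (rule norm_triangle_sub)
      moreover have "\<delta> * norm v \<le> 1 / 2 * norm v" using \<delta>(2) by (intro mult_right_mono) auto
      ultimately show ?thesis using close[OF that] by linarith
    qed
    have "closed W"
      unfolding W_def
      by (rule closed_image_bounded_below[OF bounded_linear_dilation[OF r] closed_csubspace_subspace[OF V(1)]
            closed_csubspaceD(1)[OF V(1)], of "1 / 2"]) (use below in auto)
    moreover have "0 \<in> W" unfolding W_def using closed_csubspaceD(2)[OF V(1)] dilation_0[OF r] by force
    moreover have "x + y \<in> W" if "x \<in> W" "y \<in> W" for x y
      using that closed_csubspaceD(3)[OF V(1)] unfolding W_def by (auto simp flip: dilation_add[OF r])
    moreover have "b *\<^sub>C x \<in> W" if "x \<in> W" for b x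
      using that closed_csubspaceD(4)[OF V(1)] unfolding W_def by (auto simp flip: dilation_scaleC[OF r])
    ultimately have W: "closed_csubspace W" unfolding closed_csubspace_def by blast
    have "ocomp W = range A"
      unfolding range_A V(2)[symmetric] by (auto simp: ocomp_def W_def cinner_dilation[OF r])
    then have "norm (orth_proj (range A) - orth_proj M) = norm (orth_proj W - orth_proj V)"
      using norm_orth_proj_ocomp_diff[OF W V(1)] V(2) by simp
    also have "\<dots> \<le> 2 * (2 * \<delta>)"
    proof (rule orth_proj_gap[OF W V(1)])
      fix w assume "w \<in> W"
      then obtain v where v: "v \<in> V" "w = dilation r v" by (auto simp: W_def)
      have "norm (w - v) \<le> \<delta> * norm v" using close[OF v(1)] v(2) by (simp add: norm_minus_commute)
      also have "\<dots> \<le> \<delta> * (2 * norm w)" using below[OF v(1)] v(2) \<delta>(1) by (intro mult_left_mono) auto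
      finally show "\<exists>v\<in>V. norm (w - v) \<le> 2 * \<delta> * norm w" using v(1) by (auto simp: mult_ac)
    next
      fix v assume v: "v \<in> V"
      have "\<delta> * norm v \<le> 2 * \<delta> * norm v" using \<delta>(1) by (intro mult_right_mono) auto
      then have "norm (v - dilation r v) \<le> 2 * \<delta> * norm v" using close[OF v] by linarith
      then show "\<exists>w\<in>W. norm (v - w) \<le> 2 * \<delta> * norm v" using v by (auto simp: W_def)
    qed (use \<delta> in simp)
    finally have "norm (orth_proj (range A) - orth_proj M) < \<epsilon>" using \<delta>(3) by linarith
    then show "\<exists>M'. norm_stable T M' \<and> norm (orth_proj M' - orth_proj M) < \<epsilon>" using stable by blast
  qed
qed

end

theorem corollary12:
  fixes \<omega> :: "nat \<Rightarrow> real"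
  assumes "\<And>n. \<omega> n \<ge> 1"
    and "(\<lambda>n. \<omega> n powr (1 / real n)) \<longlonglongrightarrow> 1"
    and "\<And>k :: nat. eventually_concave (\<lambda>n. ln (\<omega> n * (real n + 1) powi (- int k)))"
    and "log_convex \<omega>"
    and "filterlim (\<lambda>N. \<Sum>n<N. ln (\<omega> n) / (real n powr (3 / 2) + 1)) at_top sequentially"
  shows "Lat (weighted_shift \<omega>) = Lat_ns (weighted_shift \<omega>)"
proof -
  interpret quasianalytic_weight \<omega>
    using assms by unfold_locales
  show ?thesis using Lat_norm_stable by (auto simp: Lat_ns_def)
qed

end
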